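(* Let $\mathcal{C}$ be a C$^*$-algebra (unital, or not). Then the "sup norm" and the "operator norm" coincide on $\mathcal{B}_0^{\mathcal{C}}(\mathbb{R}^n)$; that is, $\sup_{x\in\mathbb{R}^n}\|f(x)\|_{\mathcal{C}}=\|L_f\|$ for all $f\in\mathcal{B}_0^{\mathcal{C}}(\mathbb{R}^n)$.
   Context: $\mathcal{B}_0^{\mathcal{C}}(\mathbb{R}^n)$ is the $*$-algebra of smooth functions $f\colon\mathbb{R}^n\to\mathcal{C}$ which are bounded together with all their partial derivatives, with the pointwise product and involution. (It is the case $J=0$ of Rieffel's deformed algebras.) $\mathcal{S}^{\mathcal{C}}(\mathbb{R}^n)$ is the space of $\mathcal{C}$-valued Schwartz functions on $\mathbb{R}^n$, and $E_n$ is its completion in the norm $\|f\|_2:=\|\int_{\mathbb{R}^n}f(x)^*f(x)\,dx\|_{\mathcal{C}}^{1/2}$; it is a Hilbert $\mathcal{C}$-module with inner product extending $\langle f,g\rangle=\int_{\mathbb{R}^n}f(x)^*g(x)\,dx$. For $f\in\mathcal{B}_0^{\mathcal{C}}(\mathbb{R}^n)$, $L_f$ is the bounded (adjointable) operator on $E_n$ extending the operator on $\mathcal{S}^{\mathcal{C}}(\mathbb{R}^n)$ given by the iterated integral $L_f(g)(x)=\int_{\mathbb{R}^n}\big(\int_{\mathbb{R}^n}f(x)\,g(x+v)\,e^{2\pi i u\cdot v}\,dv\big)du$, i.e. $L_f(g)(x)=f(x)g(x)$; $\|L_f\|$ is its operator norm on $(E_n,\|\cdot\|_2)$. *)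

theory Defs
  imports "HOL-Analysis.Analysis"
begin

section \<open>C*-algebras\<close>

text \<open>No unit is assumed. Completeness and submultiplicativity of the norm come from
  the classes banach and real_normed_algebra.\<close>

class cstar_algebra = real_normed_algebra + banach +
  fixes scaleC :: "complex \<Rightarrow> 'a \<Rightarrow> 'a"  (infixr \<open>*\<^sub>C\<close> 75)
    and star :: "'a \<Rightarrow> 'a"
  assumes scaleC_add_right: "c *\<^sub>C (a + b) = c *\<^sub>C a + c *\<^sub>C b"
    and scaleC_add_left: "(c + d) *\<^sub>C a = c *\<^sub>C a + d *\<^sub>C a"
    and scaleC_scaleC: "c *\<^sub>C d *\<^sub>C a = (c * d) *\<^sub>C a"
    and scaleC_of_real: "complex_of_real r *\<^sub>C a = r *\<^sub>R a"
    and mult_scaleC_left: "(c *\<^sub>C a) * b = c *\<^sub>C (a * b)"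
    and mult_scaleC_right: "a * (c *\<^sub>C b) = c *\<^sub>C (a * b)"
    and norm_scaleC: "norm (c *\<^sub>C a) = cmod c * norm a"
    and star_add: "star (a + b) = star a + star b"
    and star_scaleC: "star (c *\<^sub>C a) = cnj c *\<^sub>C star a"
    and star_mult: "star (a * b) = star b * star a"
    and star_star: "star (star a) = a"
    and cstar_identity: "norm (star a * a) = (norm a)\<^sup>2"


section \<open>Smooth bounded functions and Schwartz functions\<close>

definition partial_deriv :: "'n \<Rightarrow> (real ^ 'n \<Rightarrow> 'c) \<Rightarrow> real ^ 'n \<Rightarrow> 'c::real_normed_vector" where
  "partial_deriv i f x = vector_derivative (\<lambda>t. f (x + t *\<^sub>R axis i 1)) (at 0)"

fun partial_derivs :: "'n list \<Rightarrow> (real ^ 'n \<Rightarrow> 'c) \<Rightarrow> real ^ 'n \<Rightarrow> 'c::real_normed_vector" where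
  "partial_derivs [] f = f"
| "partial_derivs (i # js) f = partial_deriv i (partial_derivs js f)"

text \<open>All iterated partial derivatives exist and are continuous.\<close>

definition smooth :: "(real ^ 'n \<Rightarrow> 'c::real_normed_vector) \<Rightarrow> bool" where
  "smooth f \<longleftrightarrow> (\<forall>js. continuous_on UNIV (partial_derivs js f) \<and>
     (\<forall>i x. (\<lambda>t. partial_derivs js f (x + t *\<^sub>R axis i 1)) differentiable (at 0)))"

definition smooth_bounded :: "(real ^ 'n \<Rightarrow> 'c::cstar_algebra) set" where
  "smooth_bounded = {f. smooth f \<and> (\<forall>js. bounded (range (partial_derivs js f)))}"

definition schwartz :: "(real ^ 'n \<Rightarrow> 'c::cstar_algebra) set" where
  "schwartz = {g. smooth g \<and>
     (\<forall>k js. bounded (range (\<lambda>x. norm x ^ k *\<^sub>R partial_derivs js g x)))}"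

text \<open>The integrals below are Henstock-Kurzweil integrals, because the Bochner integral of
  the library requires a second countable codomain. For the continuous, rapidly decreasing
  integrands occurring here both notions agree.\<close>

definition schwartz_inner ::
    "(real ^ 'n \<Rightarrow> 'c) \<Rightarrow> (real ^ 'n \<Rightarrow> 'c) \<Rightarrow> 'c::cstar_algebra" where
  "schwartz_inner f g = integral UNIV (\<lambda>x. star (f x) * g x)"

definition norm2 :: "(real ^ 'n \<Rightarrow> 'c::cstar_algebra) \<Rightarrow> real" where
  "norm2 f = sqrt (norm (schwartz_inner f f))"


section \<open>The completion of the Schwartz space\<close>

text \<open>The completion is realised as the set of classes of Cauchy sequences of Schwartz
  functions modulo null sequences.\<close>

type_synonym ('c, 'n) schwartz_seq = "nat \<Rightarrow> real ^ 'n \<Rightarrow> 'c"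

definition cauchy_seqs :: "('c::cstar_algebra, 'n::finite) schwartz_seq set" where
  "cauchy_seqs = {X. (\<forall>k. X k \<in> schwartz) \<and>
     (\<forall>e>0. \<exists>N. \<forall>j\<ge>N. \<forall>k\<ge>N. norm2 (\<lambda>x. X j x - X k x) < e)}"

definition equiv_seqs ::
    "(('c::cstar_algebra, 'n::finite) schwartz_seq \<times> ('c, 'n) schwartz_seq) set" where
  "equiv_seqs = {(X, Y). X \<in> cauchy_seqs \<and> Y \<in> cauchy_seqs \<and>
     (\<lambda>k. norm2 (\<lambda>x. X k x - Y k x)) \<longlonglongrightarrow> 0}"

definition E :: "('c::cstar_algebra, 'n::finite) schwartz_seq set set" where
  "E = cauchy_seqs // equiv_seqs"

definition embed_E :: "(real ^ 'n \<Rightarrow> 'c) \<Rightarrow> ('c::cstar_algebra, 'n::finite) schwartz_seq set" where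
  "embed_E g = equiv_seqs `` {\<lambda>k. g}"

definition add_E :: "('c::cstar_algebra, 'n::finite) schwartz_seq set \<Rightarrow>
    ('c, 'n) schwartz_seq set \<Rightarrow> ('c, 'n) schwartz_seq set" where
  "add_E \<xi> \<eta> = (\<Union>X\<in>\<xi>. \<Union>Y\<in>\<eta>. equiv_seqs `` {\<lambda>k x. X k x + Y k x})"

definition scaleC_E :: "complex \<Rightarrow> ('c::cstar_algebra, 'n::finite) schwartz_seq set \<Rightarrow>
    ('c, 'n) schwartz_seq set" where
  "scaleC_E c \<xi> = (\<Union>X\<in>\<xi>. equiv_seqs `` {\<lambda>k x. c *\<^sub>C X k x})"

definition inner_E :: "('c::cstar_algebra, 'n::finite) schwartz_seq set \<Rightarrow>
    ('c, 'n) schwartz_seq set \<Rightarrow> 'c" where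
  "inner_E \<xi> \<eta> = (THE c. \<forall>X\<in>\<xi>. \<forall>Y\<in>\<eta>. (\<lambda>k. schwartz_inner (X k) (Y k)) \<longlonglongrightarrow> c)"

definition norm_E :: "('c::cstar_algebra, 'n::finite) schwartz_seq set \<Rightarrow> real" where
  "norm_E \<xi> = (THE r. \<forall>X\<in>\<xi>. (\<lambda>k. norm2 (X k)) \<longlonglongrightarrow> r)"


section \<open>Operators on the completion\<close>

definition linear_E :: "(('c::cstar_algebra, 'n::finite) schwartz_seq set \<Rightarrow>
    ('c, 'n) schwartz_seq set) \<Rightarrow> bool" where
  "linear_E T \<longleftrightarrow> (\<forall>\<xi>\<in>E. \<forall>\<eta>\<in>E. T (add_E \<xi> \<eta>) = add_E (T \<xi>) (T \<eta>)) \<and>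
     (\<forall>c. \<forall>\<xi>\<in>E. T (scaleC_E c \<xi>) = scaleC_E c (T \<xi>))"

definition bounded_E :: "(('c::cstar_algebra, 'n::finite) schwartz_seq set \<Rightarrow>
    ('c, 'n) schwartz_seq set) \<Rightarrow> bool" where
  "bounded_E T \<longleftrightarrow> (\<exists>B. \<forall>\<xi>\<in>E. norm_E (T \<xi>) \<le> B * norm_E \<xi>)"

definition adjointable_E :: "(('c::cstar_algebra, 'n::finite) schwartz_seq set \<Rightarrow>
    ('c, 'n) schwartz_seq set) \<Rightarrow> bool" where
  "adjointable_E T \<longleftrightarrow>
     (\<exists>S \<in> E \<rightarrow> E. \<forall>\<xi>\<in>E. \<forall>\<eta>\<in>E. inner_E (T \<xi>) \<eta> = inner_E \<xi> (S \<eta>))"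

text \<open>Operators are extensional functions on the carrier, so that they are determined
  by their values there.\<close>

definition operators_E :: "(('c::cstar_algebra, 'n::finite) schwartz_seq set \<Rightarrow>
    ('c, 'n) schwartz_seq set) set" where
  "operators_E = {T \<in> E \<rightarrow>\<^sub>E E. linear_E T \<and> bounded_E T \<and> adjointable_E T}"

definition opnorm_E :: "(('c::cstar_algebra, 'n::finite) schwartz_seq set \<Rightarrow>
    ('c, 'n) schwartz_seq set) \<Rightarrow> real" where
  "opnorm_E T = (SUP \<xi> \<in> {\<xi> \<in> E. norm_E \<xi> \<le> 1}. norm_E (T \<xi>))"

definition L_schwartz :: "(real ^ 'n \<Rightarrow> 'c::cstar_algebra) \<Rightarrow>
    (real ^ 'n \<Rightarrow> 'c) \<Rightarrow> real ^ 'n \<Rightarrow> 'c" where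
  "L_schwartz f g x = integral UNIV (\<lambda>u. integral UNIV (\<lambda>v.
     exp (2 * complex_of_real pi * \<i> * complex_of_real (u \<bullet> v)) *\<^sub>C (f x * g (x + v))))"

definition L :: "(real ^ 'n \<Rightarrow> 'c) \<Rightarrow>
    ('c::cstar_algebra, 'n::finite) schwartz_seq set \<Rightarrow> ('c, 'n) schwartz_seq set" where
  "L f = (THE T. T \<in> operators_E \<and> (\<forall>g\<in>schwartz. T (embed_E g) = embed_E (L_schwartz f g)))"

end

(*
  For Schwartz g the iterated integral is f(x) g(x), by Fourier inversion, so L_f is the extension of
  pointwise multiplication by f; density of the Schwartz functions makes this extension unique.

  Upper bound: with M = sup |f|, the element M^2 g(x)* g(x) - g(x)* f(x)* f(x) g(x) is positive for
  every x, hence so is its integral, and the norm is monotone on positive elements. Positivity is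
  handled in the unitization, where h is positive iff h = h* and |t - h| <= t for some t >= 0; square
  roots come from an iteration, and that a* a is positive is the theorem of Fukamiya and Kaplansky.
  Since the order is defined by norm inequalities, integrals of positive functions are positive.

  Lower bound: apply L_f to Gaussians concentrating at x0, times f(x0)*. The quotient of the squared
  norms tends to |f(x0) f(x0)*|^2 / |f(x0)*|^2 = |f(x0)|^2.

  Fourier inversion is for Banach space valued Henstock-Kurzweil integrals: Gaussian regularisation
  and Fubini's theorem, where all integrands are dominated by products of the weights
  1 / (1 + x_i^2).
*)
theory Submission
  imports Defs "HOL-Probability.Characteristic_Functions" "HOL-Probability.Sinc_Integral"
begin

section \<open>Elementary C*-algebra\<close>

text \<open>The module norm is the norm of an integral in C, not the integral of a norm, so |f g| <=
  M |g| pointwise does not by itself bound \<open>norm2\<close>. The comparison has to be made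
  between elements of C, in the order. This is why so much of the proof is about positivity, which
  is built without spectrum or functional calculus. The same order carries Cauchy-Schwarz, hence the
  triangle inequality and the well-definedness of norm and inner product on the completion.

  When C may lack a unit, a scalar Gaussian is not a C-valued function and needs a coefficient. The
  coefficient \<open>star (f x0)\<close> is one at which left multiplication by \<open>f x0\<close>
  attains its norm.

  \<open>L\<close> is a definite description: nothing can be said about \<open>L f\<close> before
  one operator with the required properties, adjointability included, is exhibited and shown to be
  the only one.\<close>

lemma scaleC_zero_right [simp]: "c *\<^sub>C (0::'a::cstar_algebra) = 0"
  using norm_scaleC[of c "0::'a"] by simp

lemma scaleC_zero_left [simp]: "0 *\<^sub>C (a::'a::cstar_algebra) = 0"
  using norm_scaleC[of 0 a] by simp

lemma scaleC_one [simp]: "1 *\<^sub>C (a::'a::cstar_algebra) = a"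
  using scaleC_of_real[of 1 a] by simp

lemma scaleC_minus_right: "c *\<^sub>C (- a) = - (c *\<^sub>C (a::'a::cstar_algebra))"
  using scaleC_add_right[of c a "- a"] by (simp add: eq_neg_iff_add_eq_0 add.commute)

lemma scaleC_minus_left: "(- c) *\<^sub>C a = - (c *\<^sub>C (a::'a::cstar_algebra))"
  using scaleC_add_left[of c "- c" a] by (simp add: eq_neg_iff_add_eq_0 add.commute)

lemma scaleC_diff_right: "c *\<^sub>C (a - b) = c *\<^sub>C a - c *\<^sub>C (b::'a::cstar_algebra)"
  using scaleC_add_right[of c a "- b"] by (simp add: scaleC_minus_right)

lemma scaleC_diff_left: "(c - d) *\<^sub>C a = c *\<^sub>C a - d *\<^sub>C (a::'a::cstar_algebra)"
  using scaleC_add_left[of c "- d" a] by (simp add: scaleC_minus_left)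

lemma scaleC_scaleR_left: "(r *\<^sub>R c) *\<^sub>C a = r *\<^sub>R (c *\<^sub>C (a::'a::cstar_algebra))"
  by (metis scaleC_of_real scaleC_scaleC scaleR_conv_of_real)

lemma scaleC_scaleR_right: "c *\<^sub>C (r *\<^sub>R a) = r *\<^sub>R (c *\<^sub>C (a::'a::cstar_algebra))"
  by (metis mult.commute scaleC_of_real scaleC_scaleC)

lemma bounded_bilinear_scaleC: "bounded_bilinear ((*\<^sub>C) :: complex \<Rightarrow> 'a::cstar_algebra \<Rightarrow> 'a)"
  by (rule bounded_bilinear.intro)
    (auto simp: scaleC_add_right scaleC_add_left scaleC_scaleR_left scaleC_scaleR_right norm_scaleC
      intro!: exI[of _ 1])

lemmas bounded_linear_scaleC_right = bounded_bilinear.bounded_linear_right[OF bounded_bilinear_scaleC]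
lemmas bounded_linear_scaleC_left = bounded_bilinear.bounded_linear_left[OF bounded_bilinear_scaleC]

lemma star_scaleR: "star (r *\<^sub>R a) = r *\<^sub>R star (a::'a::cstar_algebra)"
  by (metis scaleC_of_real star_scaleC complex_cnj_complex_of_real)

lemma star_zero [simp]: "star (0::'a::cstar_algebra) = 0"
  using star_scaleR[of 0 "0::'a"] by simp

lemma star_minus: "star (- a) = - star (a::'a::cstar_algebra)"
  using star_scaleR[of "-1" a] by simp

lemma star_diff: "star (a - b) = star a - star (b::'a::cstar_algebra)"
  using star_add[of a "- b"] by (simp add: star_minus)

text \<open>The involution is isometric although no axiom says so: |b|^2 is the norm of
  \<open>star b * b\<close>, which is at most |star b| |b|, and \<open>b\<close> may be replaced by
  \<open>star b\<close>.\<close>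

lemma norm_star [simp]: "norm (star a) = norm (a::'a::cstar_algebra)"
proof -
  have le: "norm b \<le> norm (star b)" for b :: 'a
  proof -
    have "norm b * norm b \<le> norm (star b) * norm b"
      using cstar_identity[of b] norm_mult_ineq[of "star b" b] by (simp add: power2_eq_square)
    then show ?thesis
      by (cases "b = 0") auto
  qed
  show ?thesis
    using le[of a] le[of "star a"] by (simp add: star_star)
qed

lemma norm_star_mult: "norm (star a * a) = norm a * norm (a::'a::cstar_algebra)"
  by (simp add: cstar_identity power2_eq_square)

lemma norm_square_selfadjoint:
  "star (a::'a::cstar_algebra) = a \<Longrightarrow> norm (a * a) = norm a * norm a"
  using norm_star_mult[of a] by simp

lemma selfadjoint_square_eq_0: "star (a::'a::cstar_algebra) = a \<Longrightarrow> a * a = 0 \<Longrightarrow> a = 0"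
  using norm_square_selfadjoint[of a] by simp

lemma bounded_linear_star: "bounded_linear (star :: 'a::cstar_algebra \<Rightarrow> 'a)"
  by (rule bounded_linear_intro[of _ 1]) (auto simp: star_add star_scaleR)

lemmas continuous_on_star = bounded_linear.continuous_on[OF bounded_linear_star]
lemmas tendsto_star = bounded_linear.tendsto[OF bounded_linear_star]

section \<open>Positive elements of a unital C*-algebra\<close>

class cstar_algebra_1 = cstar_algebra + real_normed_algebra_1

lemma star_one [simp]: "star (1::'a::cstar_algebra_1) = 1"
  by (metis mult.right_neutral mult_1 star_mult star_star)

lemma star_of_real [simp]: "star (of_real t :: 'a::cstar_algebra_1) = of_real t"
  by (simp add: of_real_def star_scaleR)

lemma star_power: "star (a ^ n) = star (a::'a::cstar_algebra_1) ^ n"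
  by (induction n) (auto simp: star_mult power_commutes)

text \<open>The iteration \<open>w \<mapsto> (x + w\<^sup>2) / 2\<close> has limit \<open>1 - sqrt (1 - x)\<close>, and its increments are
  dominated by those of the real iteration with \<open>x = 1\<close>, which is increasing and bounded.\<close>

lemma sqrt_one_minus:
  fixes x :: "'a::cstar_algebra_1"
  assumes x: "norm x \<le> 1" "star x = x"
  obtains k where "star k = k" "k * k = 1 - x" "norm (1 - k) \<le> 1"
    "\<And>z. z * x = x * z \<Longrightarrow> z * k = k * z"
proof -
  define y where "y n = ((\<lambda>w. (1/2) *\<^sub>R (x + w * w)) ^^ n) 0" for n
  define r :: "nat \<Rightarrow> real" where "r n = ((\<lambda>w. (1/2) * (1 + w * w)) ^^ n) 0" for n
  have y0: "y 0 = 0" and yS: "y (Suc n) = (1/2) *\<^sub>R (x + y n * y n)" for n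
    by (auto simp: y_def)
  have r0: "r 0 = 0" and rS: "r (Suc n) = (1/2) * (1 + r n * r n)" for n
    by (auto simp: r_def)
  have r01: "0 \<le> r n \<and> r n \<le> 1" for n
  proof (induction n)
    case (Suc n)
    then have "r n * r n \<le> 1 * 1" by (intro mult_mono) auto
    then show ?case using Suc by (auto simp: rS)
  qed (simp add: r0)
  have rmono: "r n \<le> r (Suc n)" for n
    using zero_le_power2[of "r n - 1"] by (simp add: rS power2_eq_square algebra_simps)
  \<comment> \<open>Commutation with \<open>x\<close> passes to all iterates and to the limit; the
    later arguments that multiply square roots rest on it.\<close>
  have comm: "z * y n = y n * z" if "z * x = x * z" for z n
  proof (induction n)
    case (Suc n)
    have "z * (y n * y n) = (y n * y n) * z"
      by (metis Suc.IH mult.assoc)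
    then show ?case by (simp add: yS distrib_left distrib_right that)
  qed (simp add: y0)
  have commy: "y m * y n = y n * y m" for m n
  proof -
    have "y m * x = x * y m" using comm[of x m] by simp
    then show ?thesis by (rule comm)
  qed
  have ny: "norm (y n) \<le> r n" for n
  proof (induction n)
    case (Suc n)
    have "norm (x + y n * y n) \<le> 1 + r n * r n"
      using x(1) norm_mult_ineq[of "y n" "y n"] mult_mono[OF Suc Suc] r01[of n]
        norm_triangle_ineq[of x "y n * y n"] by auto
    then show ?case by (simp add: yS rS)
  qed (simp add: y0 r0)
  have dy: "norm (y (Suc n) - y n) \<le> r (Suc n) - r n" for n
  proof (induction n)
    case 0
    show ?case using x by (simp add: y0 r0 yS rS)
  next
    case (Suc n)
    \<comment> \<open>The iterates commute with each other, so the difference of squares factors.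
      The same factorisation of the real iteration closes the induction.\<close>
    have eq: "y (Suc (Suc n)) - y (Suc n) = (1/2) *\<^sub>R ((y (Suc n) - y n) * (y (Suc n) + y n))"
    proof -
      have "y (Suc (Suc n)) - y (Suc n) =
          (1/2) *\<^sub>R (x + y (Suc n) * y (Suc n)) - (1/2) *\<^sub>R (x + y n * y n)"
        by (rule arg_cong2[where f = "(-)", OF yS[of "Suc n"] yS[of n]])
      also have "\<dots> = (1/2) *\<^sub>R (y (Suc n) * y (Suc n) - y n * y n)"
        by (simp add: scaleR_diff_right[symmetric])
      also have "y (Suc n) * y (Suc n) - y n * y n = (y (Suc n) - y n) * (y (Suc n) + y n)"
        by (simp only: distrib_left left_diff_distrib commy[of n "Suc n"]) simp
      finally show ?thesis .
    qed
    have "norm ((y (Suc n) - y n) * (y (Suc n) + y n)) \<le> (r (Suc n) - r n) * (r (Suc n) + r n)"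
      using Suc norm_triangle_ineq[of "y (Suc n)" "y n"] ny[of n] ny[of "Suc n"] r01 rmono
      by (intro order_trans[OF norm_mult_ineq] mult_mono) auto
    also have "\<dots> = 2 * (r (Suc (Suc n)) - r (Suc n))"
    proof -
      have "2 * r (Suc (Suc n)) = 1 + r (Suc n) * r (Suc n)" "2 * r (Suc n) = 1 + r n * r n"
        using rS[of n] rS[of "Suc n"] by auto
      then show ?thesis by algebra
    qed
    finally show ?case by (simp add: eq)
  qed
  have dy': "norm (y (n + m) - y n) \<le> r (n + m) - r n" for n m
  proof (induction m)
    case (Suc m)
    have "norm (y (n + Suc m) - y n) \<le> norm (y (Suc (n + m)) - y (n + m)) + norm (y (n + m) - y n)"
      using norm_triangle_ineq[of "y (Suc (n + m)) - y (n + m)" "y (n + m) - y n"] by simp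
    with Suc dy[of "n + m"] show ?case by simp
  qed simp
  have "Bseq r" using r01 by (intro BseqI'[of _ 1]) auto
  moreover have "incseq r" using rmono by (rule incseq_SucI)
  ultimately have "Cauchy r"
    by (auto intro: convergent_Cauchy Bseq_monoseq_convergent incseq_imp_monoseq)
  have "Cauchy y"
  proof (rule CauchyI')
    fix e :: real assume "0 < e"
    then obtain M where M: "\<And>m n. m \<ge> M \<Longrightarrow> n \<ge> M \<Longrightarrow> norm (r m - r n) < e"
      using \<open>Cauchy r\<close> by (metis CauchyD)
    show "\<exists>M. \<forall>m\<ge>M. \<forall>n>m. dist (y m) (y n) < e"
    proof (intro exI[of _ M] allI impI)
      fix m n assume "M \<le> m" "m < n"
      then have "norm (y n - y m) \<le> r n - r m" "norm (r n - r m) < e"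
        using dy'[of m "n - m"] M[of n m] by auto
      then show "dist (y m) (y n) < e" by (simp add: dist_norm norm_minus_commute)
    qed
  qed
  then obtain l where l: "y \<longlonglongrightarrow> l"
    using Cauchy_convergent convergentD by blast
  have "(\<lambda>n. y (Suc n)) \<longlonglongrightarrow> (1/2) *\<^sub>R (x + l * l)"
    unfolding yS by (intro tendsto_intros l)
  with l have leq: "l = (1/2) *\<^sub>R (x + l * l)"
    using LIMSEQ_Suc LIMSEQ_unique by blast
  have "norm l \<le> 1"
    using r01 ny by (intro LIMSEQ_le_const2[OF tendsto_norm[OF l]]) (meson order_trans)
  have stary: "star (y n) = y n" for n
    by (induction n) (auto simp: y0 yS star_add star_scaleR star_mult x)
  have starl: "star l = l"
    using tendsto_star[OF l] l LIMSEQ_unique unfolding stary by blast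
  have comml: "z * l = l * z" if "z * x = x * z" for z
  proof (rule LIMSEQ_unique)
    show "(\<lambda>n. z * y n) \<longlonglongrightarrow> z * l" by (intro tendsto_intros l)
    show "(\<lambda>n. z * y n) \<longlonglongrightarrow> l * z" unfolding comm[OF that] by (intro tendsto_intros l)
  qed
  have "l + l = x + l * l"
    using arg_cong[OF leq, of "\<lambda>z. 2 *\<^sub>R z"] by (simp add: scaleR_2)
  then have "(1 - l) * (1 - l) = 1 - x"
    by (simp add: algebra_simps)
  moreover have "z * (1 - l) = (1 - l) * z" if "z * x = x * z" for z
    using comml[OF that] by (simp add: algebra_simps)
  moreover have "star (1 - l) = 1 - l" "norm (1 - (1 - l)) \<le> 1"
    using starl \<open>norm l \<le> 1\<close> by (auto simp: star_diff)
  ultimately show thesis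
    using that by blast
qed

text \<open>For selfadjoint \<open>h\<close> the norm bound says that the spectrum lies in the
  interval from 0 to 2t.\<close>

definition pos :: "'a::cstar_algebra_1 \<Rightarrow> bool" where
  "pos h \<longleftrightarrow> star h = h \<and> (\<exists>t\<ge>0. norm (of_real t - h) \<le> t)"

lemma posI: "star h = h \<Longrightarrow> norm (of_real t - h) \<le> t \<Longrightarrow> pos h"
  unfolding pos_def by (meson norm_ge_zero order_trans)

lemma pos_selfadjoint: "pos h \<Longrightarrow> star h = h"
  by (simp add: pos_def)

lemma pos_of_real: "0 \<le> t \<Longrightarrow> pos (of_real t)"
  by (rule posI[of _ t]) auto

lemma pos_zero [simp]: "pos 0"
  using pos_of_real[of 0] by simp

lemma pos_add: "pos a \<Longrightarrow> pos b \<Longrightarrow> pos (a + b)"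
proof -
  assume "pos a" "pos b"
  then obtain s t where st: "norm (of_real s - a) \<le> s" "norm (of_real t - b) \<le> t"
    "star a = a" "star b = b" by (auto simp: pos_def)
  have "norm (of_real (s + t) - (a + b)) \<le> s + t"
    using st norm_triangle_ineq[of "of_real s - a" "of_real t - b"] by (simp add: algebra_simps)
  with st show ?thesis by (intro posI[of _ "s + t"]) (auto simp: star_add)
qed

lemma pos_scaleR: "pos a \<Longrightarrow> 0 \<le> r \<Longrightarrow> pos (r *\<^sub>R a)"
proof -
  assume "pos a" "0 \<le> r"
  then obtain s where s: "norm (of_real s - a) \<le> s" "star a = a" by (auto simp: pos_def)
  have "norm (of_real (r * s) - r *\<^sub>R a) = r * norm (of_real s - a)"
    using \<open>0 \<le> r\<close> by (simp add: of_real_def scaleR_scaleR[symmetric] scaleR_diff_right[symmetric] del: scaleR_scaleR)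
  then show ?thesis
    using s \<open>0 \<le> r\<close> by (intro posI[of _ "r * s"]) (auto simp: star_scaleR mult_left_mono)
qed

lemma pos_norm_minus: "star h = h \<Longrightarrow> norm h \<le> s \<Longrightarrow> pos (of_real s - h)"
  by (rule posI[of _ s]) (auto simp: star_diff)

text \<open>The iteration is applied to x = 1 - h/t, of norm at most 1, so that 1 - x = h/t. The
  commutation clause stands in for the fact that the root is a limit of polynomials in
  \<open>h\<close>.\<close>

lemma pos_sqrt:
  assumes "pos h"
  obtains k where "pos k" "k * k = h" "\<And>z. z * h = h * z \<Longrightarrow> z * k = k * z"
proof -
  obtain t where t: "t \<ge> 0" "norm (of_real t - h) \<le> t" and h: "star h = h"
    using assms by (auto simp: pos_def)
  show thesis
  proof (cases "t = 0")
    case True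
    then have "h = 0" using t by simp
    show thesis by (rule that[of 0]) (auto simp: \<open>h = 0\<close>)
  next
    case False
    with t have tp: "t > 0" by simp
    define x where "x = (1/t) *\<^sub>R (of_real t - h)"
    have "norm x \<le> 1" "star x = x"
      using t tp h by (auto simp: x_def star_scaleR star_diff divide_le_eq_1)
    then obtain k where k: "star k = k" "k * k = 1 - x" "norm (1 - k) \<le> 1"
      "\<And>z. z * x = x * z \<Longrightarrow> z * k = k * z" using sqrt_one_minus by blast
    have x1: "1 - x = (1/t) *\<^sub>R h"
      using tp by (simp add: x_def of_real_def algebra_simps)
    have "pos k" using k(1,3) by (intro posI[of _ 1]) auto
    show thesis
    proof (rule that[of "sqrt t *\<^sub>R k"])
      show "pos (sqrt t *\<^sub>R k)" using \<open>pos k\<close> t by (intro pos_scaleR) auto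
      show "sqrt t *\<^sub>R k * sqrt t *\<^sub>R k = h" using tp by (simp add: k(2) x1)
      fix z assume "z * h = h * z"
      then have "z * x = x * z" by (simp add: x_def algebra_simps of_real_def)
      then have "z * k = k * z" by (rule k(4))
      then show "z * sqrt t *\<^sub>R k = sqrt t *\<^sub>R k * z" by simp
    qed
  qed
qed

text \<open>Up to the factor s, u = h + i w is a unitary with real part h: commutation cancels the
  cross terms of \<open>star u * u\<close>, so |u| = s, and h is half of
  \<open>u + star u\<close>.\<close>

lemma norm_le_of_unitary_part:
  fixes h w :: "'a::cstar_algebra_1"
  assumes "star h = h" "star w = w" "h * w = w * h" "h * h + w * w = of_real (s * s)" "0 \<le> s"
  shows "norm h \<le> s"
proof -
  define u where "u = h + \<i> *\<^sub>C w"
  have su: "star u = h - \<i> *\<^sub>C w"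
    by (simp add: u_def star_add star_scaleC assms scaleC_minus_left)
  have "star u * u = h * h + w * w"
    unfolding su unfolding u_def
    by (simp add: algebra_simps mult_scaleC_left mult_scaleC_right scaleC_scaleC scaleC_minus_left scaleC_diff_right assms(3))
  then have "norm u * norm u = s * s"
    using norm_star_mult[of u] assms by (simp only: norm_of_real) simp
  then have "norm u = s" using assms(5) by (metis norm_ge_zero real_sqrt_abs2 abs_of_nonneg)
  have "2 *\<^sub>R h = u + star u" by (simp add: su) (simp add: u_def scaleR_2)
  then have "2 * norm h \<le> 2 * s"
    using norm_triangle_ineq[of u "star u"] \<open>norm u = s\<close> by (metis norm_scaleR norm_star abs_numeral mult_2)
  then show ?thesis by simp
qed

text \<open>Positivity of the square amounts to |1 - k k| <= 1. If w is the square root of 1 - k k,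
  then w w + k k = 1, so w is the real part of a unitary and |w w| <= 1.\<close>

lemma pos_square_of_norm_le_1:
  fixes k :: "'a::cstar_algebra_1"
  assumes k: "star k = k" "norm k \<le> 1"
  shows "pos (k * k)"
proof -
  have "norm (k * k) \<le> 1"
    using norm_square_selfadjoint[OF k(1)] k(2) by (simp add: mult_le_one)
  then have "pos (of_real 1 - k * k)"
    using k by (intro pos_norm_minus) (auto simp: star_mult)
  then obtain w where w: "pos w" "w * w = 1 - k * k"
    "\<And>z. z * (1 - k * k) = (1 - k * k) * z \<Longrightarrow> z * w = w * z"
    using pos_sqrt by (metis of_real_1)
  have "k * w = w * k" by (rule w(3)) (simp add: algebra_simps)
  then have "norm w \<le> 1"
    using w(1,2) k by (intro norm_le_of_unitary_part[of w k]) (auto simp: pos_def)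
  then have "norm (w * w) \<le> 1"
    using norm_mult_ineq[of w w] by (meson mult_le_one norm_ge_zero order_trans)
  then show ?thesis
    using k w(1,2) by (intro posI[of _ 1]) (auto simp: star_mult)
qed

lemma pos_square:
  fixes k :: "'a::cstar_algebra_1"
  assumes k: "star k = k"
  shows "pos (k * k)"
proof (cases "k = 0")
  case False
  define l where "l = (1 / norm k) *\<^sub>R k"
  have "pos (l * l)" using False k
    by (intro pos_square_of_norm_le_1) (auto simp: l_def star_scaleR)
  then have "pos ((norm k * norm k) *\<^sub>R (l * l))" by (rule pos_scaleR) simp
  then show ?thesis using False by (simp add: l_def)
qed simp

text \<open>The roots k of a and l of b commute as well, so a b is the square of the selfadjoint
  element k l.\<close>

lemma pos_mult_commuting:
  assumes "pos a" "pos b" "a * b = b * a"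
  shows "pos (a * b)"
proof -
  obtain k where k: "pos k" "k * k = a" "\<And>z. z * a = a * z \<Longrightarrow> z * k = k * z"
    using pos_sqrt[OF assms(1)] by metis
  obtain l where l: "pos l" "l * l = b" "\<And>z. z * b = b * z \<Longrightarrow> z * l = l * z"
    using pos_sqrt[OF assms(2)] by metis
  have "b * k = k * b" by (rule k(3)) (simp add: assms(3))
  then have kl: "k * l = l * k" by (intro l(3)) simp
  have "star (k * l) = k * l"
    using k(1) l(1) kl by (simp add: star_mult pos_def)
  moreover have "(k * l) * (k * l) = a * b"
    by (metis kl k(2) l(2) mult.assoc)
  ultimately show ?thesis using pos_square[of "k * l"] by simp
qed

text \<open>The way back from order bounds to a norm bound: (s - h)(s + h) = s^2 - h^2 is positive,
  and its root completes h to s times a unitary.\<close>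

lemma norm_le_of_pos:
  fixes h :: "'a::cstar_algebra_1"
  assumes "pos (of_real s - h)" "pos (of_real s + h)" "star h = h" "0 \<le> s"
  shows "norm h \<le> s"
proof -
  have "(of_real s - h) * (of_real s + h) = of_real (s * s) - h * h"
    and "(of_real s + h) * (of_real s - h) = of_real (s * s) - h * h"
    by (auto simp: algebra_simps of_real_def)
  then have "pos (of_real (s * s) - h * h)"
    using pos_mult_commuting[OF assms(1,2)] by simp
  then obtain w where w: "pos w" "w * w = of_real (s * s) - h * h"
    "\<And>z. z * (of_real (s * s) - h * h) = (of_real (s * s) - h * h) * z \<Longrightarrow> z * w = w * z"
    using pos_sqrt by metis
  have "h * w = w * h" by (rule w(3)) (simp add: algebra_simps of_real_def)
  then show ?thesis
    using w(1,2) assms by (intro norm_le_of_unitary_part[of h w]) (auto simp: pos_def)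
qed

text \<open>The scalar |q| dominates q, hence p, in the order, and an order bound by a scalar is a
  norm bound.\<close>

lemma norm_mono_pos:
  assumes "pos p" "pos (q - p)"
  shows "norm p \<le> norm q"
proof -
  have q: "star q = q" using assms pos_add[of p "q - p"] by (simp add: pos_def)
  have "pos (of_real (norm q) - q)" by (rule pos_norm_minus[OF q]) simp
  from pos_add[OF this assms(2)] have "pos (of_real (norm q) - p)" by simp
  moreover have "pos (of_real (norm q) + p)" using assms by (intro pos_add pos_of_real) auto
  ultimately show ?thesis using assms by (intro norm_le_of_pos) (auto simp: pos_def)
qed

lemma pos_antisym: "pos p \<Longrightarrow> pos (- p) \<Longrightarrow> p = 0"
  using norm_le_of_pos[of 0 p] by (simp add: pos_def)

section \<open>The theorem of Fukamiya and Kaplansky\<close>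

lemma norm_power_two_power:
  fixes z :: "'a::cstar_algebra_1"
  assumes "star z = z"
  shows "norm (z ^ (2 ^ k)) = norm z ^ (2 ^ k)"
proof (induction k)
  case (Suc k)
  have "norm (z ^ (2 ^ k) * z ^ (2 ^ k)) = norm (z ^ (2 ^ k)) * norm (z ^ (2 ^ k))"
    by (rule norm_square_selfadjoint) (simp add: star_power assms)
  moreover have "z ^ (2 ^ Suc k) = z ^ (2 ^ k) * z ^ (2 ^ k)"
    by (metis mult_2 power_Suc power_add)
  moreover have "norm z ^ (2 ^ Suc k) = norm z ^ (2 ^ k) * norm z ^ (2 ^ k)"
    by (metis mult_2 power_Suc power_add)
  ultimately show ?case by (simp only: Suc)
qed simp

text \<open>Bernoulli's inequality for c^(2^k) yields only growth linear in 2^k, which is no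
  contradiction. Squaring it, that is, passing to the exponent 2^(k+1), makes the growth quadratic
  in 2^k.\<close>

lemma le_one_of_linear_growth:
  fixes c K :: real
  assumes c: "\<And>k::nat. c ^ (2 ^ k) \<le> 1 + 2 ^ k * K"
  shows "c \<le> 1"
proof (rule ccontr)
  assume "\<not> c \<le> 1"
  then have "c > 1" by simp
  define d where "d = c - 1"
  have d: "d > 0" using \<open>c > 1\<close> by (simp add: d_def)
  have ineq: "2 * (2 ^ k * d) + (2 ^ k * d)^2 \<le> 2 ^ k * (2 * K)" for k :: nat
  proof -
    have "1 + 2 ^ k * d \<le> c ^ (2 ^ k)"
      using Bernoulli_inequality[of d "2 ^ k"] d by (simp add: d_def)
    then have "(1 + 2 ^ k * d)^2 \<le> (c ^ (2 ^ k))^2"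
      using d by (intro power_mono) auto
    also have "\<dots> = c ^ (2 ^ Suc k)" by (simp add: power_mult[symmetric] mult.commute)
    also have "\<dots> \<le> 1 + 2 ^ Suc k * K" by (rule c)
    finally show ?thesis by (simp add: power2_eq_square algebra_simps)
  qed
  have bound: "2 ^ k * d^2 \<le> 2 * K" for k :: nat
  proof -
    have "2 ^ k * (2 ^ k * d^2) \<le> 2 ^ k * (2 * K)"
    proof -
      have "(2 ^ k * d)^2 = 2 ^ k * (2 ^ k * d^2)" by (simp add: power2_eq_square)
      moreover have "0 \<le> 2 * (2 ^ k * d)" using d by simp
      ultimately show ?thesis using ineq[of k] by linarith
    qed
    then show ?thesis by simp
  qed
  obtain k :: nat where "2 * K / d^2 < 2 ^ k" using real_arch_pow[of 2] by auto
  with bound[of k] d show False by (simp add: field_simps)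
qed

text \<open>The usual proof compares the spectra of \<open>star b * b\<close> and
  \<open>b * star b\<close>. Here associativity does the work: it gives
  \<open>star b * q = (1 + p) * star b\<close> for the \<open>p\<close> and \<open>q\<close> below,
  and |q| <= 1 makes the powers of \<open>1 + p\<close> grow at most linearly. Since
  \<open>1 + p\<close> is selfadjoint, its power with exponent 2^k has norm |1 + p|^(2^k), in place
  of a spectral radius formula. This forces |1 + p| <= 1, hence \<open>pos (- p)\<close> and
  \<open>p = 0\<close>.\<close>

lemma eq_zero_of_pos_minus_star_mult:
  fixes b :: "'a::cstar_algebra_1"
  assumes neg: "pos (- (star b * b))"
  shows "b = 0"
proof -
  \<comment> \<open>Real and imaginary part of \<open>b\<close>:
    \<open>star b * b + b * star b\<close> is twice the sum of their squares, so the hypothesis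
    makes \<open>b * star b\<close> positive.\<close>
  define x where "x = (1/2) *\<^sub>R (b + star b)"
  define y where "y = (- \<i> / 2) *\<^sub>C (b - star b)"
  have sx: "star x = x" by (simp add: x_def star_scaleR star_add star_star add.commute)
  have sy: "star y = y"
    by (simp add: y_def star_scaleC star_diff star_star scaleC_diff_right scaleC_minus_left)
  have xx: "4 *\<^sub>R (x * x) = (b + star b) * (b + star b)" by (simp add: x_def)
  have "y * y = - ((1/4) *\<^sub>R ((b - star b) * (b - star b)))"
    by (simp add: y_def mult_scaleC_left mult_scaleC_right scaleC_scaleC scaleC_minus_left scaleC_minus_right
        flip: scaleC_of_real)
  then have yy: "4 *\<^sub>R (y * y) = - ((b - star b) * (b - star b))" by simp
  have "4 *\<^sub>R (x * x + y * y) = 2 *\<^sub>R (star b * b + b * star b)"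
    unfolding scaleR_add_right xx yy scaleR_2
    by (simp add: distrib_left distrib_right left_diff_distrib right_diff_distrib)
  then have "(1/2) *\<^sub>R (4 *\<^sub>R (x * x + y * y)) = (1/2) *\<^sub>R (2 *\<^sub>R (star b * b + b * star b))"
    by simp
  then have "b * star b = 2 *\<^sub>R (x * x + y * y) + - (star b * b)" by (simp add: algebra_simps)
  moreover have "pos (2 *\<^sub>R (x * x + y * y) + - (star b * b))"
    by (intro pos_add pos_scaleR pos_square sx sy neg) simp
  ultimately have "pos (b * star b)" by simp
  then obtain t0 where t0: "t0 \<ge> 0" "norm (of_real t0 - b * star b) \<le> t0" by (auto simp: pos_def)
  \<comment> \<open>Adding 1 makes \<open>t\<close> strictly positive, so that it can be
    inverted.\<close>
  define t where "t = t0 + 1"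
  have t: "t > 0" using t0 by (simp add: t_def)
  have "norm (of_real t - b * star b) \<le> t"
    using norm_triangle_ineq[of "of_real t0 - b * star b" 1] t0 by (simp add: t_def algebra_simps)
  define q where "q = 1 - (1/t) *\<^sub>R (b * star b)"
  have "q = (1/t) *\<^sub>R (of_real t - b * star b)"
    using t by (simp add: q_def of_real_def algebra_simps)
  then have nq: "norm q \<le> 1"
    using t \<open>norm (of_real t - b * star b) \<le> t\<close> by simp
  define p where "p = (1/t) *\<^sub>R (- (star b * b))"
  have pp: "pos p" unfolding p_def using neg t by (intro pos_scaleR) auto
  have bb: "star b * b = - (t *\<^sub>R p)" using t by (simp add: p_def)
  have inter: "star b * q = (1 + p) * star b"
    by (simp add: q_def p_def algebra_simps)
  have inter_n: "star b * q ^ n = (1 + p) ^ n * star b" for n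
  proof (induction n)
    case (Suc n)
    have "star b * q ^ Suc n = (star b * q ^ n) * q" by (simp add: power_commutes mult.assoc)
    also have "\<dots> = (1 + p) ^ n * (star b * q)" by (simp add: Suc mult.assoc)
    also have "\<dots> = (1 + p) ^ Suc n * star b" unfolding inter by (metis mult.assoc power_Suc2)
    finally show ?case .
  qed simp
  \<comment> \<open>An increment of the powers is \<open>(1 + p) ^ n * p\<close>. Moving
    \<open>star b\<close> through it leaves a power of \<open>q\<close>, which stays
    bounded.\<close>
  have diff: "(1 + p) ^ Suc n - (1 + p) ^ n = - ((1/t) *\<^sub>R (star b * q ^ n * b))" for n
  proof -
    have "star b * q ^ n * b = (1 + p) ^ n * (star b * b)" by (simp add: inter_n mult.assoc)
    also have "\<dots> = - (t *\<^sub>R ((1 + p) ^ n * p))" by (simp add: bb)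
    also have "(1 + p) ^ n * p = (1 + p) ^ Suc n - (1 + p) ^ n"
      by (subst power_Suc2) (simp add: algebra_simps)
    finally show ?thesis using t by simp
  qed
  define K where "K = (1/t) * (norm b * norm b)"
  have K: "norm ((1 + p) ^ Suc n - (1 + p) ^ n) \<le> K" for n
  proof -
    have "norm (q ^ n) \<le> 1"
      using nq norm_power_ineq[of q n] by (meson norm_ge_zero order_trans power_le_one)
    then have "norm (star b * q ^ n) \<le> norm b"
      by (intro order_trans[OF norm_mult_ineq]) (auto intro: mult_left_le)
    then have "norm (star b * q ^ n * b) \<le> norm b * norm b"
      by (intro order_trans[OF norm_mult_ineq]) (auto intro: mult_right_mono)
    then show ?thesis unfolding diff K_def using t by (simp add: divide_right_mono)
  qed
  have lin: "norm ((1 + p) ^ n) \<le> 1 + n * K" for n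
  proof (induction n)
    case (Suc n)
    have "norm ((1 + p) ^ Suc n) \<le> norm ((1 + p) ^ Suc n - (1 + p) ^ n) + norm ((1 + p) ^ n)"
      by (metis diff_add_cancel norm_triangle_ineq)
    with Suc K[of n] show ?case by (simp add: algebra_simps)
  qed simp
  have sz: "star (1 + p) = 1 + p" using pp by (simp add: star_add pos_def)
  have "norm (1 + p) ^ (2 ^ k) \<le> 1 + 2 ^ k * K" for k
    using lin[of "2 ^ k"] norm_power_two_power[OF sz, of k] by simp
  then have "norm (1 + p) \<le> 1" by (rule le_one_of_linear_growth)
  then have "pos (of_real 1 - (1 + p))" by (intro pos_norm_minus sz)
  then have "pos (- p)" by simp
  with pp have "p = 0" by (rule pos_antisym)
  then have "norm b * norm b = 0" using bb norm_star_mult[of b] by simp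
  then show ?thesis by simp
qed

text \<open>With \<open>m = |a* a|\<close> and \<open>v = m - a* a\<close>, the element \<open>a v\<close> satisfies the hypothesis of
  the previous lemma, so that \<open>v = 0\<close>.\<close>

theorem pos_star_mult: "pos (star a * (a::'a::cstar_algebra_1))"
proof -
  define h where "h = star a * a"
  have sh: "star h = h" by (simp add: h_def star_mult star_star)
  obtain m where m: "pos m" "m * m = h * h" "\<And>z. z * (h * h) = (h * h) * z \<Longrightarrow> z * m = m * z"
    using pos_sqrt[OF pos_square[OF sh]] by metis
  have hm: "h * m = m * h" by (rule m(3)) (simp add: mult.assoc)
  obtain r where r: "pos r" "r * r = m" "\<And>z. z * m = m * z \<Longrightarrow> z * r = r * z"
    using pos_sqrt[OF m(1)] by metis
  define v where "v = m - h"
  have sm: "star m = m" and sr: "star r = r" using m(1) r(1) by (auto simp: pos_def)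
  have sv: "star v = v" by (simp add: v_def star_diff sh sm)
  have "h * r = r * h" by (rule r(3)) (rule hm)
  have rm: "m * r = r * m" by (rule r(3)) simp
  have rv: "r * v = v * r" by (simp add: v_def algebra_simps \<open>h * r = r * h\<close> rm)
  have hv: "h * v = - (m * v)" by (simp add: v_def algebra_simps hm m(2))
  have mv: "m * v = v * m" by (simp add: v_def algebra_simps hm)
  have srv: "star (r * v) = r * v" by (simp add: star_mult sr sv rv)
  \<comment> \<open>Since \<open>r\<close> is a root of \<open>m\<close> and commutes with
    \<open>v\<close>, the element \<open>v * (m * v)\<close> is the square of the selfadjoint
    \<open>r * v\<close>, hence positive.\<close>
  have sq: "(r * v) * (r * v) = v * (m * v)"
    by (metis mult.assoc r(2) rv)
  have "star (a * v) * (a * v) = v * (h * v)" by (simp add: star_mult sv h_def mult.assoc)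
  also have "\<dots> = - ((r * v) * (r * v))" by (simp add: hv sq)
  finally have e: "star (a * v) * (a * v) = - ((r * v) * (r * v))" .
  then have "pos (- (star (a * v) * (a * v)))" using pos_square[OF srv] by simp
  then have "a * v = 0" by (rule eq_zero_of_pos_minus_star_mult)
  \<comment> \<open>The vanishing travels through the factors: \<open>r * v = 0\<close> gives
    \<open>m * v = 0\<close>, hence \<open>h * v = 0\<close>, and \<open>v * v\<close> is their
    difference.\<close>
  then have "r * v = 0" using e selfadjoint_square_eq_0[OF srv] by simp
  then have "m * v = 0" by (metis mult.assoc mult_zero_right r(2))
  then have "v * v = 0" using hv by (simp add: v_def algebra_simps)
  then have "v = 0" using selfadjoint_square_eq_0[OF sv] by simp
  then show ?thesis using m(1) by (simp add: v_def h_def)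
qed

lemma pos_conj: "pos h \<Longrightarrow> pos (star a * h * a)"
proof -
  assume "pos h"
  then obtain k where k: "pos k" "k * k = h" using pos_sqrt by metis
  then have "star (k * a) * (k * a) = star a * h * a"
    by (metis mult.assoc pos_selfadjoint star_mult)
  then show ?thesis by (metis pos_star_mult)
qed

section \<open>The unitization\<close>

datatype 'a unitization = Unitization (upart: 'a) (uscal: complex)

lemma unitization_eq_iff: "x = y \<longleftrightarrow> upart x = upart y \<and> uscal x = uscal y"
  by (auto intro: unitization.expand)

instantiation unitization :: (cstar_algebra) real_algebra_1
begin

definition "0 = Unitization 0 0"
definition "1 = Unitization 0 1"
definition "x + y = Unitization (upart x + upart y) (uscal x + uscal y)"
definition "x - y = Unitization (upart x - upart y) (uscal x - uscal y)"
definition "- x = Unitization (- upart x) (- uscal x)"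
definition "r *\<^sub>R x = Unitization (r *\<^sub>R upart x) (r *\<^sub>R uscal x)"
definition "x * y = Unitization
  (upart x * upart y + uscal x *\<^sub>C upart y + uscal y *\<^sub>C upart x) (uscal x * uscal y)"

lemmas unitization_defs = zero_unitization_def one_unitization_def plus_unitization_def
  minus_unitization_def uminus_unitization_def scaleR_unitization_def times_unitization_def

instance
  by intro_classes
    (auto simp: unitization_eq_iff unitization_defs algebra_simps scaleC_add_right scaleC_add_left
      scaleC_scaleC mult_scaleC_left mult_scaleC_right scaleC_scaleR_left scaleC_scaleR_right)

end

lemma unitization_simps [simp]:
  "upart 0 = (0::'a::cstar_algebra)" "uscal (0::'a unitization) = 0"
  "upart 1 = (0::'a)" "uscal (1::'a unitization) = 1"
  "upart (x + y) = upart x + (upart y::'a)" "uscal (x + y) = uscal x + uscal y"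
  "upart (x - y) = upart x - upart y" "uscal (x - y) = uscal x - uscal y"
  "upart (- x) = - upart x" "uscal (- x) = - uscal x"
  "upart (r *\<^sub>R x) = r *\<^sub>R upart x" "uscal (r *\<^sub>R x) = r *\<^sub>R uscal x"
  "upart (x * y) = upart x * upart y + uscal x *\<^sub>C upart y + uscal y *\<^sub>C upart x"
  "uscal (x * y) = uscal x * uscal y"
  by (simp_all add: unitization_defs)

section \<open>The norm of the unitization, from left multiplication on C\<close>

definition left_op :: "'a::cstar_algebra unitization \<Rightarrow> 'a \<Rightarrow> 'a" where
  "left_op x b = upart x * b + uscal x *\<^sub>C b"

lemma bounded_linear_left_op: "bounded_linear (left_op x)"
  unfolding left_op_def
  by (intro bounded_linear_add bounded_linear_mult_right bounded_linear_scaleC_right)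

lemma left_op_add: "left_op (x + y) b = left_op x b + left_op y b"
  and left_op_scaleR: "left_op (r *\<^sub>R x) b = r *\<^sub>R left_op x b"
  and left_op_mult: "left_op (x * y) b = left_op x (left_op y b)"
  and left_op_one: "left_op 1 b = b"
  and left_op_zero: "left_op 0 b = 0"
  by (simp_all add: left_op_def algebra_simps scaleC_add_right scaleC_add_left scaleC_diff_left
      scaleC_scaleC mult_scaleC_left mult_scaleC_right scaleC_scaleR_left)

lemma norm_left_op: "norm (left_op x b) \<le> onorm (left_op x) * norm b"
  by (rule onorm[OF bounded_linear_left_op])

instantiation unitization :: (cstar_algebra) real_normed_algebra_1
begin

text \<open>The operator norm alone is only a seminorm: if C has a unit e, then \<open>1 - e\<close>
  acts as zero, and on C = 0 everything does. The maximum with the scalar part separates these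
  elements and gives 1 the norm 1 in every case.\<close>

definition "norm x = max (onorm (left_op x)) (cmod (uscal x))"
definition "sgn (x::'a unitization) = inverse (norm x) *\<^sub>R x"
definition "dist (x::'a unitization) y = norm (x - y)"
definition "uniformity = (INF e\<in>{0<..}. principal {(x::'a unitization, y). dist x y < e})"
definition "open (S::'a unitization set) \<longleftrightarrow>
  (\<forall>x\<in>S. \<forall>\<^sub>F (x', y) in uniformity. x' = x \<longrightarrow> y \<in> S)"

instance
proof
  fix x y :: "'a unitization" and r :: real and S :: "'a unitization set"
  show "sgn x = inverse (norm x) *\<^sub>R x" "dist x y = norm (x - y)"
    by (rule sgn_unitization_def dist_unitization_def)+
  show "uniformity = (INF e\<in>{0<..}. principal {(x::'a unitization, y). dist x y < e})"
    by (rule uniformity_unitization_def)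
  show "open S \<longleftrightarrow> (\<forall>x\<in>S. \<forall>\<^sub>F (x', y) in uniformity. x' = x \<longrightarrow> y \<in> S)"
    by (rule open_unitization_def)
  show "norm x = 0 \<longleftrightarrow> x = 0"
  proof
    assume n: "norm x = 0"
    have "0 \<le> onorm (left_op x)" by (rule onorm_pos_le[OF bounded_linear_left_op])
    then have o: "onorm (left_op x) = 0" and s: "uscal x = 0"
      using n by (auto simp: norm_unitization_def max_def split: if_splits)
    have "norm (upart x * star (upart x)) = 0"
      using norm_left_op[of x "star (upart x)"] o s by (simp add: left_op_def)
    then have "upart x = 0" using norm_star_mult[of "star (upart x)"] by (simp add: star_star)
    with s show "x = 0" by (simp add: unitization_eq_iff)
  next
    assume "x = 0"
    have "left_op (0::'a unitization) = (\<lambda>b. 0)" by (simp add: left_op_zero fun_eq_iff)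
    then show "norm x = 0"
      by (simp add: \<open>x = 0\<close> norm_unitization_def onorm_zero)
  qed
  have "left_op (x + y) = (\<lambda>b. left_op x b + left_op y b)" by (simp add: left_op_add fun_eq_iff)
  then have "onorm (left_op (x + y)) \<le> onorm (left_op x) + onorm (left_op y)"
    by (simp add: onorm_triangle bounded_linear_left_op)
  then show "norm (x + y) \<le> norm x + norm y"
    using norm_triangle_ineq[of "uscal x" "uscal y"] by (simp add: norm_unitization_def) linarith
  have "left_op (r *\<^sub>R x) = (\<lambda>b. r *\<^sub>R left_op x b)" by (simp add: left_op_scaleR fun_eq_iff)
  then have "onorm (left_op (r *\<^sub>R x)) = \<bar>r\<bar> * onorm (left_op x)"
    by (simp add: onorm_scaleR bounded_linear_left_op)
  then show "norm (r *\<^sub>R x) = \<bar>r\<bar> * norm x"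
    by (simp add: norm_unitization_def max_mult_distrib_left)
  have "left_op (x * y) = left_op x \<circ> left_op y" by (simp add: left_op_mult fun_eq_iff)
  then have "onorm (left_op (x * y)) \<le> onorm (left_op x) * onorm (left_op y)"
    by (simp add: onorm_compose bounded_linear_left_op)
  also have "\<dots> \<le> norm x * norm y"
    by (intro mult_mono) (auto simp: norm_unitization_def onorm_pos_le[OF bounded_linear_left_op]
        intro: max.coboundedI2)
  finally have "onorm (left_op (x * y)) \<le> norm x * norm y" .
  moreover have "cmod (uscal x) * cmod (uscal y) \<le> norm x * norm y"
    by (intro mult_mono) (auto simp: norm_unitization_def intro: max.coboundedI2)
  ultimately show "norm (x * y) \<le> norm x * norm y"
    by (simp add: norm_unitization_def[of "x * y"] norm_mult)
  have "left_op (1::'a unitization) = (\<lambda>b. b)" by (simp add: left_op_one fun_eq_iff)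
  then show "norm (1::'a unitization) = 1"
    using onorm_id_le[where 'a='a] by (simp add: norm_unitization_def)
qed

end

lemma norm_uscal_le: "norm (uscal x) \<le> norm x"
  by (simp add: norm_unitization_def)

lemma norm_left_op_le: "norm (left_op x b) \<le> norm x * norm b"
  using norm_left_op[of x b] mult_right_mono[of "onorm (left_op x)" "norm x" "norm b"]
  by (simp add: norm_unitization_def)

text \<open>Evaluation at \<open>star (upart x)\<close> recovers the norm of \<open>upart x\<close>;
  removing the scalar part costs the factor 2. Both components of a Cauchy sequence are therefore
  Cauchy.\<close>

lemma norm_upart_le: "norm (upart x) \<le> 2 * norm x"
proof (cases "upart x = 0")
  case False
  have "norm (upart x) * norm (upart x) = norm (upart x * star (upart x))"
    using norm_star_mult[of "star (upart x)"] by (simp add: star_star)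
  also have "upart x * star (upart x) = left_op x (star (upart x)) - uscal x *\<^sub>C star (upart x)"
    by (simp add: left_op_def)
  also have "norm \<dots> \<le> norm (left_op x (star (upart x))) + norm (uscal x *\<^sub>C star (upart x))"
    by (rule norm_triangle_ineq4)
  also have "\<dots> \<le> norm x * norm (upart x) + norm x * norm (upart x)"
    using norm_left_op_le[of x "star (upart x)"] norm_uscal_le[of x]
    by (intro add_mono) (auto simp: norm_scaleC intro: mult_right_mono)
  finally have "norm (upart x) * norm (upart x) \<le> (2 * norm x) * norm (upart x)" by simp
  then show ?thesis using False by (simp add: mult_le_cancel_right)
qed simp

lemma norm_unitization_le: "norm x \<le> norm (upart x) + norm (uscal x)"
proof -
  have "onorm (left_op x) \<le> norm (upart x) + norm (uscal x)"
  proof (rule onorm_bound)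
    fix b
    have "norm (left_op x b) \<le> norm (upart x * b) + norm (uscal x *\<^sub>C b)"
      unfolding left_op_def by (rule norm_triangle_ineq)
    also have "\<dots> \<le> norm (upart x) * norm b + norm (uscal x) * norm b"
      by (intro add_mono norm_mult_ineq) (simp add: norm_scaleC)
    finally show "norm (left_op x b) \<le> (norm (upart x) + norm (uscal x)) * norm b"
      by (simp add: algebra_simps)
  qed auto
  then show ?thesis by (simp add: norm_unitization_def)
qed

text \<open>The norm is equivalent to the sum of the norms of the two components, so limits are
  taken componentwise.\<close>

instance unitization :: (cstar_algebra) banach
proof
  fix X :: "nat \<Rightarrow> 'a unitization" assume X: "Cauchy X"
  have bl: "bounded_linear (upart :: 'a unitization \<Rightarrow> 'a)"
    by (rule bounded_linear_intro[of _ 2]) (auto simp: norm_upart_le mult.commute[of _ 2])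
  have bs: "bounded_linear (uscal :: 'a unitization \<Rightarrow> complex)"
    by (rule bounded_linear_intro[of _ 1]) (auto simp: norm_uscal_le)
  obtain a where a: "(\<lambda>n. upart (X n)) \<longlonglongrightarrow> a"
    using bounded_linear.Cauchy[OF bl X] Cauchy_convergent convergentD by blast
  obtain l where l: "(\<lambda>n. uscal (X n)) \<longlonglongrightarrow> l"
    using bounded_linear.Cauchy[OF bs X] Cauchy_convergent convergentD by blast
  have "(\<lambda>n. norm (upart (X n) - a) + norm (uscal (X n) - l)) \<longlonglongrightarrow> 0 + 0"
    by (intro tendsto_add) (use a l in \<open>auto simp: tendsto_norm_zero_iff LIM_zero_iff\<close>)
  then have lim: "(\<lambda>n. norm (upart (X n) - a) + norm (uscal (X n) - l)) \<longlonglongrightarrow> 0" by simp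
  have "norm (X n - Unitization a l) \<le> norm (upart (X n) - a) + norm (uscal (X n) - l)" for n
    using norm_unitization_le[of "X n - Unitization a l"] by simp
  then have "(\<lambda>n. X n - Unitization a l) \<longlonglongrightarrow> 0"
    by (intro Lim_null_comparison[OF always_eventually lim]) simp
  then have "X \<longlonglongrightarrow> Unitization a l" by (rule LIM_zero_cancel)
  then show "convergent X" by (rule convergentI)
qed

instantiation unitization :: (cstar_algebra) cstar_algebra_1
begin

definition "c *\<^sub>C x = Unitization (c *\<^sub>C upart x) (c * uscal x)"
definition "star x = Unitization (star (upart x)) (cnj (uscal x))"

lemma unitization_star_simps [simp]:
  "upart (c *\<^sub>C x) = c *\<^sub>C (upart x::'a)" "uscal (c *\<^sub>C x) = c * uscal x"
  "upart (star x) = star (upart x)" "uscal (star x) = cnj (uscal x)"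
  by (simp_all add: scaleC_unitization_def star_unitization_def)

lemma left_op_scaleC: "left_op (c *\<^sub>C x) b = c *\<^sub>C left_op x b"
  for x :: "'a unitization"
  by (simp add: left_op_def scaleC_add_right scaleC_scaleC mult_scaleC_left)

text \<open>For the C-valued form \<open>star b * c\<close> on C, the adjoint of
  \<open>left_op x\<close> is \<open>left_op (star x)\<close>.\<close>

lemma star_left_op: "star (left_op x b) * c = star b * left_op (star x) c"
  for x :: "'a unitization"
  by (simp add: left_op_def star_add star_mult star_scaleC algebra_simps mult_scaleC_left
      mult_scaleC_right)

text \<open>As for operators on a Hilbert space: the square of the norm of
  \<open>left_op x b\<close> is the norm of \<open>star b * left_op (star x * x) b\<close>. This
  gives one inequality; together with submultiplicativity it shows that \<open>x\<close> and
  \<open>star x\<close> have equal operator norms, which gives the other.\<close>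

lemma onorm_left_op_star_mult:
  fixes x :: "'a unitization"
  shows "onorm (left_op (star x * x)) = (onorm (left_op x))\<^sup>2"
proof -
  have p: "0 \<le> onorm (left_op y)" for y :: "'a unitization"
    by (rule onorm_pos_le[OF bounded_linear_left_op])
  have 1: "(onorm (left_op y))\<^sup>2 \<le> onorm (left_op (star y * y))" for y :: "'a unitization"
  proof -
    have "onorm (left_op y) \<le> sqrt (onorm (left_op (star y * y)))"
    proof (rule onorm_bound)
      fix b
      have "(norm (left_op y b))\<^sup>2 = norm (star b * left_op (star y * y) b)"
        by (simp add: cstar_identity[symmetric] star_left_op left_op_mult)
      also have "\<dots> \<le> norm b * (onorm (left_op (star y * y)) * norm b)"
        using norm_mult_ineq[of "star b" "left_op (star y * y) b"]
          mult_left_mono[OF norm_left_op[of "star y * y" b] norm_ge_zero[of b]] by simp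
      also have "\<dots> = (sqrt (onorm (left_op (star y * y))) * norm b)\<^sup>2"
        using p by (simp add: power_mult_distrib power2_eq_square)
      finally show "norm (left_op y b) \<le> sqrt (onorm (left_op (star y * y))) * norm b"
        by (rule power2_le_imp_le) (use p in auto)
    qed (use p in auto)
    then have "(onorm (left_op y))\<^sup>2 \<le> (sqrt (onorm (left_op (star y * y))))\<^sup>2"
      using p by (intro power_mono) auto
    then show ?thesis using p by simp
  qed
  have 2: "onorm (left_op (y * z)) \<le> onorm (left_op y) * onorm (left_op z)" for y z :: "'a unitization"
  proof -
    have "left_op (y * z) = left_op y \<circ> left_op z" by (simp add: left_op_mult fun_eq_iff)
    then show ?thesis by (simp add: onorm_compose bounded_linear_left_op)
  qed
  have 3: "onorm (left_op y) \<le> onorm (left_op (star y))" for y :: "'a unitization"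
  proof -
    have "onorm (left_op y) * onorm (left_op y) \<le> onorm (left_op (star y)) * onorm (left_op y)"
      using order_trans[OF 1[of y] 2[of "star y" y]] by (simp add: power2_eq_square)
    then show ?thesis using p[of y] p[of "star y"] by (cases "onorm (left_op y) = 0") auto
  qed
  have "star (star x) = x" by (simp add: unitization_eq_iff star_star)
  then have "onorm (left_op (star x)) = onorm (left_op x)"
    using 3[of x] 3[of "star x"] by simp
  then show ?thesis using 1[of x] 2[of "star x" x] by (simp add: power2_eq_square)
qed

instance
proof
  fix x :: "'a unitization"
  have p: "0 \<le> onorm (left_op x)" by (rule onorm_pos_le[OF bounded_linear_left_op])
  have "max (u\<^sup>2) (v\<^sup>2) = (max u v)\<^sup>2" if "0 \<le> u" "0 \<le> v" for u v :: real
    using that by (auto simp: max_def power2_le_iff_abs_le abs_le_square_iff[symmetric])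
  then show "norm (star x * x) = (norm x)\<^sup>2"
    using p by (simp add: norm_unitization_def onorm_left_op_star_mult norm_mult power2_eq_square[of "cmod _", symmetric])
next
  fix c :: complex and x :: "'a unitization"
  have "onorm (left_op (c *\<^sub>C x)) = onorm (\<lambda>b. cmod c *\<^sub>R left_op x b)"
    by (simp add: onorm_def left_op_scaleC norm_scaleC)
  also have "\<dots> = cmod c * onorm (left_op x)"
    by (simp add: onorm_scaleR bounded_linear_left_op)
  finally show "norm (c *\<^sub>C x) = cmod c * norm x"
    by (simp add: norm_unitization_def max_mult_distrib_left norm_mult)
qed (auto simp: unitization_eq_iff algebra_simps scaleC_add_right scaleC_add_left scaleC_scaleC
    mult_scaleC_left mult_scaleC_right star_add star_mult star_scaleC star_star scaleC_of_real
    scaleR_conv_of_real[where 'a = complex])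

end

section \<open>Integrals of decaying vector-valued functions\<close>

lemma
  fixes f :: "'n::finite \<Rightarrow> real \<Rightarrow> 'b::{real_normed_field, banach, second_countable_topology}"
  assumes f: "\<And>i. integrable lborel (f i)"
  shows integrable_prod_vec: "integrable lborel (\<lambda>x::real^'n. \<Prod>i\<in>UNIV. f i (x $ i))" (is ?A)
    and integral_prod_vec:
      "integral\<^sup>L lborel (\<lambda>x::real^'n. \<Prod>i\<in>UNIV. f i (x $ i)) = (\<Prod>i\<in>UNIV. integral\<^sup>L lborel (f i))" (is ?B)
proof -
  interpret product_sigma_finite "\<lambda>b::real^'n. lborel :: real measure" by standard
  \<comment> \<open>\<open>lborel\<close> is a product measure indexed by \<open>Basis\<close>,
    whose elements are the vectors \<open>axis i 1\<close>; \<open>ix\<close> translates them back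
    into coordinates.\<close>
  define ix :: "real^'n \<Rightarrow> 'n" where "ix b = (THE i. b = axis i 1)" for b
  have ix: "ix (axis i 1) = i" for i by (auto simp: ix_def axis_eq_axis)
  have B: "(Basis :: (real^'n) set) = range (\<lambda>i. axis i 1)" by (auto simp: Basis_vec_def)
  have inj: "inj (\<lambda>i::'n. axis i (1::real))" by (auto simp: inj_on_def axis_eq_axis)
  define S where "S g = (\<Sum>b\<in>Basis. g b *\<^sub>R (b::real^'n))" for g :: "real^'n \<Rightarrow> real"
  have Sm: "S \<in> measurable (\<Pi>\<^sub>M b\<in>Basis. lborel) borel" unfolding S_def by measurable
  have comp: "S g $ i = g (axis i 1)" for g i
    unfolding S_def B by (subst sum.reindex[OF inj]) (simp add: axis_def if_distrib cong: if_cong)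
  have pr: "(\<Prod>i\<in>UNIV. f i (S g $ i)) = (\<Prod>b\<in>Basis. f (ix b) (g b))" for g
    unfolding B comp by (subst prod.reindex[OF inj]) (simp add: ix)
  have fm: "f i \<in> borel_measurable borel" for i using borel_measurable_integrable[OF f[of i]] by simp
  have m: "(\<lambda>x::real^'n. \<Prod>i\<in>UNIV. f i (x $ i)) \<in> borel_measurable borel"
  proof (intro borel_measurable_prod)
    fix i :: 'n
    have "(\<lambda>x::real^'n. x $ i) \<in> borel_measurable borel"
      by (intro borel_measurable_continuous_onI continuous_intros)
    then show "(\<lambda>x::real^'n. f i (x $ i)) \<in> borel_measurable borel"
      using fm by (rule measurable_compose)
  qed
  have "integrable (\<Pi>\<^sub>M b\<in>Basis. lborel) (\<lambda>g. \<Prod>i\<in>UNIV. f i (S g $ i))"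
    unfolding pr by (rule product_integrable_prod) (auto simp: f)
  then show ?A
    unfolding lborel_eq[where 'a = "real^'n"] S_def[symmetric] using integrable_distr_eq[OF Sm m] by simp
  have "integral\<^sup>L lborel (\<lambda>x::real^'n. \<Prod>i\<in>UNIV. f i (x $ i))
      = integral\<^sup>L (\<Pi>\<^sub>M b\<in>Basis. lborel) (\<lambda>g. \<Prod>i\<in>UNIV. f i (S g $ i))"
    unfolding lborel_eq[where 'a = "real^'n"] S_def[symmetric] by (rule integral_distr[OF Sm m])
  also have "\<dots> = (\<Prod>b\<in>Basis. integral\<^sup>L lborel (f (ix b)))"
    unfolding pr by (rule product_integral_prod) (auto simp: f)
  also have "\<dots> = (\<Prod>i\<in>UNIV. integral\<^sup>L lborel (f i))"
    unfolding B by (subst prod.reindex[OF inj]) (simp add: ix)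
  finally show ?B .
qed

section \<open>Continuous functions dominated by a product weight\<close>

definition weight :: "real ^ 'n::finite \<Rightarrow> real" where
  "weight x = (\<Prod>i\<in>UNIV. inverse (1 + (x $ i)\<^sup>2))"

lemma one_plus_square_pos: "0 < 1 + (t::real)\<^sup>2"
  by (smt (verit) zero_le_power2)

lemma weight_pos: "0 < weight x"
  unfolding weight_def by (intro prod_pos) (simp add: one_plus_square_pos)

lemma weight_nonneg: "0 \<le> weight x"
  using weight_pos[of x] by simp

lemma weight_le_1: "weight x \<le> 1"
  unfolding weight_def by (intro prod_le_1) (auto simp: one_plus_square_pos less_imp_le inverse_le_1_iff)

lemma continuous_on_weight: "continuous_on S weight"
  unfolding weight_def using one_plus_square_pos
  by (intro continuous_intros) (metis less_irrefl)

lemma integrable_weight: "weight integrable_on (UNIV :: (real^'n::finite) set)"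
proof -
  have "set_integrable lborel (einterval (-\<infinity>) \<infinity>) (\<lambda>x. inverse (1 + x\<^sup>2))"
    by (rule integrable_inverse_1_plus_square)
  then have "integrable lborel (\<lambda>x::real. inverse (1 + x\<^sup>2))"
    by (simp add: set_integrable_def einterval_eq)
  then have "integrable lborel (weight :: real^'n \<Rightarrow> real)"
    unfolding weight_def[abs_def] by (rule integrable_prod_vec)
  then show ?thesis by (rule integrable_on_lborel)
qed

text \<open>Continuity gives integrability over boxes and the weight controls the tails. The product
  form of the weight reduces its own integrability to dimension one and fits bounds that are known
  coordinate by coordinate.\<close>

definition decaying :: "(real ^ 'n::finite \<Rightarrow> 'b::real_normed_vector) \<Rightarrow> bool" where
  "decaying f \<longleftrightarrow> continuous_on UNIV f \<and> (\<exists>C. \<forall>x. norm (f x) \<le> C * weight x)"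

lemma decayingI: "continuous_on UNIV f \<Longrightarrow> (\<And>x. norm (f x) \<le> C * weight x) \<Longrightarrow> decaying f"
  by (auto simp: decaying_def)

lemma decayingD:
  fixes f :: "real ^ 'n::finite \<Rightarrow> 'b::real_normed_vector"
  assumes "decaying f"
  obtains C where "continuous_on UNIV f" "0 \<le> C" "\<And>x. norm (f x) \<le> C * weight x"
proof -
  obtain C where C: "continuous_on UNIV f" "\<And>x. norm (f x) \<le> C * weight x"
    using assms by (auto simp: decaying_def)
  have "0 \<le> C" using order_trans[OF norm_ge_zero C(2)[of 0]] weight_pos[of "0::real^'n"]
    by (auto simp: zero_le_mult_iff)
  with C show thesis using that by blast
qed

lemma decaying_continuous: "decaying f \<Longrightarrow> continuous_on S f"
  by (meson continuous_on_subset decaying_def subset_UNIV)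

lemma decaying_integrable_cbox:
  fixes f :: "real ^ 'n::finite \<Rightarrow> 'b::banach"
  shows "decaying f \<Longrightarrow> f integrable_on cbox a b"
  by (intro integrable_continuous decaying_continuous)

lemma decaying_integrable:
  fixes f :: "real ^ 'n::finite \<Rightarrow> 'b::banach"
  assumes "decaying f"
  shows "f integrable_on UNIV"
proof -
  obtain C where C: "\<And>x. norm (f x) \<le> C * weight x" using assms by (auto simp: decaying_def)
  have "(\<lambda>x::real^'n. C * weight x) integrable_on UNIV"
    by (intro integrable_on_mult_right integrable_weight)
  then show ?thesis
    by (intro integrable_on_all_intervals_UNIV[OF decaying_integrable_cbox[OF assms] C])
qed

lemma decaying_weight: "decaying weight"
  by (rule decayingI[OF continuous_on_weight, of 1]) (simp add: abs_of_pos weight_pos)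

lemma decaying_linear:
  assumes T: "bounded_linear T" and f: "decaying f"
  shows "decaying (\<lambda>x. T (f x))"
proof -
  obtain C where C: "continuous_on UNIV f" "0 \<le> C" "\<And>x. norm (f x) \<le> C * weight x"
    using decayingD[OF f] by blast
  obtain K where K: "\<And>x. norm (T x) \<le> norm x * K" "0 \<le> K"
    using bounded_linear.nonneg_bounded[OF T] by blast
  show ?thesis
  proof (rule decayingI[of _ "C * K"])
    show "continuous_on UNIV (\<lambda>x. T (f x))" by (rule bounded_linear.continuous_on[OF T C(1)])
    fix x show "norm (T (f x)) \<le> (C * K) * weight x"
      using order_trans[OF K(1) mult_right_mono[OF C(3) K(2)]] by (simp add: mult_ac)
  qed
qed

lemma decaying_add:
  assumes "decaying f" "decaying g"
  shows "decaying (\<lambda>x. f x + g x)"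
proof -
  obtain C where C: "continuous_on UNIV f" "\<And>x. norm (f x) \<le> C * weight x"
    using decayingD[OF assms(1)] by blast
  obtain D where D: "continuous_on UNIV g" "\<And>x. norm (g x) \<le> D * weight x"
    using decayingD[OF assms(2)] by blast
  show ?thesis
  proof (rule decayingI[of _ "C + D"])
    show "continuous_on UNIV (\<lambda>x. f x + g x)" by (intro continuous_intros C D)
    fix x show "norm (f x + g x) \<le> (C + D) * weight x"
      using norm_triangle_mono[OF C(2) D(2)] by (simp add: algebra_simps)
  qed
qed

lemma decaying_diff: "decaying f \<Longrightarrow> decaying g \<Longrightarrow> decaying (\<lambda>x. f x - g x)"
  using decaying_add[of f "\<lambda>x. - g x"] decaying_linear[OF bounded_linear_minus[OF bounded_linear_ident], of g]
  by simp

lemma decaying_norm: "decaying f \<Longrightarrow> decaying (\<lambda>x. norm (f x))"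
  by (auto simp: decaying_def intro: continuous_on_norm)

lemma decaying_bilinear:
  assumes B: "bounded_bilinear B" and f: "continuous_on UNIV f" "bounded (range f)" and g: "decaying g"
  shows "decaying (\<lambda>x. B (f x) (g x))"
proof -
  obtain C where C: "continuous_on UNIV g" "0 \<le> C" "\<And>x. norm (g x) \<le> C * weight x"
    using decayingD[OF g] by blast
  obtain K where K: "\<And>x y. norm (B x y) \<le> norm x * norm y * K" "0 \<le> K"
    using bounded_bilinear.nonneg_bounded[OF B] by blast
  obtain M where M: "\<And>x. norm (f x) \<le> M" using f(2) by (auto simp: bounded_iff)
  show ?thesis
  proof (rule decayingI[of _ "M * C * K"])
    show "continuous_on UNIV (\<lambda>x. B (f x) (g x))"
      by (rule bounded_bilinear.continuous_on[OF B f(1) C(1)])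
    fix x
    have "norm (f x) * norm (g x) * K \<le> M * (C * weight x) * K"
      using M[of x] C K order_trans[OF norm_ge_zero M] by (intro mult_mono) (auto intro!: mult_nonneg_nonneg simp: weight_nonneg)
    then show "norm (B (f x) (g x)) \<le> (M * C * K) * weight x"
      using order_trans[OF K(1)] by (simp add: mult_ac)
  qed
qed

lemma decaying_bounded: "decaying f \<Longrightarrow> bounded (range f)"
proof -
  assume "decaying f"
  then obtain C where C: "0 \<le> C" "\<And>x. norm (f x) \<le> C * weight x" using decayingD by metis
  have "norm (f x) \<le> C" for x
    using C(2)[of x] mult_left_le[OF weight_le_1[of x] C(1)] by simp
  then show ?thesis by (auto simp: bounded_iff)
qed

section \<open>Affine substitutions\<close>

lemma weight_affine_le:
  assumes "m > 0"
  obtains K where "0 \<le> K" "\<And>x. weight (m *\<^sub>R x + c) \<le> K * weight x"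
proof
  \<comment> \<open>With y = m x_i + c_i one has x_i = (y - c_i)/m, hence x_i^2 <= 2 (y^2 +
    c_i^2)/m^2; \<open>k i\<close> collects the constants.\<close>
  define k where "k i = 1 + 2 * (1 + (c $ i)\<^sup>2) / m\<^sup>2" for i
  have k: "0 \<le> k i" for i by (simp add: k_def)
  show "0 \<le> (\<Prod>i\<in>UNIV. k i)" using k by (intro prod_nonneg) auto
  fix x
  have "inverse (1 + ((m *\<^sub>R x + c) $ i)\<^sup>2) \<le> k i * inverse (1 + (x $ i)\<^sup>2)" for i
  proof -
    define y where "y = m * (x $ i) + c $ i"
    have "(m * x $ i)\<^sup>2 = (y - c $ i)\<^sup>2" by (simp add: y_def)
    also have "\<dots> \<le> 2 * (y\<^sup>2 + (c $ i)\<^sup>2)"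
      using zero_le_power2[of "y + c $ i"] by (simp add: power2_eq_square algebra_simps)
    finally have "(x $ i)\<^sup>2 \<le> 2 * (y\<^sup>2 + (c $ i)\<^sup>2) / m\<^sup>2"
      using assms by (simp add: field_simps power_mult_distrib)
    also have "\<dots> \<le> 2 * (1 + (c $ i)\<^sup>2) / m\<^sup>2 * (1 + y\<^sup>2)"
    proof -
      have "y\<^sup>2 + (c $ i)\<^sup>2 \<le> (1 + (c $ i)\<^sup>2) * (1 + y\<^sup>2)" by (simp add: algebra_simps)
      then have "2 * (y\<^sup>2 + (c $ i)\<^sup>2) / m\<^sup>2 \<le> 2 * ((1 + (c $ i)\<^sup>2) * (1 + y\<^sup>2)) / m\<^sup>2"
        by (intro divide_right_mono mult_left_mono) auto
      then show ?thesis by (simp add: algebra_simps)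
    qed
    finally have "(x $ i)\<^sup>2 \<le> 2 * (1 + (c $ i)\<^sup>2) / m\<^sup>2 * (1 + y\<^sup>2)" .
    then have "1 + (x $ i)\<^sup>2 \<le> k i * (1 + y\<^sup>2)"
      using zero_le_power2[of y] unfolding k_def by (simp only: distrib_right mult_1)
    moreover have "(m *\<^sub>R x + c) $ i = y" by (simp add: y_def)
    ultimately show ?thesis
      using one_plus_square_pos[of "x $ i"] one_plus_square_pos[of y]
      by (simp add: field_simps)
  qed
  then have "weight (m *\<^sub>R x + c) \<le> (\<Prod>i\<in>UNIV. k i * inverse (1 + (x $ i)\<^sup>2))"
    unfolding weight_def using one_plus_square_pos
    by (intro prod_mono) (auto simp: less_imp_le)
  then show "weight (m *\<^sub>R x + c) \<le> (\<Prod>i\<in>UNIV. k i) * weight x"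
    by (simp add: weight_def prod.distrib)
qed

lemma decaying_affine:
  assumes m: "m > 0" and f: "decaying f"
  shows "decaying (\<lambda>x. f (m *\<^sub>R x + c))"
proof -
  obtain C where C: "continuous_on UNIV f" "0 \<le> C" "\<And>x. norm (f x) \<le> C * weight x"
    using decayingD[OF f] by blast
  obtain K where K: "0 \<le> K" "\<And>x. weight (m *\<^sub>R x + c) \<le> K * weight x"
    using weight_affine_le[OF m] by metis
  show ?thesis
  proof (rule decayingI[of _ "C * K"])
    show "continuous_on UNIV (\<lambda>x. f (m *\<^sub>R x + c))"
      by (intro continuous_on_compose2[OF C(1)] continuous_intros) auto
    fix x show "norm (f (m *\<^sub>R x + c)) \<le> (C * K) * weight x"
      using order_trans[OF C(3) mult_left_mono[OF K(2) C(2)]] by (simp add: mult_ac)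
  qed
qed

lemma has_integral_affinity_UNIV:
  fixes f :: "'a::euclidean_space \<Rightarrow> 'b::banach"
  assumes f: "(f has_integral I) UNIV" and m: "m > 0"
  shows "((\<lambda>x. f (m *\<^sub>R x + c)) has_integral (I /\<^sub>R m ^ DIM('a))) UNIV"
proof -
  have fa: "f integrable_on cbox a b" for a b
    using f integrable_on_subcbox[of f UNIV] by auto
  have fe: "\<exists>B>0. \<forall>a b. ball 0 B \<subseteq> cbox a b \<longrightarrow> norm (integral (cbox a b) f - I) < e" if "e > 0" for e
    using f that unfolding has_integral_alt'[of f] by simp
  have aff: "((\<lambda>x. f (m *\<^sub>R x + c)) has_integral
      (integral (cbox (m *\<^sub>R a + c) (m *\<^sub>R b + c)) f /\<^sub>R m ^ DIM('a))) (cbox a b)" for a b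
    using has_integral_affinity'[OF integrable_integral[OF fa[of "m *\<^sub>R a + c" "m *\<^sub>R b + c"]] m, of c] m
    by simp
  show ?thesis
    unfolding has_integral_alt'
  proof (intro conjI allI impI)
    fix a b show "(\<lambda>x. if x \<in> UNIV then f (m *\<^sub>R x + c) else 0) integrable_on cbox a b"
      using aff by auto
  next
    fix e :: real assume "e > 0"
    then have "e * m ^ DIM('a) > 0" using m by simp
    then obtain B where B: "B > 0"
      "\<And>a b. ball 0 B \<subseteq> cbox a b \<Longrightarrow> norm (integral (cbox a b) f - I) < e * m ^ DIM('a)"
      using fe by meson
    show "\<exists>B>0. \<forall>a b. ball 0 B \<subseteq> cbox a b \<longrightarrow>
      norm (integral (cbox a b) (\<lambda>x. if x \<in> UNIV then f (m *\<^sub>R x + c) else 0) - I /\<^sub>R m ^ DIM('a)) < e"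
    \<comment> \<open>If |y| < B, then the preimage (y - c)/m has norm less than this radius, so the
      image of the box contains the ball of radius B.\<close>
    proof (intro exI[of _ "(B + norm c) / m"] conjI allI impI)
      show "(B + norm c) / m > 0" using B m by (simp add: add_pos_nonneg)
      fix a b :: 'a assume sub: "ball 0 ((B + norm c) / m) \<subseteq> cbox a b"
      have "ball 0 B \<subseteq> cbox (m *\<^sub>R a + c) (m *\<^sub>R b + c)"
      proof
        fix y :: 'a assume "y \<in> ball 0 B"
        then have "norm (y - c) < B + norm c" using norm_triangle_ineq4[of y c] by simp
        then have "norm (y - c) / m < (B + norm c) / m"
          using m by (intro divide_strict_right_mono) auto
        moreover have "norm ((y - c) /\<^sub>R m) = norm (y - c) / m"
          using m by (simp add: divide_inverse mult.commute)
        ultimately have "norm ((y - c) /\<^sub>R m) < (B + norm c) / m" by simp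
        then have "(y - c) /\<^sub>R m \<in> cbox a b" using sub by (auto simp: subset_iff)
        then show "y \<in> cbox (m *\<^sub>R a + c) (m *\<^sub>R b + c)"
          using m by (auto simp: mem_box inner_simps field_simps)
      qed
      then have "norm (integral (cbox (m *\<^sub>R a + c) (m *\<^sub>R b + c)) f - I) < e * m ^ DIM('a)"
        by (rule B(2))
      moreover have "integral (cbox a b) (\<lambda>x. f (m *\<^sub>R x + c)) - I /\<^sub>R m ^ DIM('a)
          = (integral (cbox (m *\<^sub>R a + c) (m *\<^sub>R b + c)) f - I) /\<^sub>R m ^ DIM('a)"
        using integral_unique[OF aff] by (simp add: scaleR_diff_right)
      moreover have "norm (X /\<^sub>R m ^ DIM('a)) < e" if "norm X < e * m ^ DIM('a)" for X :: 'b
      proof -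
        have "norm (X /\<^sub>R m ^ DIM('a)) = norm X / m ^ DIM('a)"
          using m by (simp add: divide_inverse mult.commute)
        then show ?thesis using that m by (simp add: pos_divide_less_eq)
      qed
      ultimately show "norm (integral (cbox a b) (\<lambda>x. if x \<in> UNIV then f (m *\<^sub>R x + c) else 0)
          - I /\<^sub>R m ^ DIM('a)) < e"
        by simp
    qed
  qed
qed

lemma integral_affinity:
  fixes f :: "'a::euclidean_space \<Rightarrow> 'b::banach"
  assumes "f integrable_on UNIV" "m > 0"
  shows "integral UNIV (\<lambda>x. f (m *\<^sub>R x + c)) = integral UNIV f /\<^sub>R m ^ DIM('a)"
  using has_integral_affinity_UNIV[OF integrable_integral[OF assms(1)] assms(2)] by (rule integral_unique)

lemma integral_translation:
  fixes f :: "'a::euclidean_space \<Rightarrow> 'b::banach"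
  assumes "f integrable_on UNIV"
  shows "integral UNIV (\<lambda>x. f (x + c)) = integral UNIV f"
  using integral_affinity[OF assms, of 1 c] by simp

lemma integral_linear': "bounded_linear T \<Longrightarrow> f integrable_on S \<Longrightarrow> integral S (\<lambda>x. T (f x)) = T (integral S f)"
  using integral_linear[of f S T] by (simp add: o_def)

text \<open>The vector-valued statement is reduced to real functions: the norms of f_k - g tend to 0
  pointwise and are dominated by 2 C times the weight.\<close>

lemma decaying_dominated_convergence:
  fixes f :: "nat \<Rightarrow> real ^ 'n::finite \<Rightarrow> 'b::banach"
  assumes f: "\<And>k. continuous_on UNIV (f k)" "\<And>k x. norm (f k x) \<le> C * weight x"
    and g: "continuous_on UNIV g" and lim: "\<And>x. (\<lambda>k. f k x) \<longlonglongrightarrow> g x"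
  shows "(\<lambda>k. integral UNIV (f k)) \<longlonglongrightarrow> integral UNIV g"
proof -
  have df: "decaying (f k)" for k by (rule decayingI[OF f])
  have ng: "norm (g x) \<le> C * weight x" for x
    using f(2) by (intro LIMSEQ_le_const2[OF tendsto_norm[OF lim]]) auto
  have dg: "decaying g" by (rule decayingI[OF g ng])
  have dd: "(\<lambda>x. norm (f k x - g x)) integrable_on UNIV" for k
    by (intro decaying_integrable decaying_norm decaying_diff df dg)
  have "(\<lambda>k. integral UNIV (\<lambda>x. norm (f k x - g x))) \<longlonglongrightarrow> integral UNIV (\<lambda>x::real^'n. 0 :: real)"
  proof (rule dominated_convergence(2)[OF dd, where h = "\<lambda>x. (2 * C) * weight x"])
    show "(\<lambda>x. (2 * C) * weight x) integrable_on (UNIV :: (real^'n) set)"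
      by (intro integrable_on_mult_right integrable_weight)
    fix k x
    show "norm (norm (f k x - g x)) \<le> (2 * C) * weight x"
      using norm_triangle_ineq4[of "f k x" "g x"] f(2)[of k x] ng[of x] by simp
    show "(\<lambda>k. norm (f k x - g x)) \<longlonglongrightarrow> 0"
      using lim[of x] by (simp add: tendsto_norm_zero_iff LIM_zero_iff)
  qed
  then have l: "(\<lambda>k. integral UNIV (\<lambda>x. norm (f k x - g x))) \<longlonglongrightarrow> 0" by simp
  have "norm (integral UNIV (f k) - integral UNIV g) \<le> integral UNIV (\<lambda>x. norm (f k x - g x))" for k
  proof -
    have "integral UNIV (f k) - integral UNIV g = integral UNIV (\<lambda>x. f k x - g x)"
      by (intro integral_diff[symmetric] decaying_integrable df dg)
    also have "norm \<dots> \<le> integral UNIV (\<lambda>x. norm (f k x - g x))"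
      by (intro Henstock_Kurzweil_Integration.integral_norm_bound_integral dd
        decaying_integrable[OF decaying_diff[OF df dg]]) simp
    finally show ?thesis .
  qed
  then have "(\<lambda>k. integral UNIV (f k) - integral UNIV g) \<longlonglongrightarrow> 0"
    by (intro Lim_null_comparison[OF always_eventually l]) simp
  then show ?thesis by (rule LIM_zero_cancel)
qed

section \<open>Fubini's theorem for decaying integrands\<close>

definition cube :: "nat \<Rightarrow> (real ^ 'n::finite) set" where
  "cube k = cbox (\<chi> i. - real k) (\<chi> i. real k)"

lemma ball_subset_cube:
  assumes "B \<le> real k"
  shows "ball 0 B \<subseteq> cube k"
proof
  fix x :: "real^'n" assume "x \<in> ball 0 B"
  then have "\<bar>x $ i\<bar> \<le> real k" for i
    using component_le_norm_cart[of x i] assms by simp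
  then show "x \<in> cube k" by (auto simp: cube_def mem_box_cart abs_le_iff minus_le_iff)
qed

lemma integral_cube_tendsto:
  fixes f :: "real ^ 'n::finite \<Rightarrow> 'b::banach"
  assumes "f integrable_on UNIV"
  shows "(\<lambda>k. integral (cube k) f) \<longlonglongrightarrow> integral UNIV f"
proof (rule LIMSEQ_I)
  fix e :: real assume "e > 0"
  have "(f has_integral integral UNIV f) UNIV" by (rule integrable_integral[OF assms])
  then obtain B where B: "\<And>a b. ball 0 B \<subseteq> cbox a b \<Longrightarrow> norm (integral (cbox a b) f - integral UNIV f) < e"
    unfolding has_integral_alt'[of f] using \<open>e > 0\<close> by simp metis
  obtain N :: nat where "B \<le> real N" using real_arch_simple by blast
  then have "norm (integral (cube k) f - integral UNIV f) < e" if "k \<ge> N" for k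
    using B ball_subset_cube[of B k] that unfolding cube_def by simp
  then show "\<exists>no. \<forall>n\<ge>no. norm (integral (cube n) f - integral UNIV f) < e" by blast
qed

text \<open>The truncation error depends on \<open>f\<close> only through \<open>C\<close>, which
  makes it uniform in any parameter on which \<open>f\<close> depends.\<close>

lemma integral_minus_cube_le:
  fixes f :: "real ^ 'n::finite \<Rightarrow> 'b::banach"
  assumes f: "decaying f" "\<And>x. norm (f x) \<le> C * weight x"
  shows "norm (integral UNIV f - integral (cube k) f)
    \<le> C * (integral UNIV (weight :: real^'n \<Rightarrow> real) - integral (cube k) (weight :: real^'n \<Rightarrow> real))"
proof -
  let ?r = "\<lambda>h (x::real^'n). if x \<in> cube k then h x else 0"
  have cu: "f integrable_on (cube k)" "(weight :: real^'n \<Rightarrow> real) integrable_on (cube k)"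
    unfolding cube_def by (intro decaying_integrable_cbox f(1) decaying_weight)+
  have fi: "f integrable_on UNIV" "?r f integrable_on UNIV"
    using f(1) cu(1) by (auto intro: decaying_integrable simp: integrable_restrict_UNIV)
  have wi: "(weight :: real^'n \<Rightarrow> real) integrable_on UNIV" "?r weight integrable_on UNIV"
    using cu(2) by (auto intro: integrable_weight simp: integrable_restrict_UNIV)
  have "integral UNIV f - integral (cube k) f = integral UNIV (\<lambda>x. f x - ?r f x)"
    by (subst integral_diff[OF fi]) (simp add: integral_restrict_UNIV)
  also have "norm \<dots> \<le> integral UNIV (\<lambda>x. C * (weight x - ?r weight x))"
  proof (rule Henstock_Kurzweil_Integration.integral_norm_bound_integral)
    show "(\<lambda>x. f x - ?r f x) integrable_on UNIV" by (rule integrable_diff[OF fi])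
    show "(\<lambda>x. C * (weight x - ?r weight x)) integrable_on UNIV"
      by (rule integrable_on_mult_right[OF integrable_diff[OF wi]])
    show "norm (f x - ?r f x) \<le> C * (weight x - ?r weight x)" for x
      using f(2)[of x] by simp
  qed
  also have "\<dots> = C * (integral UNIV (weight :: real^'n \<Rightarrow> real) - integral (cube k) (weight :: real^'n \<Rightarrow> real))"
    by (simp only: integral_mult_right integral_diff[OF wi] integral_restrict_UNIV)
  finally show ?thesis .
qed

lemma decaying_integral_bound:
  fixes f :: "real ^ 'n::finite \<Rightarrow> 'b::banach"
  assumes f: "decaying f" "\<And>x. norm (f x) \<le> C * weight x"
  shows "norm (integral UNIV f) \<le> C * integral UNIV (weight :: real^'n \<Rightarrow> real)"
proof -
  have "norm (integral UNIV f) \<le> integral UNIV (\<lambda>x::real^'n. C * weight x)"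
    by (rule Henstock_Kurzweil_Integration.integral_norm_bound_integral)
      (rule decaying_integrable f integrable_on_mult_right integrable_weight)+
  then show ?thesis by simp
qed

text \<open>Domination by the product of both weights lets the truncation error in one variable
  decay in the other, so that the outer integrand is again decaying.\<close>

locale decaying_kernel =
  fixes F :: "real ^ 'n::finite \<Rightarrow> real ^ 'm::finite \<Rightarrow> 'b::banach" and A :: real
  assumes continuous: "continuous_on UNIV (\<lambda>(u, v). F u v)"
    and bound: "\<And>u v. norm (F u v) \<le> A * weight u * weight v"
begin

lemma decaying_right: "decaying (F u)"
proof (rule decayingI[OF _ bound])
  have "continuous_on UNIV (\<lambda>v. (\<lambda>(u, v). F u v) (u, v))"
    by (rule continuous_on_compose2[OF continuous]) (intro continuous_intros, simp)
  then show "continuous_on UNIV (F u)" by simp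
qed

lemma tail_bound:
  "norm (integral UNIV (F u) - integral (cube k) (F u))
    \<le> (A * (integral UNIV (weight :: real^'m \<Rightarrow> real) - integral (cube k) (weight :: real^'m \<Rightarrow> real))) * weight u"
  using integral_minus_cube_le[OF decaying_right bound, of u k] by (simp add: mult_ac)

lemma tail_tendsto:
  "(\<lambda>k. A * (integral UNIV (weight :: real^'m \<Rightarrow> real) - integral (cube k) (weight :: real^'m \<Rightarrow> real))) \<longlonglongrightarrow> 0"
proof -
  let ?M = "integral UNIV (weight :: real^'m \<Rightarrow> real)"
  have "(\<lambda>k. A * (?M - integral (cube k) (weight :: real^'m \<Rightarrow> real))) \<longlonglongrightarrow> A * (?M - ?M)"
    by (intro tendsto_intros integral_cube_tendsto integrable_weight)
  then show ?thesis by simp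
qed

lemma continuous_cube: "continuous_on UNIV (\<lambda>u. integral (cube k) (F u))"
  unfolding cube_def
proof (rule integral_continuous_on_param)
  show "continuous_on (UNIV \<times> cbox (\<chi> i. - real k) (\<chi> i. real k)) (\<lambda>(x, y). F x y)"
    by (rule continuous_on_subset[OF continuous]) simp
qed

text \<open>For continuity: the integrals over cubes depend continuously on u, and they converge
  uniformly because the weight of u is at most 1.\<close>

lemma decaying_integral: "decaying (\<lambda>u. integral UNIV (F u))"
proof (rule decayingI)
  show "norm (integral UNIV (F u)) \<le> (A * integral UNIV (weight :: real^'m \<Rightarrow> real)) * weight u" for u
    using decaying_integral_bound[OF decaying_right bound, of u] by (simp add: mult_ac)
  show "continuous_on UNIV (\<lambda>u. integral UNIV (F u))"
  proof (rule uniform_limit_theorem)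
    show "\<forall>\<^sub>F k in sequentially. continuous_on UNIV (\<lambda>u. integral (cube k) (F u))"
      by (intro always_eventually allI continuous_cube)
    show "uniform_limit UNIV (\<lambda>k u. integral (cube k) (F u)) (\<lambda>u. integral UNIV (F u)) sequentially"
    proof (rule uniform_limitI)
      fix e :: real assume "e > 0"
      let ?d = "\<lambda>k. A * (integral UNIV (weight :: real^'m \<Rightarrow> real) - integral (cube k) (weight :: real^'m \<Rightarrow> real))"
      have "\<forall>\<^sub>F k in sequentially. ?d k < e"
        using tail_tendsto \<open>e > 0\<close> by (rule order_tendstoD)
      then show "\<forall>\<^sub>F k in sequentially. \<forall>u\<in>UNIV. dist (integral (cube k) (F u)) (integral UNIV (F u)) < e"
      proof (rule eventually_mono, intro ballI)
        fix k and u :: "real^'n" assume k: "?d k < e"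
        \<comment> \<open>The sign of \<open>?d k\<close> is left open: if it is nonnegative, the
          weight is at most 1; otherwise the product is not positive.\<close>
        have "?d k * weight u \<le> ?d k \<or> ?d k * weight u \<le> 0"
          using weight_le_1[of u] weight_nonneg[of u]
          by (metis linear mult_left_le mult_nonpos_nonneg)
        then show "dist (integral (cube k) (F u)) (integral UNIV (F u)) < e"
          using tail_bound[of u k] k \<open>e > 0\<close>
          unfolding dist_norm norm_minus_commute[of "integral (cube k) (F u)"] by linarith
      qed
    qed
  qed simp
qed

text \<open>Both variables are truncated at the same \<open>k\<close>. Truncating the inner one
  costs at most \<open>?d k * weight u\<close>, whose integral over u tends to 0.\<close>

lemma iterated_cube_tendsto:
  "(\<lambda>k. integral (cube k) (\<lambda>u. integral (cube k) (F u))) \<longlonglongrightarrow> integral UNIV (\<lambda>u. integral UNIV (F u))"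
proof -
  let ?I = "\<lambda>u. integral UNIV (F u)"
  let ?d = "\<lambda>k. A * (integral UNIV (weight :: real^'m \<Rightarrow> real) - integral (cube k) (weight :: real^'m \<Rightarrow> real))"
  let ?M = "integral UNIV (weight :: real^'n \<Rightarrow> real)"
  have "norm (integral (cube k) (\<lambda>u. integral (cube k) (F u)) - integral (cube k) ?I) \<le> ?d k * ?M" for k
  proof -
    have i1: "?I integrable_on cube k" and i2: "(\<lambda>u. integral (cube k) (F u)) integrable_on cube k"
      using decaying_integrable_cbox[OF decaying_integral]
        integrable_continuous[OF continuous_on_subset[OF continuous_cube]]
      by (auto simp: cube_def)
    have wi: "(\<lambda>u::real^'n. ?d k * weight u) integrable_on cube k"
      unfolding cube_def by (intro integrable_on_mult_right decaying_integrable_cbox decaying_weight)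
    have dk: "0 \<le> ?d k"
      using order_trans[OF norm_ge_zero tail_bound[of 0 k]] weight_pos[of "0::real^'n"]
      by (auto simp: zero_le_mult_iff)
    have "norm (integral (cube k) (\<lambda>u. integral (cube k) (F u)) - integral (cube k) ?I)
        = norm (integral (cube k) (\<lambda>u. integral (cube k) (F u) - ?I u))"
      by (simp add: integral_diff[OF i2 i1])
    also have "\<dots> \<le> integral (cube k) (\<lambda>u::real^'n. ?d k * weight u)"
      using tail_bound by (intro Henstock_Kurzweil_Integration.integral_norm_bound_integral
          integrable_diff i1 i2 wi) (simp add: norm_minus_commute)
    also have "\<dots> \<le> integral UNIV (\<lambda>u::real^'n. ?d k * weight u)"
      by (intro integral_subset_le wi integrable_on_mult_right integrable_weight)
        (use dk in \<open>auto simp: weight_nonneg intro!: mult_nonneg_nonneg\<close>)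
    finally show ?thesis by simp
  qed
  then have le: "\<forall>\<^sub>F k in sequentially. norm (integral (cube k) (\<lambda>u. integral (cube k) (F u))
      - integral (cube k) ?I) \<le> ?d k * ?M"
    by (intro always_eventually allI)
  have lim: "(\<lambda>k. ?d k * ?M) \<longlonglongrightarrow> 0"
    using tendsto_mult_right[OF tail_tendsto, of ?M] by simp
  have "(\<lambda>k. integral (cube k) (\<lambda>u. integral (cube k) (F u)) - integral (cube k) ?I) \<longlonglongrightarrow> 0"
    by (rule Lim_null_comparison[OF le lim])
  from tendsto_add[OF this integral_cube_tendsto[OF decaying_integrable[OF decaying_integral]]]
  show ?thesis by simp
qed

end

text \<open>On cubes continuity suffices for the exchange, and the iterated cube integrals converge
  to the two sides.\<close>

lemma integral_swap_decaying:
  fixes F :: "real ^ 'n::finite \<Rightarrow> real ^ 'm::finite \<Rightarrow> 'b::banach"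
  assumes c: "continuous_on UNIV (\<lambda>(u, v). F u v)"
    and b: "\<And>u v. norm (F u v) \<le> A * weight u * weight v"
  shows "integral UNIV (\<lambda>u. integral UNIV (F u)) = integral UNIV (\<lambda>v. integral UNIV (\<lambda>u. F u v))"
proof -
  have "continuous_on UNIV (\<lambda>p. (\<lambda>(u, v). F u v) (snd p, fst p))"
    by (rule continuous_on_compose2[OF c]) (intro continuous_intros, simp)
  then have c': "continuous_on UNIV (\<lambda>(v, u). F u v)" by (simp add: case_prod_unfold)
  interpret K: decaying_kernel F A by standard (rule c, rule b)
  interpret K': decaying_kernel "\<lambda>v u. F u v" A
    by standard (rule c', use b in \<open>simp add: mult_ac\<close>)
  have "integral (cube k) (\<lambda>u. integral (cube k) (F u))
      = integral (cube k) (\<lambda>v. integral (cube k) (\<lambda>u. F u v))" for k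
    unfolding cube_def
    by (rule integral_swap_continuous) (rule continuous_on_subset[OF c], simp)
  then show ?thesis
    using K.iterated_cube_tendsto K'.iterated_cube_tendsto LIMSEQ_unique by auto
qed

section \<open>Fourier inversion\<close>

definition gauss :: "real ^ 'n::finite \<Rightarrow> real" where
  "gauss z = (\<Prod>i\<in>UNIV. std_normal_density (z $ i))"

lemma gauss_nonneg: "0 \<le> gauss z"
  unfolding gauss_def by (intro prod_nonneg) simp

lemma continuous_on_gauss: "continuous_on S gauss"
  unfolding gauss_def std_normal_density_def by (intro continuous_intros) auto

lemma std_normal_density_le: "std_normal_density t \<le> exp (- t\<^sup>2 / 2)"
proof -
  have "1 \<le> 2 * pi" using pi_gt3 by simp
  then have "1 \<le> sqrt (2 * pi)" by (subst real_sqrt_ge_1_iff)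
  then have "1 / sqrt (2 * pi) \<le> 1" by (simp only: divide_le_eq_1) auto
  then show ?thesis unfolding std_normal_density_def by (intro mult_left_le_one_le) auto
qed

lemma gauss_le_1: "gauss z \<le> 1"
  unfolding gauss_def
proof (intro prod_le_1 conjI)
  fix i show "std_normal_density (z $ i) \<le> 1"
    by (rule order_trans[OF std_normal_density_le]) simp
qed simp

lemma gauss_le_weight: "gauss (z::real^'n::finite) \<le> 2 ^ CARD('n) * weight z"
proof -
  have "std_normal_density t \<le> 2 * inverse (1 + t\<^sup>2)" for t
  proof -
    have "1 + t\<^sup>2 / 2 \<le> exp (t\<^sup>2 / 2)" by (rule exp_ge_add_one_self)
    then have "(1 + t\<^sup>2) / 2 \<le> exp (t\<^sup>2 / 2)" by (simp add: field_simps)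
    then have "inverse (exp (t\<^sup>2 / 2)) \<le> inverse ((1 + t\<^sup>2) / 2)"
      using one_plus_square_pos[of t] by (intro le_imp_inverse_le) auto
    moreover have "exp (- t\<^sup>2 / 2) = inverse (exp (t\<^sup>2 / 2))"
      using exp_minus[of "t\<^sup>2 / 2"] by simp
    moreover have "inverse ((1 + t\<^sup>2) / 2) = 2 * inverse (1 + t\<^sup>2)"
      by (simp add: inverse_eq_divide)
    ultimately have "exp (- t\<^sup>2 / 2) \<le> 2 * inverse (1 + t\<^sup>2)" by (simp only:)
    then show ?thesis using std_normal_density_le order_trans by blast
  qed
  then have "gauss z \<le> (\<Prod>i\<in>(UNIV::'n set). 2 * inverse (1 + (z $ i)\<^sup>2))"
    unfolding gauss_def by (intro prod_mono) auto
  then show ?thesis by (simp add: weight_def prod.distrib)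
qed

lemma decaying_gauss: "decaying (gauss :: real^'n::finite \<Rightarrow> real)"
  by (rule decayingI[OF continuous_on_gauss, where C = "2 ^ CARD('n)"])
    (simp add: gauss_nonneg gauss_le_weight)

lemma has_integral_gauss: "((gauss :: real^'n::finite \<Rightarrow> real) has_integral 1) UNIV"
proof -
  have i: "integrable lborel (std_normal_density)" by (rule integrable_normal_density) simp
  have "integral\<^sup>L lborel (gauss :: real^'n \<Rightarrow> real) = (\<Prod>i\<in>(UNIV::'n set). 1)"
    unfolding gauss_def[abs_def] using integral_prod_vec[of "\<lambda>i::'n. std_normal_density"] i by simp
  moreover have "integrable lborel (gauss :: real^'n \<Rightarrow> real)"
    unfolding gauss_def[abs_def] by (rule integrable_prod_vec) (rule i)
  ultimately show ?thesis
    using has_integral_integral_lborel[of "gauss :: real^'n \<Rightarrow> real"] by simp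
qed

text \<open>Coordinatewise this is the characteristic function exp (-t^2/2) of the normal
  distribution; the factor sqrt (2 pi) in each coordinate turns it back into the density.\<close>

lemma gauss_char:
  fixes z :: "real^'n::finite"
  shows "integral UNIV (\<lambda>x. complex_of_real (gauss x) * exp (\<i> * complex_of_real (z \<bullet> x)))
    = complex_of_real (sqrt (2 * pi) ^ CARD('n) * gauss z)"
proof -
  define f where "f i t = std_normal_density t *\<^sub>R iexp ((z $ i) * t)" for i t
  have fi: "integrable lborel (f i)" for i
    unfolding f_def
    by (rule Bochner_Integration.integrable_bound[OF integrable_normal_density[of 1 0]]) auto
  have "integral\<^sup>L lborel (f i) = complex_of_real (exp (- ((z $ i)\<^sup>2) / 2))" for i
  proof -
    have "integral\<^sup>L lborel (f i) = char std_normal_distribution (z $ i)"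
      unfolding char_def f_def by (subst integral_density) auto
    then show ?thesis by (simp add: char_std_normal_distribution)
  qed
  moreover have "exp (- (t\<^sup>2) / 2) = sqrt (2 * pi) * std_normal_density t" for t
    by (simp add: std_normal_density_def)
  ultimately have fI: "integral\<^sup>L lborel (f i) = complex_of_real (sqrt (2 * pi) * std_normal_density (z $ i))" for i
    by simp
  have "(\<Prod>i\<in>UNIV. f i (x $ i)) = complex_of_real (gauss x) * exp (\<i> * complex_of_real (z \<bullet> x))" for x
    by (simp add: f_def gauss_def scaleR_conv_of_real prod.distrib inner_vec_def sum_distrib_left
        exp_sum[symmetric])
  then have "integral UNIV (\<lambda>x. complex_of_real (gauss x) * exp (\<i> * complex_of_real (z \<bullet> x)))
      = integral UNIV (\<lambda>x::real^'n. \<Prod>i\<in>UNIV. f i (x $ i))" by simp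
  also have "\<dots> = (\<Prod>i\<in>UNIV. integral\<^sup>L lborel (f i))"
    by (simp only: integral_lborel[OF integrable_prod_vec[OF fi]] integral_prod_vec[OF fi])
  also have "\<dots> = complex_of_real (sqrt (2 * pi) ^ CARD('n) * gauss z)"
    unfolding fI by (simp add: gauss_def prod.distrib)
  finally show ?thesis .
qed

section \<open>Gaussian regularisation of the Fourier integral\<close>

definition wave :: "real ^ 'n \<Rightarrow> real ^ 'n \<Rightarrow> complex" where
  "wave u v = exp (2 * complex_of_real pi * \<i> * complex_of_real (u \<bullet> v))"

text \<open>The exponent has the sign of the inner integral in \<open>L_schwartz\<close>. Inversion
  is needed only at the point 0, where the sign does not matter.\<close>

definition fourier :: "(real ^ 'n::finite \<Rightarrow> 'c::cstar_algebra) \<Rightarrow> real ^ 'n \<Rightarrow> 'c" where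
  "fourier h u = integral UNIV (\<lambda>v. wave u v *\<^sub>C h v)"

lemma norm_wave [simp]: "norm (wave u v) = 1"
proof -
  have "wave u v = exp (\<i> * complex_of_real (2 * pi * (u \<bullet> v)))" by (simp add: wave_def mult_ac)
  then show ?thesis by (simp only: norm_exp_i_times)
qed

lemma continuous_on_wave:
  "continuous_on S f \<Longrightarrow> continuous_on S g \<Longrightarrow> continuous_on S (\<lambda>x. wave (f x) (g x))"
  unfolding wave_def by (intro continuous_intros)

lemma bounded_bilinear_of_real_mult: "bounded_bilinear (\<lambda>(x::complex) r. complex_of_real r * x)"
proof -
  have "bounded_bilinear (\<lambda>(x::complex) (r::real). r *\<^sub>R x)"
    by (rule bounded_bilinear.flip[OF bounded_bilinear_scaleR])
  then show ?thesis by (simp only: scaleR_conv_of_real)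
qed

text \<open>The substitution x = 2 pi \<epsilon> u turns the wave into exp (i (v/\<epsilon>) . x),
  so that the result is a Gaussian of width \<epsilon> in v with total mass 1.\<close>

lemma integral_gauss_wave:
  fixes v :: "real^'n::finite"
  assumes "\<epsilon> > 0"
  shows "integral UNIV (\<lambda>u. complex_of_real (gauss ((2 * pi * \<epsilon>) *\<^sub>R u)) * wave u v)
    = complex_of_real (gauss (v /\<^sub>R \<epsilon>) / (sqrt (2 * pi) * \<epsilon>) ^ CARD('n))"
proof -
  let ?m = "2 * pi * \<epsilon>" and ?s = "sqrt (2 * pi)"
  let ?f = "\<lambda>x. complex_of_real (gauss x) * exp (\<i> * complex_of_real ((v /\<^sub>R \<epsilon>) \<bullet> x))"
  have m: "?m > 0" using assms by simp
  have "decaying (\<lambda>x. complex_of_real (gauss x) * exp (\<i> * complex_of_real ((v /\<^sub>R \<epsilon>) \<bullet> x)))"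
    by (rule decaying_bilinear[OF bounded_bilinear_of_real_mult _ _ decaying_gauss])
      (auto intro!: continuous_intros boundedI[of _ 1] simp del: inner_scaleR_left)
  then have int: "?f integrable_on UNIV" by (rule decaying_integrable)
  have eq: "complex_of_real (gauss (?m *\<^sub>R u)) * wave u v = ?f (?m *\<^sub>R u + 0)" for u
    using assms by (simp add: wave_def field_simps inner_commute)
  have "integral UNIV (\<lambda>u. complex_of_real (gauss (?m *\<^sub>R u)) * wave u v)
      = integral UNIV ?f /\<^sub>R ?m ^ CARD('n)"
    unfolding eq by (subst integral_affinity[OF int m]) simp
  also have "\<dots> = complex_of_real (gauss (v /\<^sub>R \<epsilon>)) * complex_of_real ((?s / ?m) ^ CARD('n))"
    unfolding gauss_char using assms by (simp add: scaleR_conv_of_real power_divide field_simps)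
  also have "?s / ?m = 1 / (?s * \<epsilon>)"
  proof -
    have ss: "?s * ?s = 2 * pi" and "?s > 0" by simp_all
    have "t / (t * t * \<epsilon>) = 1 / (t * \<epsilon>)" if "t > 0" for t :: real using that by simp
    from this[OF \<open>?s > 0\<close>] show ?thesis unfolding ss .
  qed
  finally show ?thesis by (simp add: power_divide)
qed

lemma inverse_Suc_tendsto_scaleR: "(\<lambda>k. inverse (real (Suc k)) *\<^sub>R x) \<longlonglongrightarrow> (0::'a::real_normed_vector)"
  using tendsto_scaleR[OF LIMSEQ_inverse_real_of_nat tendsto_const[of x]] by simp

text \<open>Rescaled Gaussians form an approximate identity. This serves twice: at 0 for Fourier
  inversion, and at an arbitrary point for the lower bound of the operator norm.\<close>

lemma gauss_average_tendsto:
  fixes h :: "real^'n::finite \<Rightarrow> 'b::banach"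
  assumes h: "continuous_on UNIV h" "bounded (range h)"
  shows "(\<lambda>k. integral UNIV (\<lambda>x. gauss x *\<^sub>R h (x0 + inverse (real (Suc k)) *\<^sub>R x))) \<longlonglongrightarrow> h x0"
proof -
  obtain M where M: "\<And>x. norm (h x) \<le> M" using h(2) by (auto simp: bounded_iff)
  have "(\<lambda>k. integral UNIV (\<lambda>x. gauss x *\<^sub>R h (x0 + inverse (real (Suc k)) *\<^sub>R x)))
      \<longlonglongrightarrow> integral UNIV (\<lambda>x::real^'n. gauss x *\<^sub>R h x0)"
  proof (rule decaying_dominated_convergence[where C = "2 ^ CARD('n) * M"])
    show "continuous_on UNIV (\<lambda>x. gauss x *\<^sub>R h (x0 + inverse (real (Suc k)) *\<^sub>R x))" for k
      by (intro continuous_intros continuous_on_gauss continuous_on_compose2[OF h(1)]) auto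
    show "continuous_on UNIV (\<lambda>x::real^'n. gauss x *\<^sub>R h x0)"
      by (intro continuous_intros continuous_on_gauss)
    fix x :: "real^'n" and k
    have "norm (gauss x *\<^sub>R h y) \<le> (2 ^ CARD('n) * weight x) * M" for y
      using M[of y] gauss_le_weight[of x] gauss_nonneg[of x] order_trans[OF norm_ge_zero M[of y]]
      by (auto simp: intro!: mult_mono)
    then show "norm (gauss x *\<^sub>R h (x0 + inverse (real (Suc k)) *\<^sub>R x)) \<le> 2 ^ CARD('n) * M * weight x"
      by (simp only: mult_ac)
    have "(\<lambda>k. x0 + inverse (real (Suc k)) *\<^sub>R x) \<longlonglongrightarrow> x0 + 0"
      by (intro tendsto_intros inverse_Suc_tendsto_scaleR)
    then have "(\<lambda>k. h (x0 + inverse (real (Suc k)) *\<^sub>R x)) \<longlonglongrightarrow> h x0"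
      by (intro continuous_on_tendsto_compose[OF h(1)]) auto
    then show "(\<lambda>k. gauss x *\<^sub>R h (x0 + inverse (real (Suc k)) *\<^sub>R x)) \<longlonglongrightarrow> gauss x *\<^sub>R h x0"
      by (intro tendsto_intros)
  qed
  moreover have "integral UNIV (\<lambda>x::real^'n. gauss x *\<^sub>R h x0) = h x0"
    by (rule integral_unique[OF has_integral_scaleR_left[OF has_integral_gauss, of "h x0", simplified]])
  ultimately show ?thesis by simp
qed

text \<open>This is the multiplication formula, which moves the transform from \<open>h\<close> to a
  Gaussian under the integral. The Gaussian supplies the decay in u that the wave lacks, so the
  integrals may be exchanged; the right side then arises from v = \<epsilon> x.\<close>

lemma fourier_gauss_average:
  fixes h :: "real^'n::finite \<Rightarrow> 'c::cstar_algebra"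
  assumes h: "decaying h" and \<epsilon>: "\<epsilon> > 0"
  shows "sqrt (2 * pi) ^ CARD('n) *\<^sub>R integral UNIV (\<lambda>u. gauss ((2 * pi * \<epsilon>) *\<^sub>R u) *\<^sub>R fourier h u)
    = integral UNIV (\<lambda>x. gauss x *\<^sub>R h (\<epsilon> *\<^sub>R x))"
proof -
  let ?m = "2 * pi * \<epsilon>" and ?s = "sqrt (2 * pi)" and ?n = "CARD('n)"
  have m: "?m > 0" using \<epsilon> by simp
  define F where "F u v = (complex_of_real (gauss (?m *\<^sub>R u)) * wave u v) *\<^sub>C h v" for u v
  obtain C where C: "continuous_on UNIV h" "0 \<le> C" "\<And>x. norm (h x) \<le> C * weight x"
    using decayingD[OF h] by blast
  obtain D where D: "0 \<le> D" "\<And>x. norm (gauss (?m *\<^sub>R x + 0 :: real^'n)) \<le> D * weight x"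
    using decayingD[OF decaying_affine[OF m decaying_gauss, of 0]] by metis
  have wh: "(\<lambda>v. wave u v *\<^sub>C h v) integrable_on UNIV" for u
    by (intro decaying_integrable decaying_bilinear[OF bounded_bilinear_scaleC _ _ h]
        continuous_on_wave continuous_intros boundedI[of _ 1]) auto
  have swap: "integral UNIV (\<lambda>u. integral UNIV (F u)) = integral UNIV (\<lambda>v. integral UNIV (\<lambda>u. F u v))"
  proof (rule integral_swap_decaying)
    have "continuous_on UNIV (\<lambda>p. F (fst p) (snd p))"
      unfolding F_def
      by (intro bounded_bilinear.continuous_on[OF bounded_bilinear_scaleC] continuous_intros
          continuous_on_wave continuous_on_compose2[OF continuous_on_gauss[of UNIV]]
          continuous_on_compose2[OF C(1)]) auto
    then show "continuous_on UNIV (\<lambda>(u, v). F u v)" by (simp add: case_prod_unfold)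
    fix u v
    have "norm (F u v) = norm (gauss (?m *\<^sub>R u)) * norm (h v)"
      by (simp add: F_def norm_scaleC norm_mult)
    also have "\<dots> \<le> (D * weight u) * (C * weight v)"
      using D(2)[of u] C(3)[of v] D(1) weight_nonneg[of u] by (intro mult_mono) auto
    finally show "norm (F u v) \<le> (D * C) * weight u * weight v" by (simp add: mult_ac)
  qed
  have L: "integral UNIV (F u) = gauss (?m *\<^sub>R u) *\<^sub>R fourier h u" for u
    unfolding fourier_def F_def
    by (subst integral_linear'[OF bounded_linear_scaleR_right wh, symmetric])
      (simp add: scaleC_scaleC[symmetric] scaleC_of_real)
  have wg: "(\<lambda>u. complex_of_real (gauss (?m *\<^sub>R u)) * wave u v) integrable_on UNIV" for v :: "real^'n"
  proof -
    have "decaying (\<lambda>u. complex_of_real (gauss (?m *\<^sub>R u + 0)) * wave u v)"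
      by (rule decaying_bilinear[OF bounded_bilinear_of_real_mult _ _ decaying_affine[OF m decaying_gauss]])
        (auto intro!: continuous_on_wave continuous_intros boundedI[of _ 1])
    then show ?thesis by (simp add: decaying_integrable)
  qed
  have R: "integral UNIV (\<lambda>u. F u v) = (1 / (?s * \<epsilon>) ^ ?n) *\<^sub>R (gauss (v /\<^sub>R \<epsilon>) *\<^sub>R h v)" for v
  proof -
    have "integral UNIV (\<lambda>u. F u v) = integral UNIV (\<lambda>u. complex_of_real (gauss (?m *\<^sub>R u)) * wave u v) *\<^sub>C h v"
      unfolding F_def by (rule integral_linear'[OF bounded_linear_scaleC_left wg])
    then show ?thesis
      unfolding integral_gauss_wave[OF \<epsilon>] by (simp add: scaleC_of_real del: of_real_divide of_real_power)
  qed
  let ?g = "\<lambda>v. gauss (v /\<^sub>R \<epsilon>) *\<^sub>R h v"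
  have "decaying ?g"
    by (rule decaying_bilinear[OF bounded_bilinear_scaleR _ _ h])
      (auto intro!: continuous_on_compose2[OF continuous_on_gauss[of UNIV]] continuous_intros
        boundedI[of _ 1] simp: gauss_nonneg gauss_le_1)
  then have gi: "?g integrable_on UNIV" by (rule decaying_integrable)
  have "integral UNIV (\<lambda>x. gauss x *\<^sub>R h (\<epsilon> *\<^sub>R x)) = integral UNIV (\<lambda>x. ?g (\<epsilon> *\<^sub>R x + 0))"
    using \<epsilon> by simp
  also have "\<dots> = integral UNIV ?g /\<^sub>R \<epsilon> ^ ?n"
    by (subst integral_affinity[OF gi \<epsilon>]) simp
  finally have A: "integral UNIV (\<lambda>x. gauss x *\<^sub>R h (\<epsilon> *\<^sub>R x)) = integral UNIV ?g /\<^sub>R \<epsilon> ^ ?n" .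
  have "integral UNIV (\<lambda>u. gauss (?m *\<^sub>R u) *\<^sub>R fourier h u)
      = integral UNIV (\<lambda>v. (1 / (?s * \<epsilon>) ^ ?n) *\<^sub>R ?g v)"
    using swap unfolding L R .
  also have "\<dots> = (1 / (?s * \<epsilon>) ^ ?n) *\<^sub>R integral UNIV ?g"
    by (rule integral_linear'[OF bounded_linear_scaleR_right gi])
  finally show ?thesis
    unfolding A by (simp add: power_mult_distrib divide_inverse)
qed

text \<open>Let \<epsilon> tend to 0 in \<open>fourier_gauss_average\<close>. The Gaussian factor
  tends to \<open>gauss 0\<close>, which cancels the constant in front, and the average on the right
  tends to \<open>h 0\<close>.\<close>

theorem fourier_inversion_at_0:
  fixes h :: "real^'n::finite \<Rightarrow> 'c::cstar_algebra"
  assumes h: "decaying h" and fh: "decaying (fourier h)"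
  shows "integral UNIV (fourier h) = h 0"
proof -
  let ?s = "sqrt (2 * pi) ^ CARD('n)"
  obtain C where C: "continuous_on UNIV (fourier h)" "0 \<le> C" "\<And>x. norm (fourier h x) \<le> C * weight x"
    using decayingD[OF fh] by blast
  have s: "?s > 0" by simp
  have g0: "gauss (0::real^'n) = 1 / ?s"
    by (simp add: gauss_def std_normal_density_def power_divide)
  have "(\<lambda>k. integral UNIV (\<lambda>u. gauss ((2 * pi * inverse (real (Suc k))) *\<^sub>R u) *\<^sub>R fourier h u))
    \<longlonglongrightarrow> integral UNIV (\<lambda>u. gauss (0::real^'n) *\<^sub>R fourier h u)"
  proof (rule decaying_dominated_convergence[where C = C])
    show "continuous_on UNIV (\<lambda>u. gauss ((2 * pi * inverse (real (Suc k))) *\<^sub>R u) *\<^sub>R fourier h u)" for k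
      by (intro continuous_intros continuous_on_compose2[OF continuous_on_gauss[of UNIV]] C(1)) auto
    show "continuous_on UNIV (\<lambda>u. gauss (0::real^'n) *\<^sub>R fourier h u)"
      by (intro continuous_intros C(1))
    fix u :: "real^'n" and k
    have "norm (gauss y *\<^sub>R fourier h u) \<le> 1 * (C * weight u)" for y :: "real^'n"
      unfolding norm_scaleR using C(3)[of u] gauss_le_1[of y] gauss_nonneg[of y]
      by (intro mult_mono) auto
    then show "norm (gauss ((2 * pi * inverse (real (Suc k))) *\<^sub>R u) *\<^sub>R fourier h u) \<le> C * weight u"
      by simp
    have "(\<lambda>k. (2 * pi * inverse (real (Suc k))) *\<^sub>R u) \<longlonglongrightarrow> 0"
      using tendsto_scaleR[OF tendsto_const[of "2 * pi"] inverse_Suc_tendsto_scaleR[of u]] by simp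
    then have "(\<lambda>k. gauss ((2 * pi * inverse (real (Suc k))) *\<^sub>R u)) \<longlonglongrightarrow> gauss (0::real^'n)"
      by (intro continuous_on_tendsto_compose[OF continuous_on_gauss[of UNIV]]) auto
    then show "(\<lambda>k. gauss ((2 * pi * inverse (real (Suc k))) *\<^sub>R u) *\<^sub>R fourier h u)
        \<longlonglongrightarrow> gauss (0::real^'n) *\<^sub>R fourier h u" by (intro tendsto_intros)
  qed
  from tendsto_scaleR[OF tendsto_const[of ?s] this]
  have "(\<lambda>k. integral UNIV (\<lambda>x. gauss x *\<^sub>R h (inverse (real (Suc k)) *\<^sub>R x)))
    \<longlonglongrightarrow> ?s *\<^sub>R integral UNIV (\<lambda>u. gauss (0::real^'n) *\<^sub>R fourier h u)"
    by (subst (asm) fourier_gauss_average[OF h]) auto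
  moreover have "(\<lambda>k. integral UNIV (\<lambda>x. gauss x *\<^sub>R h (inverse (real (Suc k)) *\<^sub>R x))) \<longlonglongrightarrow> h 0"
    using gauss_average_tendsto[OF decaying_continuous[OF h] decaying_bounded[OF h], of 0] by simp
  ultimately have "?s *\<^sub>R integral UNIV (\<lambda>u. gauss (0::real^'n) *\<^sub>R fourier h u) = h 0"
    by (rule LIMSEQ_unique)
  moreover have "integral UNIV (\<lambda>u. gauss (0::real^'n) *\<^sub>R fourier h u)
      = gauss (0::real^'n) *\<^sub>R integral UNIV (fourier h)"
    by (rule integral_linear'[OF bounded_linear_scaleR_right decaying_integrable[OF fh]])
  ultimately show ?thesis using s by (simp add: g0)
qed

section \<open>Calculus of smooth bounded and Schwartz functions\<close>

text \<open>\<open>partial_deriv\<close> is total; this relation also records that the derivative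
  exists, so that rules of differentiation can be chained.\<close>

definition has_pd :: "'n \<Rightarrow> (real ^ 'n::finite \<Rightarrow> 'b) \<Rightarrow> (real ^ 'n \<Rightarrow> 'b::real_normed_vector) \<Rightarrow> bool" where
  "has_pd i F F' \<longleftrightarrow> (\<forall>x. ((\<lambda>t. F (x + t *\<^sub>R axis i 1)) has_vector_derivative F' x) (at 0))"

lemma has_pd_imp_differentiable: "has_pd i F F' \<Longrightarrow> (\<lambda>t. F (x + t *\<^sub>R axis i 1)) differentiable (at 0)"
  by (auto simp: has_pd_def intro: differentiableI_vector)

lemma has_pd_imp_eq: "has_pd i F F' \<Longrightarrow> partial_deriv i F = F'"
  by (auto simp: has_pd_def partial_deriv_def fun_eq_iff intro: vector_derivative_at)

lemma has_pd_partial_deriv: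
  "(\<And>x. (\<lambda>t. F (x + t *\<^sub>R axis i 1)) differentiable (at 0)) \<Longrightarrow> has_pd i F (partial_deriv i F)"
  by (simp add: has_pd_def partial_deriv_def vector_derivative_works[symmetric])

text \<open>\<open>has_pd\<close> differentiates at parameter 0 only; the mean value inequality
  along a segment needs the derivative at every parameter.\<close>

lemma has_pd_shift:
  assumes "has_pd i F F'"
  shows "((\<lambda>t. F (x + t *\<^sub>R axis i 1)) has_vector_derivative F' (x + s *\<^sub>R axis i 1)) (at s)"
proof -
  have "((\<lambda>t. F ((x + s *\<^sub>R axis i 1) + t *\<^sub>R axis i 1)) has_vector_derivative F' (x + s *\<^sub>R axis i 1)) (at (s - s))"
    using assms by (simp add: has_pd_def)
  moreover have "((\<lambda>t. t - s) has_vector_derivative 1) (at s)"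
    by (auto intro!: derivative_eq_intros)
  ultimately have "(((\<lambda>t. F ((x + s *\<^sub>R axis i 1) + t *\<^sub>R axis i 1)) \<circ> (\<lambda>t. t - s))
      has_vector_derivative 1 *\<^sub>R F' (x + s *\<^sub>R axis i 1)) (at s)"
    by (intro vector_diff_chain_at)
  then show ?thesis by (simp add: o_def algebra_simps)
qed

lemma has_pd_linear:
  assumes "bounded_linear T" "has_pd i F F'"
  shows "has_pd i (\<lambda>x. T (F x)) (\<lambda>x. T (F' x))"
  using assms by (auto simp: has_pd_def intro: bounded_linear.has_vector_derivative)

lemma has_pd_add: "has_pd i F F' \<Longrightarrow> has_pd i G G' \<Longrightarrow> has_pd i (\<lambda>x. F x + G x) (\<lambda>x. F' x + G' x)"
  by (auto simp: has_pd_def intro: has_vector_derivative_add)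

lemma has_pd_bilinear:
  assumes "bounded_bilinear B" "has_pd i F F'" "has_pd i G G'"
  shows "has_pd i (\<lambda>x. B (F x) (G x)) (\<lambda>x. B (F x) (G' x) + B (F' x) (G x))"
  unfolding has_pd_def
proof
  fix x
  have "((\<lambda>t. F (x + t *\<^sub>R axis i 1)) has_vector_derivative F' x) (at 0)"
    "((\<lambda>t. G (x + t *\<^sub>R axis i 1)) has_vector_derivative G' x) (at 0)"
    using assms by (auto simp: has_pd_def)
  from bounded_bilinear.has_vector_derivative[OF assms(1) this]
  show "((\<lambda>t. B (F (x + t *\<^sub>R axis i 1)) (G (x + t *\<^sub>R axis i 1)))
      has_vector_derivative B (F x) (G' x) + B (F' x) (G x)) (at 0)" by simp
qed

section \<open>Smoothness from families closed under partial derivatives\<close>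

lemma partial_derivs_append: "partial_derivs (js @ ks) f = partial_derivs js (partial_derivs ks f)"
  by (induction js) auto

lemma smooth_continuous: "smooth f \<Longrightarrow> continuous_on UNIV (partial_derivs js f)"
  by (simp add: smooth_def)

lemma smooth_has_pd: "smooth f \<Longrightarrow> has_pd i f (partial_deriv i f)"
  unfolding smooth_def by (rule has_pd_partial_deriv) (metis partial_derivs.simps(1))

lemma smooth_partial_deriv: "smooth f \<Longrightarrow> smooth (partial_deriv i f)"
  unfolding smooth_def by (metis partial_derivs.simps partial_derivs_append)

text \<open>If every member of \<open>S\<close> is continuous and has all its partial derivatives in
  \<open>S\<close>, then all iterated derivatives of \<open>f\<close> stay in \<open>S\<close> and
  inherit what is known of its members. No formula for iterated derivatives is needed.\<close>

lemma
  assumes f: "f \<in> S"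
    and cont: "\<And>F. F \<in> S \<Longrightarrow> continuous_on UNIV F"
    and pd: "\<And>F i. F \<in> S \<Longrightarrow> \<exists>F'\<in>S. has_pd i F F'"
  shows closed_partial_derivs: "partial_derivs js f \<in> S"
    and closed_smooth: "smooth f"
proof -
  show *: "partial_derivs js f \<in> S" for js
  proof (induction js)
    case (Cons i js)
    then show ?case using pd[of "partial_derivs js f" i] has_pd_imp_eq by auto
  qed (simp add: f)
  show "smooth f"
    unfolding smooth_def using cont[OF *] pd[OF *] has_pd_imp_differentiable by metis
qed

lemma schwartzI:
  assumes "f \<in> S"
    and "\<And>F. F \<in> S \<Longrightarrow> continuous_on UNIV F"
    and "\<And>F i. F \<in> S \<Longrightarrow> \<exists>F'\<in>S. has_pd i F F'"
    and "\<And>F k. F \<in> S \<Longrightarrow> bounded (range (\<lambda>x. norm x ^ k *\<^sub>R F x))"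
  shows "f \<in> schwartz"
  using closed_partial_derivs[OF assms(1-3)] closed_smooth[OF assms(1-3)] assms(4)
  by (auto simp: schwartz_def)

lemma smooth_boundedI:
  assumes "f \<in> S"
    and "\<And>F. F \<in> S \<Longrightarrow> continuous_on UNIV F"
    and "\<And>F i. F \<in> S \<Longrightarrow> \<exists>F'\<in>S. has_pd i F F'"
    and "\<And>F. F \<in> S \<Longrightarrow> bounded (range F)"
  shows "f \<in> smooth_bounded"
  using closed_partial_derivs[OF assms(1-3)] closed_smooth[OF assms(1-3)] assms(4)
  by (auto simp: smooth_bounded_def)

lemma schwartz_smooth: "g \<in> schwartz \<Longrightarrow> smooth g"
  by (simp add: schwartz_def)

lemma schwartz_continuous: "g \<in> schwartz \<Longrightarrow> continuous_on S g"
  using smooth_continuous[OF schwartz_smooth, of g "[]"] by (auto intro: continuous_on_subset)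

lemma schwartz_bounded: "g \<in> schwartz \<Longrightarrow> bounded (range (\<lambda>x. norm x ^ k *\<^sub>R g x))"
  unfolding schwartz_def by (auto dest!: spec[of _ "[]"] spec[of _ k])

lemma schwartz_partial_deriv: "g \<in> schwartz \<Longrightarrow> partial_deriv i g \<in> schwartz"
  unfolding schwartz_def using smooth_partial_deriv[of g i]
  by (auto simp: partial_derivs_append[symmetric, of _ "[i]", simplified])

lemma schwartz_pd: "g \<in> schwartz \<Longrightarrow> \<exists>g'\<in>schwartz. has_pd i g g'"
  using schwartz_partial_deriv smooth_has_pd[OF schwartz_smooth] by blast

lemma smooth_bounded_continuous: "f \<in> smooth_bounded \<Longrightarrow> continuous_on S f"
  using smooth_continuous[of f "[]"] by (auto simp: smooth_bounded_def intro: continuous_on_subset)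

lemma smooth_bounded_bounded: "f \<in> smooth_bounded \<Longrightarrow> bounded (range f)"
  unfolding smooth_bounded_def by (auto dest!: spec[of _ "[]"])

lemma smooth_bounded_pd: "f \<in> smooth_bounded \<Longrightarrow> \<exists>f'\<in>smooth_bounded. has_pd i f f'"
proof (intro bexI)
  assume f: "f \<in> smooth_bounded"
  then show "has_pd i f (partial_deriv i f)" by (intro smooth_has_pd) (simp add: smooth_bounded_def)
  show "partial_deriv i f \<in> smooth_bounded"
    using f unfolding smooth_bounded_def using smooth_partial_deriv[of f i]
    by (auto simp: partial_derivs_append[symmetric, of _ "[i]", simplified])
qed

lemma bounded_range_linear: "bounded_linear T \<Longrightarrow> bounded (range F) \<Longrightarrow> bounded (range (\<lambda>x. T (F x)))"
  using bounded_linear_image[of "range F" T] by (simp add: image_image)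

lemma schwartz_linear:
  assumes T: "bounded_linear T" and g: "g \<in> schwartz"
  shows "(\<lambda>x. T (g x)) \<in> schwartz"
proof (rule schwartzI[where S = "(\<lambda>F x. T (F x)) ` schwartz"])
  fix F k i assume "F \<in> (\<lambda>F x. T (F x)) ` schwartz"
  then obtain G where G: "F = (\<lambda>x. T (G x))" "G \<in> schwartz" by auto
  show "continuous_on UNIV F"
    unfolding G by (intro bounded_linear.continuous_on[OF T] schwartz_continuous G)
  obtain G' where G': "G' \<in> schwartz" "has_pd i G G'" using schwartz_pd[OF G(2)] by blast
  show "\<exists>F'\<in>(\<lambda>F x. T (F x)) ` schwartz. has_pd i F F'"
    unfolding G(1) using has_pd_linear[OF T G'(2)] G'(1) by blast
  have "bounded (range (\<lambda>x. T (norm x ^ k *\<^sub>R G x)))"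
    by (rule bounded_range_linear[OF T schwartz_bounded[OF G(2)]])
  then show "bounded (range (\<lambda>x. norm x ^ k *\<^sub>R F x))"
    unfolding G(1) by (simp only: linear_simps(5)[OF T])
qed (use g in auto)

lemma smooth_bounded_linear:
  assumes T: "bounded_linear T" and g: "g \<in> smooth_bounded"
  shows "(\<lambda>x. T (g x)) \<in> smooth_bounded"
proof (rule smooth_boundedI[where S = "(\<lambda>F x. T (F x)) ` smooth_bounded"])
  fix F i assume "F \<in> (\<lambda>F x. T (F x)) ` smooth_bounded"
  then obtain G where G: "F = (\<lambda>x. T (G x))" "G \<in> smooth_bounded" by auto
  show "continuous_on UNIV F"
    unfolding G by (intro bounded_linear.continuous_on[OF T] smooth_bounded_continuous G)
  obtain G' where G': "G' \<in> smooth_bounded" "has_pd i G G'" using smooth_bounded_pd[OF G(2)] by blast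
  show "\<exists>F'\<in>(\<lambda>F x. T (F x)) ` smooth_bounded. has_pd i F F'"
    unfolding G(1) using has_pd_linear[OF T G'(2)] G'(1) by blast
  show "bounded (range F)"
    unfolding G(1) by (rule bounded_range_linear[OF T smooth_bounded_bounded[OF G(2)]])
qed (use g in auto)

lemma schwartz_add:
  fixes f g :: "real ^ 'n::finite \<Rightarrow> 'c::cstar_algebra"
  assumes "f \<in> schwartz" "g \<in> schwartz"
  shows "(\<lambda>x. f x + g x) \<in> schwartz"
proof (rule schwartzI[where S = "{\<lambda>x. F x + G x | F G. F \<in> schwartz \<and> G \<in> schwartz}"])
  fix H k i assume "H \<in> {\<lambda>x. F x + G x | F G. F \<in> schwartz \<and> G \<in> (schwartz :: (real^'n \<Rightarrow> 'c) set)}"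
  then obtain F G where H: "H = (\<lambda>x. F x + G x)" "F \<in> schwartz" "G \<in> schwartz" by auto
  show "continuous_on UNIV H"
    unfolding H by (intro continuous_intros schwartz_continuous H)
  obtain F' G' where "F' \<in> schwartz" "has_pd i F F'" "G' \<in> schwartz" "has_pd i G G'"
    using schwartz_pd[OF H(2)] schwartz_pd[OF H(3)] by blast
  then show "\<exists>H'\<in>{\<lambda>x. F x + G x | F G. F \<in> schwartz \<and> G \<in> schwartz}. has_pd i H H'"
    unfolding H(1) using has_pd_add by blast
  show "bounded (range (\<lambda>x. norm x ^ k *\<^sub>R H x))"
    unfolding H(1) scaleR_add_right by (intro bounded_plus_comp schwartz_bounded H)
qed (use assms in auto)

lemma schwartz_scaleC: "g \<in> schwartz \<Longrightarrow> (\<lambda>x. c *\<^sub>C g x) \<in> schwartz"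
  by (rule schwartz_linear[OF bounded_linear_scaleC_right])

lemma schwartz_scaleR: "g \<in> schwartz \<Longrightarrow> (\<lambda>x. r *\<^sub>R g x) \<in> schwartz"
  by (rule schwartz_linear[OF bounded_linear_scaleR_right])

lemma schwartz_diff: "f \<in> schwartz \<Longrightarrow> g \<in> schwartz \<Longrightarrow> (\<lambda>x. f x - g x) \<in> schwartz"
  using schwartz_add[OF _ schwartz_scaleR[of g "-1"], of f] by simp

lemma smooth_bounded_star: "f \<in> smooth_bounded \<Longrightarrow> (\<lambda>x. star (f x)) \<in> smooth_bounded"
  by (rule smooth_bounded_linear[OF bounded_linear_star])

text \<open>Closed under partial derivatives by the product rule; it replaces the Leibniz formula
  for iterated derivatives.\<close>

inductive_set leibniz_span :: "(real ^ 'n::finite \<Rightarrow> 'c::cstar_algebra) set" where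
  mult: "f \<in> smooth_bounded \<Longrightarrow> g \<in> schwartz \<Longrightarrow> (\<lambda>x. f x * g x) \<in> leibniz_span"
| add: "F \<in> leibniz_span \<Longrightarrow> G \<in> leibniz_span \<Longrightarrow> (\<lambda>x. F x + G x) \<in> leibniz_span"

lemma schwartz_mult:
  fixes f g :: "real ^ 'n::finite \<Rightarrow> 'c::cstar_algebra"
  assumes "f \<in> smooth_bounded" "g \<in> schwartz"
  shows "(\<lambda>x. f x * g x) \<in> schwartz"
proof (rule schwartzI[where S = leibniz_span])
  show "(\<lambda>x. f x * g x) \<in> leibniz_span" by (rule leibniz_span.mult[OF assms])
next
  fix F :: "real^'n \<Rightarrow> 'c" assume "F \<in> leibniz_span"
  then show "continuous_on UNIV F"
  proof induction
    case (mult f g)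
    show ?case
      by (rule continuous_on_mult[OF smooth_bounded_continuous[OF mult(1)] schwartz_continuous[OF mult(2)]])
  next
    case (add F G)
    show ?case by (rule continuous_on_add[OF add.IH])
  qed
next
  fix F :: "real^'n \<Rightarrow> 'c" and i assume "F \<in> leibniz_span"
  then show "\<exists>F'\<in>leibniz_span. has_pd i F F'"
  proof induction
    case (mult f g)
    obtain f' where f': "f' \<in> smooth_bounded" "has_pd i f f'" using smooth_bounded_pd[OF mult(1)] by blast
    obtain g' where g': "g' \<in> schwartz" "has_pd i g g'" using schwartz_pd[OF mult(2)] by blast
    have "(\<lambda>x. f x * g' x + f' x * g x) \<in> leibniz_span"
      by (intro leibniz_span.intros mult f' g')
    then show ?case using has_pd_bilinear[OF bounded_bilinear_mult f'(2) g'(2)] by blast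
  next
    case (add F G)
    then obtain F' G' where "F' \<in> leibniz_span" "has_pd i F F'" "G' \<in> leibniz_span" "has_pd i G G'" by blast
    then show ?case using has_pd_add leibniz_span.add by blast
  qed
next
  fix F :: "real^'n \<Rightarrow> 'c" and k assume "F \<in> leibniz_span"
  then show "bounded (range (\<lambda>x. norm x ^ k *\<^sub>R F x))"
  proof induction
    case (mult f g)
    obtain M where M: "\<And>x. norm (f x) \<le> M"
      using smooth_bounded_bounded[OF mult(1)] by (auto simp: bounded_iff)
    obtain N where N: "\<And>x. norm (norm x ^ k *\<^sub>R g x) \<le> N"
      using schwartz_bounded[OF mult(2), of k] unfolding bounded_iff by blast
    have "norm (f x * (norm x ^ k *\<^sub>R g x)) \<le> M * N" for x
      using order_trans[OF norm_ge_zero M[of x]]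
      by (intro order_trans[OF norm_mult_ineq] mult_mono M N) auto
    then have "bounded (range (\<lambda>x. f x * (norm x ^ k *\<^sub>R g x)))"
      unfolding bounded_iff by blast
    then show ?case by simp
  next
    case (add F G)
    then show ?case unfolding scaleR_add_right by (intro bounded_plus_comp)
  qed
qed

section \<open>Gaussians are Schwartz functions\<close>

lemma power_le_exp: "0 \<le> y \<Longrightarrow> y ^ k \<le> real k ^ k * exp y"
proof (cases "k = 0")
  case False
  assume y: "0 \<le> y"
  \<comment> \<open>The claim is the k-th power of this inequality.\<close>
  have "y / real k \<le> exp (y / real k)" using exp_ge_add_one_self[of "y / real k"] by linarith
  then have "(y / real k) ^ k \<le> exp (y / real k) ^ k" using y by (intro power_mono) auto
  also have "\<dots> = exp y" using False by (simp add: exp_of_nat_mult[symmetric])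
  finally show ?thesis using False by (simp add: power_divide field_simps)
qed simp

text \<open>Polynomials in the coordinates of x - x0 times one Gaussian: a family that contains the
  Gaussian and is closed under partial derivatives.\<close>

inductive_set gaussian_span :: "real \<Rightarrow> real ^ 'n::finite \<Rightarrow> 'c::cstar_algebra \<Rightarrow> (real ^ 'n \<Rightarrow> 'c) set"
  for a x0 c where
  base: "(\<lambda>x. exp (- a * ((x - x0) \<bullet> (x - x0))) *\<^sub>R c) \<in> gaussian_span a x0 c"
| coord: "F \<in> gaussian_span a x0 c \<Longrightarrow> (\<lambda>x. (x $ i - x0 $ i) *\<^sub>R F x) \<in> gaussian_span a x0 c"
| scale: "F \<in> gaussian_span a x0 c \<Longrightarrow> (\<lambda>x. r *\<^sub>R F x) \<in> gaussian_span a x0 c"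
| add: "F \<in> gaussian_span a x0 c \<Longrightarrow> G \<in> gaussian_span a x0 c \<Longrightarrow> (\<lambda>x. F x + G x) \<in> gaussian_span a x0 c"

lemma has_pd_coord: "has_pd i (\<lambda>x. x $ j - x0) (\<lambda>x. axis i 1 $ j)"
  unfolding has_pd_def by (auto intro!: derivative_eq_intros simp: has_real_derivative_iff_has_vector_derivative[symmetric])

lemma gaussian_schwartz:
  fixes x0 :: "real^'n::finite" and c :: "'c::cstar_algebra"
  assumes a: "a > 0"
  shows "(\<lambda>x. exp (- a * ((x - x0) \<bullet> (x - x0))) *\<^sub>R c) \<in> schwartz"
proof (rule schwartzI[where S = "gaussian_span a x0 c"])
  show "(\<lambda>x. exp (- a * ((x - x0) \<bullet> (x - x0))) *\<^sub>R c) \<in> gaussian_span a x0 c" by (rule gaussian_span.base)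
next
  fix F :: "real^'n \<Rightarrow> 'c" assume "F \<in> gaussian_span a x0 c"
  then show "continuous_on UNIV F" by induction (auto intro!: continuous_intros)
next
  fix F :: "real^'n \<Rightarrow> 'c" and i assume "F \<in> gaussian_span a x0 c"
  then show "\<exists>F'\<in>gaussian_span a x0 c. has_pd i F F'"
  proof induction
    case base
    let ?b = "\<lambda>x. exp (- a * ((x - x0) \<bullet> (x - x0))) *\<^sub>R c"
    have "(\<lambda>x. (- 2 * a) *\<^sub>R ((x $ i - x0 $ i) *\<^sub>R ?b x)) \<in> gaussian_span a x0 c"
      by (intro gaussian_span.intros)
    moreover have "has_pd i ?b (\<lambda>x. (- 2 * a) *\<^sub>R ((x $ i - x0 $ i) *\<^sub>R ?b x))"
      unfolding has_pd_def
    proof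
      fix x :: "real^'n"
      have "((\<lambda>t. exp (- a * ((x + t *\<^sub>R axis i 1 - x0) \<bullet> (x + t *\<^sub>R axis i 1 - x0)))) has_real_derivative
          (- 2 * a * (x $ i - x0 $ i)) * exp (- a * ((x - x0) \<bullet> (x - x0)))) (at 0)"
      proof -
        have e: "(x + t *\<^sub>R axis i 1 - x0) \<bullet> (x + t *\<^sub>R axis i 1 - x0)
            = (x - x0) \<bullet> (x - x0) + 2 * t * (x $ i - x0 $ i) + t * t" for t
        proof -
          have "x + t *\<^sub>R axis i 1 - x0 = (x - x0) + t *\<^sub>R axis i 1" by simp
          then show ?thesis
            by (simp add: inner_add_left inner_add_right inner_axis inner_axis' axis_nth algebra_simps)
        qed
        show ?thesis unfolding e by (auto intro!: derivative_eq_intros)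
      qed
      then have "((\<lambda>t. exp (- a * ((x + t *\<^sub>R axis i 1 - x0) \<bullet> (x + t *\<^sub>R axis i 1 - x0))) *\<^sub>R c) has_vector_derivative
          ((- 2 * a * (x $ i - x0 $ i)) * exp (- a * ((x - x0) \<bullet> (x - x0)))) *\<^sub>R c) (at 0)"
        by (intro bounded_linear.has_vector_derivative[OF bounded_linear_scaleR_left])
          (simp add: has_real_derivative_iff_has_vector_derivative)
      then show "((\<lambda>t. ?b (x + t *\<^sub>R axis i 1)) has_vector_derivative
          (- 2 * a) *\<^sub>R ((x $ i - x0 $ i) *\<^sub>R ?b x)) (at 0)"
        by (simp add: mult.assoc)
    qed
    ultimately show ?case by blast
  next
    case (coord F j)
    then obtain F' where F': "F' \<in> gaussian_span a x0 c" "has_pd i F F'" by blast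
    have "(\<lambda>x. (x $ j - x0 $ j) *\<^sub>R F' x + (axis i 1 $ j) *\<^sub>R F x) \<in> gaussian_span a x0 c"
      by (intro gaussian_span.intros F' coord)
    then show ?case using has_pd_bilinear[OF bounded_bilinear_scaleR has_pd_coord F'(2)] by blast
  next
    case (scale F r)
    then obtain F' where F': "F' \<in> gaussian_span a x0 c" "has_pd i F F'" by blast
    then show ?case
      using has_pd_linear[OF bounded_linear_scaleR_right F'(2)] gaussian_span.scale by blast
  next
    case (add F G)
    then obtain F' G' where "F' \<in> gaussian_span a x0 c" "has_pd i F F'" "G' \<in> gaussian_span a x0 c" "has_pd i G G'" by blast
    then show ?case using has_pd_add gaussian_span.add by blast
  qed
next
  fix F :: "real^'n \<Rightarrow> 'c" and k assume "F \<in> gaussian_span a x0 c"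
  then show "bounded (range (\<lambda>x. norm x ^ k *\<^sub>R F x))"
  proof (induction arbitrary: k)
    case base
    define R where "R = norm x0"
    have R: "0 \<le> R" by (simp add: R_def)
    show ?case
    proof (rule boundedI)
      fix y assume "y \<in> range (\<lambda>x. norm x ^ k *\<^sub>R (exp (- a * ((x - x0) \<bullet> (x - x0))) *\<^sub>R c))"
      then obtain x where y: "y = norm x ^ k *\<^sub>R (exp (- a * ((x - x0) \<bullet> (x - x0))) *\<^sub>R c)" by auto
      define r where "r = norm (x - x0)"
      have r: "0 \<le> r" "norm x \<le> r + R"
        using norm_triangle_sub[of x x0] by (auto simp: r_def R_def)
      \<comment> \<open>Completing the square lets the Gaussian absorb the factor exp r that bounds
        the power of |x|.\<close>
      have "r - a * r\<^sup>2 \<le> 1 / (4 * a)"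
      proof -
        have "0 \<le> (2 * a * r - 1)\<^sup>2" by simp
        then show ?thesis using a by (simp add: power2_eq_square field_simps)
      qed
      then have e: "exp (r + R) * exp (- a * r\<^sup>2) \<le> exp (1 / (4 * a) + R)"
        by (simp flip: exp_add)
      have "norm x ^ k \<le> (r + R) ^ k" using r by (intro power_mono) auto
      also have "\<dots> \<le> real k ^ k * exp (r + R)" using r R by (intro power_le_exp) auto
      finally have "norm x ^ k * exp (- a * r\<^sup>2) \<le> real k ^ k * exp (r + R) * exp (- a * r\<^sup>2)"
        by (intro mult_right_mono) auto
      also have "\<dots> \<le> real k ^ k * exp (1 / (4 * a) + R)"
        using mult_left_mono[OF e, of "real k ^ k"] by (simp add: mult.assoc)
      finally have "norm x ^ k * exp (- a * r\<^sup>2) * norm c \<le> real k ^ k * exp (1 / (4 * a) + R) * norm c"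
        by (rule mult_right_mono) simp
      then show "norm y \<le> real k ^ k * exp (1 / (4 * a) + R) * norm c"
        by (simp add: y r_def power2_norm_eq_inner mult.assoc)
    qed
  next
    case (coord F j)
    \<comment> \<open>A coordinate factor costs one power of |x|, so the induction hypothesis is
      used for k + 1, and for k because of the summand |x0|.\<close>
    obtain M where M: "\<And>x. norm (norm x ^ Suc k *\<^sub>R F x) \<le> M"
      using coord.IH[of "Suc k"] by (auto simp: bounded_iff)
    obtain N where N: "\<And>x. norm (norm x ^ k *\<^sub>R F x) \<le> N"
      using coord.IH[of k] by (auto simp: bounded_iff)
    show ?case
    proof (rule boundedI)
      fix y assume "y \<in> range (\<lambda>x. norm x ^ k *\<^sub>R ((x $ j - x0 $ j) *\<^sub>R F x))"
      then obtain x where y: "y = norm x ^ k *\<^sub>R ((x $ j - x0 $ j) *\<^sub>R F x)" by auto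
      have "\<bar>x $ j - x0 $ j\<bar> \<le> norm x + norm x0"
        using component_le_norm_cart[of x j] component_le_norm_cart[of x0 j] by linarith
      then have "norm y \<le> norm x ^ k * ((norm x + norm x0) * norm (F x))"
        unfolding y by (auto intro!: mult_left_mono mult_right_mono simp: abs_mult mult.assoc)
      also have "\<dots> = norm (norm x ^ Suc k *\<^sub>R F x) + norm x0 * norm (norm x ^ k *\<^sub>R F x)"
        by (simp add: algebra_simps)
      also have "\<dots> \<le> M + norm x0 * N" by (intro add_mono mult_left_mono M N) simp
      finally show "norm y \<le> M + norm x0 * N" .
    qed
  next
    case (scale F r)
    from bounded_range_linear[OF bounded_linear_scaleR_right[of r] scale.IH[of k]]
    show ?case by (simp add: mult.commute)
  next
    case (add F G)
    then show ?case unfolding scaleR_add_right by (intro bounded_plus_comp)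
  qed
qed

section \<open>The Fourier transform of a Schwartz function\<close>

lemma one_plus_power_le:
  fixes t :: real
  assumes "0 \<le> t"
  shows "(1 + t) ^ n \<le> 2 ^ n * (1 + t ^ n)"
proof (cases "t \<le> 1")
  case True
  then have "(1 + t) ^ n \<le> 2 ^ n" using assms by (intro power_mono) auto
  also have "\<dots> \<le> 2 ^ n * (1 + t ^ n)" using assms by simp
  finally show ?thesis .
next
  case False
  then have "(1 + t) ^ n \<le> (2 * t) ^ n" by (intro power_mono) auto
  also have "\<dots> \<le> 2 ^ n * (1 + t ^ n)" by (simp add: power_mult_distrib)
  finally show ?thesis .
qed

lemma inverse_power_le_weight: "inverse ((1 + (norm x)\<^sup>2) ^ CARD('n)) \<le> weight (x :: real^'n::finite)"
proof -
  have "inverse (1 + (norm x)\<^sup>2) \<le> inverse (1 + (x $ i)\<^sup>2)" for i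
    using component_le_norm_cart[of x i] one_plus_square_pos[of "x $ i"]
    by (intro le_imp_inverse_le) (auto simp: abs_le_square_iff[symmetric])
  then have "(\<Prod>i\<in>(UNIV::'n set). inverse (1 + (norm x)\<^sup>2)) \<le> weight x"
    unfolding weight_def by (intro prod_mono) auto
  then show ?thesis by (simp add: power_inverse)
qed

text \<open>With n = \<open>CARD('n)\<close>, the seminorms for the powers 0 and 2n suffice:
  together they bound (1 + |x|^2)^n |g x|, and the inverse of that power lies below the
  weight.\<close>

lemma schwartz_decaying:
  fixes g :: "real ^ 'n::finite \<Rightarrow> 'c::cstar_algebra"
  assumes g: "g \<in> schwartz"
  shows "decaying g"
proof -
  let ?n = "CARD('n)"
  obtain M where M: "\<And>x. norm (norm x ^ 0 *\<^sub>R g x) \<le> M"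
    using schwartz_bounded[OF g, of 0] unfolding bounded_iff by blast
  obtain N where N: "\<And>x. norm (norm x ^ (2 * ?n) *\<^sub>R g x) \<le> N"
    using schwartz_bounded[OF g, of "2 * ?n"] unfolding bounded_iff by blast
  show ?thesis
  proof (rule decayingI[OF schwartz_continuous[OF g], where C = "2 ^ ?n * (M + N)"])
    fix x :: "real^'n"
    have e: "norm x ^ (2 * ?n) = ((norm x)\<^sup>2) ^ ?n" by (rule power_mult)
    let ?p = "(1 + (norm x)\<^sup>2) ^ ?n"
    have p: "?p > 0" using one_plus_square_pos[of "norm x"] by simp
    have "?p * norm (g x) \<le> (2 ^ ?n * (1 + ((norm x)\<^sup>2) ^ ?n)) * norm (g x)"
      by (intro mult_right_mono one_plus_power_le) auto
    also have "\<dots> = 2 ^ ?n * (norm (norm x ^ 0 *\<^sub>R g x) + norm (norm x ^ (2 * ?n) *\<^sub>R g x))"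
      unfolding e by (simp add: algebra_simps)
    also have "\<dots> \<le> 2 ^ ?n * (M + N)" by (intro mult_left_mono add_mono M N) auto
    finally have b: "?p * norm (g x) \<le> 2 ^ ?n * (M + N)" .
    have nn: "0 \<le> 2 ^ ?n * (M + N)"
      by (rule order_trans[OF _ b]) (use p in auto)
    have "b = (q * b) * inverse q" if "0 < q" for b q :: real using that by simp
    from this[OF p] have "norm (g x) = (?p * norm (g x)) * inverse ?p" .
    also have "\<dots> \<le> (2 ^ ?n * (M + N)) * inverse ?p" using b p by (intro mult_right_mono) auto
    also have "\<dots> \<le> (2 ^ ?n * (M + N)) * weight x"
      by (intro mult_left_mono nn inverse_power_le_weight)
    finally show "norm (g x) \<le> 2 ^ ?n * (M + N) * weight x" .
  qed
qed

text \<open>Unlike in \<open>weight_affine_le\<close>, the constant does not depend on the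
  translation, so that all difference quotients with steps at most 1 share one bound.\<close>

lemma weight_translate_le:
  fixes x c :: "real ^ 'n::finite"
  assumes c: "\<And>i. \<bar>c $ i\<bar> \<le> 1"
  shows "weight (x + c) \<le> 3 ^ CARD('n) * weight x"
proof -
  have "inverse (1 + ((x + c) $ i)\<^sup>2) \<le> 3 * inverse (1 + (x $ i)\<^sup>2)" for i
  proof -
    define y where "y = x $ i + c $ i"
    have "(c $ i)\<^sup>2 \<le> 1" using c[of i] by (simp add: abs_square_le_1)
    moreover have "(x $ i)\<^sup>2 \<le> 2 * y\<^sup>2 + 2 * (c $ i)\<^sup>2"
      using zero_le_power2[of "y + c $ i"] by (simp add: y_def power2_eq_square algebra_simps)
    moreover have "1 + a \<le> 3 * (1 + b)" if "d \<le> 1" "a \<le> 2 * b + 2 * d" "0 \<le> b" for a b d :: real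
      using that by simp
    ultimately have "1 + (x $ i)\<^sup>2 \<le> 3 * (1 + y\<^sup>2)" using zero_le_power2[of y] by blast
    moreover have "(x + c) $ i = y" by (simp add: y_def)
    ultimately show ?thesis
      using one_plus_square_pos[of "x $ i"] one_plus_square_pos[of y] by (simp add: field_simps)
  qed
  then have "weight (x + c) \<le> (\<Prod>i\<in>(UNIV::'n set). 3 * inverse (1 + (x $ i)\<^sup>2))"
    unfolding weight_def using one_plus_square_pos by (intro prod_mono) (auto simp: less_imp_le)
  then show ?thesis by (simp add: weight_def prod.distrib)
qed

text \<open>The mean value inequality on the segment from v to v + t e_i. It supplies the dominating
  function for passing to the derivative under the Fourier integral.\<close>

lemma schwartz_diff_quotient_le:
  fixes g :: "real ^ 'n::finite \<Rightarrow> 'c::cstar_algebra"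
  assumes g: "has_pd i g g'" and C: "0 \<le> C" "\<And>x. norm (g' x) \<le> C * weight x"
    and t: "0 < t" "t \<le> 1"
  shows "norm ((g (v + t *\<^sub>R axis i 1) - g v) /\<^sub>R t) \<le> (C * 3 ^ CARD('n)) * weight v"
proof -
  let ?\<phi> = "\<lambda>s. g (v + s *\<^sub>R axis i 1)" and ?B = "(C * 3 ^ CARD('n)) * weight v"
  have B: "norm (g' (v + s *\<^sub>R axis i 1)) \<le> ?B" if "s \<in> {0..t}" for s
  proof -
    have "\<bar>(s *\<^sub>R axis i 1 :: real^'n) $ j\<bar> \<le> 1" for j using that t by (simp add: axis_def)
    then have "weight (v + s *\<^sub>R axis i 1) \<le> 3 ^ CARD('n) * weight v" by (rule weight_translate_le)
    then have "C * weight (v + s *\<^sub>R axis i 1) \<le> C * (3 ^ CARD('n) * weight v)"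
      using C(1) by (rule mult_left_mono)
    then show ?thesis using C(2)[of "v + s *\<^sub>R axis i 1"] by (simp add: mult.assoc)
  qed
  have "norm (?\<phi> t - ?\<phi> 0) \<le> ?B * norm (t - 0)"
  proof (rule differentiable_bound[of "{0..t}" ?\<phi> "\<lambda>s h. h *\<^sub>R g' (v + s *\<^sub>R axis i 1)"])
    fix s assume s: "s \<in> {0..t}"
    show "(?\<phi> has_derivative (\<lambda>h. h *\<^sub>R g' (v + s *\<^sub>R axis i 1))) (at s within {0..t})"
      using has_pd_shift[OF g, of v s]
      by (auto simp: has_vector_derivative_def intro: has_derivative_at_withinI)
    show "onorm (\<lambda>h. h *\<^sub>R g' (v + s *\<^sub>R axis i 1)) \<le> ?B"
    proof (rule onorm_bound)
      show "0 \<le> ?B" using C(1) by (simp add: weight_nonneg)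
      show "norm (h *\<^sub>R g' (v + s *\<^sub>R axis i 1)) \<le> ?B * norm h" for h
        using mult_left_mono[OF B[OF s], of "\<bar>h\<bar>"] by (simp add: mult_ac)
    qed
  qed (use t in auto)
  then have "norm (g (v + t *\<^sub>R axis i 1) - g v) \<le> ?B * t" using t by simp
  then have "norm (g (v + t *\<^sub>R axis i 1) - g v) / t \<le> ?B" using t by (simp add: pos_divide_le_eq)
  then show ?thesis using t by (simp add: divide_inverse mult.commute)
qed

section \<open>Fourier transforms of translates and derivatives\<close>

lemma decaying_wave: "decaying h \<Longrightarrow> decaying (\<lambda>v. wave u v *\<^sub>C h v)"
  by (rule decaying_bilinear[OF bounded_bilinear_scaleC])
    (auto intro!: continuous_on_wave continuous_intros boundedI[of _ 1])

lemma fourier_translate: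
  fixes h :: "real ^ 'n::finite \<Rightarrow> 'c::cstar_algebra"
  assumes "decaying h"
  shows "fourier (\<lambda>v. h (v + c)) u = wave u (- c) *\<^sub>C fourier h u"
proof -
  have "wave u v = wave u (- c) * wave u (v + c)" for v
    by (simp add: wave_def exp_add[symmetric] inner_add_right algebra_simps)
  then have "fourier (\<lambda>v. h (v + c)) u
      = integral UNIV (\<lambda>v. wave u (- c) *\<^sub>C (wave u (v + c) *\<^sub>C h (v + c)))"
    unfolding fourier_def by (metis scaleC_scaleC)
  also have "\<dots> = integral UNIV (\<lambda>v. wave u (- c) *\<^sub>C (wave u v *\<^sub>C h v))"
    by (rule integral_translation)
      (intro decaying_integrable decaying_linear[OF bounded_linear_scaleC_right] decaying_wave assms)
  also have "\<dots> = wave u (- c) *\<^sub>C fourier h u"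
    unfolding fourier_def
    by (intro integral_linear'[OF bounded_linear_scaleC_right] decaying_integrable decaying_wave assms)
  finally show ?thesis .
qed

text \<open>Translation invariance takes the place of integration by parts: the transform of a
  difference quotient of g is that of g times a difference quotient of the exponential, and both
  sides converge.\<close>

lemma fourier_partial_deriv:
  fixes g :: "real ^ 'n::finite \<Rightarrow> 'c::cstar_algebra"
  assumes g: "decaying g" and g': "decaying g'" and pd: "has_pd i g g'"
  shows "fourier g' u = (- (2 * complex_of_real pi * \<i> * complex_of_real (u $ i))) *\<^sub>C fourier g u"
proof -
  obtain C where C: "0 \<le> C" "\<And>x. norm (g' x) \<le> C * weight x" using decayingD[OF g'] by metis
  \<comment> \<open>Dominated convergence is used along a sequence of steps, which are at most 1 to
    keep the bound on the quotients uniform.\<close>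
  define e where "e k = inverse (real (Suc k))" for k
  have e: "0 < e k" "e k \<le> 1" for k by (auto simp: e_def inverse_le_1_iff)
  have e0: "e \<longlonglongrightarrow> 0" unfolding e_def by (rule LIMSEQ_inverse_real_of_nat)
  let ?a = "axis i 1 :: real^'n" and ?z = "- (2 * complex_of_real pi * \<i> * complex_of_real (u $ i))"
  let ?q = "\<lambda>k v. (g (v + e k *\<^sub>R ?a) - g v) /\<^sub>R e k"
  have q: "fourier (?q k) u = ((wave u (- (e k *\<^sub>R ?a)) - 1) /\<^sub>R e k) *\<^sub>C fourier g u" for k
  proof -
    have gt: "decaying (\<lambda>v. g (v + e k *\<^sub>R ?a))"
      using decaying_affine[OF _ g, of 1 "e k *\<^sub>R ?a"] by simp
    have "fourier (?q k) u = integral UNIV (\<lambda>v. (wave u v *\<^sub>C g (v + e k *\<^sub>R ?a) - wave u v *\<^sub>C g v) /\<^sub>R e k)"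
      unfolding fourier_def by (simp add: scaleC_scaleR_right scaleC_diff_right)
    also have "\<dots> = integral UNIV (\<lambda>v. wave u v *\<^sub>C g (v + e k *\<^sub>R ?a) - wave u v *\<^sub>C g v) /\<^sub>R e k"
      by (intro integral_linear'[OF bounded_linear_scaleR_right] decaying_integrable decaying_diff
          decaying_wave g gt)
    also have "integral UNIV (\<lambda>v. wave u v *\<^sub>C g (v + e k *\<^sub>R ?a) - wave u v *\<^sub>C g v)
        = fourier (\<lambda>v. g (v + e k *\<^sub>R ?a)) u - fourier g u"
      unfolding fourier_def by (intro integral_diff decaying_integrable decaying_wave g gt)
    also have "\<dots> = (wave u (- (e k *\<^sub>R ?a)) - 1) *\<^sub>C fourier g u"
      unfolding fourier_translate[OF g] by (simp add: scaleC_diff_left)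
    finally show ?thesis by (simp add: scaleC_scaleR_left)
  qed
  have "(\<lambda>k. fourier (?q k) u) \<longlonglongrightarrow> fourier g' u"
    unfolding fourier_def
  proof (rule decaying_dominated_convergence[where C = "C * 3 ^ CARD('n)"])
    show "continuous_on UNIV (\<lambda>v. wave u v *\<^sub>C ?q k v)" for k
      by (intro bounded_bilinear.continuous_on[OF bounded_bilinear_scaleC] continuous_on_wave
          continuous_intros continuous_on_compose2[OF decaying_continuous[OF g, of UNIV]]) auto
    show "continuous_on UNIV (\<lambda>v. wave u v *\<^sub>C g' v)"
      by (intro decaying_continuous decaying_wave g')
    fix v :: "real^'n" and k
    show "norm (wave u v *\<^sub>C ?q k v) \<le> (C * 3 ^ CARD('n)) * weight v"
      using schwartz_diff_quotient_le[OF pd C e(1)[of k] e(2)[of k]] by (simp only: norm_scaleC norm_wave mult_1)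
    have "((\<lambda>t. g (v + t *\<^sub>R ?a)) has_vector_derivative g' v) (at 0)" using pd by (simp add: has_pd_def)
    then have "((\<lambda>t. norm (g (v + t *\<^sub>R ?a) - g v - t *\<^sub>R g' v) / norm t) \<longlongrightarrow> 0) (at 0)"
      by (simp add: has_vector_derivative_def has_derivative_at)
    moreover have "filterlim e (at 0) sequentially"
      using e0 e by (auto simp: filterlim_at less_imp_neq[symmetric])
    ultimately have l: "(\<lambda>k. norm (g (v + e k *\<^sub>R ?a) - g v - e k *\<^sub>R g' v) / norm (e k)) \<longlonglongrightarrow> 0"
      by (rule filterlim_compose)
    have "norm (?q k v - g' v) = norm (g (v + e k *\<^sub>R ?a) - g v - e k *\<^sub>R g' v) / norm (e k)" for k
    proof -
      have "?q k v - g' v = (g (v + e k *\<^sub>R ?a) - g v - e k *\<^sub>R g' v) /\<^sub>R e k"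
        using e(1)[of k] by (simp add: scaleR_diff_right)
      then show ?thesis by (simp add: divide_inverse mult.commute)
    qed
    with l have "(\<lambda>k. norm (?q k v - g' v)) \<longlonglongrightarrow> 0" by (simp only:)
    then have "(\<lambda>k. ?q k v) \<longlonglongrightarrow> g' v"
      by (simp only: tendsto_norm_zero_iff LIM_zero_iff)
    then show "(\<lambda>k. wave u v *\<^sub>C ?q k v) \<longlonglongrightarrow> wave u v *\<^sub>C g' v"
      by (rule bounded_linear.tendsto[OF bounded_linear_scaleC_right])
  qed
  moreover have "(\<lambda>k. (wave u (- (e k *\<^sub>R ?a)) - 1) /\<^sub>R e k) \<longlonglongrightarrow> ?z"
  proof -
    have w: "wave u (- (t *\<^sub>R ?a)) = exp (?z * complex_of_real t)" for t
      by (simp add: wave_def inner_axis mult_ac)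
    have "((\<lambda>z. exp (?z * z)) has_field_derivative ?z) (at 0)"
      by (auto intro!: derivative_eq_intros)
    then have "((\<lambda>z. (exp (?z * z) - 1) / z) \<longlongrightarrow> ?z) (at 0)"
      by (simp add: has_field_derivative_iff)
    moreover have "(\<lambda>k. complex_of_real (e k)) \<longlonglongrightarrow> 0"
      using tendsto_of_real[OF e0, where 'a = complex] by simp
    then have "filterlim (\<lambda>k. complex_of_real (e k)) (at 0) sequentially"
      using e by (auto simp: filterlim_at less_imp_neq[symmetric])
    ultimately have l: "(\<lambda>k. (exp (?z * complex_of_real (e k)) - 1) / complex_of_real (e k)) \<longlonglongrightarrow> ?z"
      by (rule filterlim_compose)
    have "a / complex_of_real r = a /\<^sub>R r" for a r
      by (simp only: scaleR_conv_of_real of_real_inverse divide_inverse mult.commute)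
    with l show ?thesis by (simp only: w)
  qed
  then have "(\<lambda>k. fourier (?q k) u) \<longlonglongrightarrow> ?z *\<^sub>C fourier g u"
    unfolding q by (rule bounded_linear.tendsto[OF bounded_linear_scaleC_left])
  ultimately show ?thesis by (rule LIMSEQ_unique)
qed

text \<open>Each partial derivative of g pays for one factor 2 pi |u_i|; without such factors the
  transform is bounded because g is decaying.\<close>

lemma fourier_coord_power_bounded:
  fixes g :: "real ^ 'n::finite \<Rightarrow> 'c::cstar_algebra"
  assumes "g \<in> schwartz"
  shows "\<exists>C. \<forall>u. \<bar>u $ i\<bar> ^ k * norm (fourier g u) \<le> C"
  using assms
proof (induction k arbitrary: g)
  case 0
  obtain C where C: "0 \<le> C" "\<And>x. norm (g x) \<le> C * weight x"
    using decayingD[OF schwartz_decaying[OF 0]] by metis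
  have "norm (fourier g u) \<le> C * integral UNIV (weight :: real^'n \<Rightarrow> real)" for u
    unfolding fourier_def
    by (intro decaying_integral_bound decaying_wave schwartz_decaying 0) (simp add: norm_scaleC C)
  then show ?case by auto
next
  case (Suc k)
  obtain g' where g': "g' \<in> schwartz" "has_pd i g g'" using schwartz_pd[OF Suc.prems] by blast
  obtain C where C: "\<And>u. \<bar>u $ i\<bar> ^ k * norm (fourier g' u) \<le> C" using Suc.IH[OF g'(1)] by blast
  have "\<bar>u $ i\<bar> ^ Suc k * norm (fourier g u) \<le> C / (2 * pi)" for u
  proof -
    have "norm (fourier g' u) = 2 * pi * \<bar>u $ i\<bar> * norm (fourier g u)"
      unfolding fourier_partial_deriv[OF schwartz_decaying[OF Suc.prems] schwartz_decaying[OF g'(1)] g'(2)]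
      by (simp add: norm_scaleC norm_mult)
    then show ?thesis using C[of u] by (simp add: field_simps)
  qed
  then show ?case by blast
qed

lemma weight_neq_0: "weight x \<noteq> 0"
  using weight_pos[of x] by simp

lemma continuous_on_fourier:
  fixes h :: "real ^ 'n::finite \<Rightarrow> 'c::cstar_algebra"
  assumes h: "decaying h"
  shows "continuous_on UNIV (fourier h)"
proof -
  obtain C where C: "0 \<le> C" "\<And>x. norm (h x) \<le> C * weight x" using decayingD[OF h] by metis
  \<comment> \<open>The factor \<open>weight u\<close> is only there to make the kernel decay in \<open>u\<close> too.\<close>
  define F where "F u v = weight u *\<^sub>R (wave u v *\<^sub>C h v)" for u v
  interpret decaying_kernel F C
  proof
    have "continuous_on UNIV (\<lambda>p. F (fst p) (snd p))"
      unfolding F_def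
      by (intro bounded_bilinear.continuous_on[OF bounded_bilinear_scaleC] continuous_intros
          continuous_on_wave continuous_on_compose2[OF continuous_on_weight[of UNIV]]
          continuous_on_compose2[OF decaying_continuous[OF h, of UNIV]]) auto
    then show "continuous_on UNIV (\<lambda>(u, v). F u v)" by (simp add: case_prod_unfold)
    fix u v :: "real^'n"
    show "norm (F u v) \<le> C * weight u * weight v"
      using mult_left_mono[OF C(2)[of v] weight_nonneg[of u]]
      by (simp add: F_def norm_scaleC weight_nonneg mult_ac)
  qed
  have "integral UNIV (F u) = weight u *\<^sub>R fourier h u" for u
    unfolding F_def fourier_def
    by (intro integral_linear'[OF bounded_linear_scaleR_right] decaying_integrable decaying_wave h)
  then have cw: "continuous_on UNIV (\<lambda>u. weight u *\<^sub>R fourier h u)"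
    using decaying_continuous[OF decaying_integral] by simp
  have "continuous_on UNIV (\<lambda>u::real^'n. inverse (weight u))"
    by (intro continuous_on_inverse continuous_on_weight) (simp add: weight_neq_0)
  from continuous_on_scaleR[OF this cw]
  have c: "continuous_on UNIV (\<lambda>u. inverse (weight u) *\<^sub>R (weight u *\<^sub>R fourier h u))" .
  have "inverse (weight u) *\<^sub>R (weight u *\<^sub>R fourier h u) = fourier h u" for u
    by (simp add: weight_neq_0)
  with c show ?thesis by (simp only:)
qed

text \<open>Decay in each single coordinate is enough: with n = \<open>CARD('n)\<close>, the n
  bounds by K (1 + u_i^2)^(-n) are multiplied, and the n-th root of the product is K times the
  weight.\<close>

lemma decaying_fourier:
  fixes g :: "real ^ 'n::finite \<Rightarrow> 'c::cstar_algebra"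
  assumes g: "g \<in> schwartz"
  shows "decaying (fourier g)"
proof -
  let ?n = "CARD('n)"
  have "\<exists>D. \<forall>u. (1 + (u $ i)\<^sup>2) ^ ?n * norm (fourier g u) \<le> D" for i
  proof -
    obtain M where M: "\<And>u. \<bar>u $ i\<bar> ^ 0 * norm (fourier g u) \<le> M"
      using fourier_coord_power_bounded[OF g] by blast
    obtain N where N: "\<And>u. \<bar>u $ i\<bar> ^ (2 * ?n) * norm (fourier g u) \<le> N"
      using fourier_coord_power_bounded[OF g] by blast
    have "(1 + (u $ i)\<^sup>2) ^ ?n * norm (fourier g u) \<le> 2 ^ ?n * (M + N)" for u
    proof -
      have e: "\<bar>u $ i\<bar> ^ (2 * ?n) = ((u $ i)\<^sup>2) ^ ?n" by (subst power_mult) simp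
      have "(1 + (u $ i)\<^sup>2) ^ ?n * norm (fourier g u) \<le> (2 ^ ?n * (1 + ((u $ i)\<^sup>2) ^ ?n)) * norm (fourier g u)"
        by (intro mult_right_mono one_plus_power_le) auto
      also have "\<dots> = 2 ^ ?n * (\<bar>u $ i\<bar> ^ 0 * norm (fourier g u) + \<bar>u $ i\<bar> ^ (2 * ?n) * norm (fourier g u))"
        unfolding e by (simp add: algebra_simps)
      also have "\<dots> \<le> 2 ^ ?n * (M + N)" by (intro mult_left_mono add_mono M N) auto
      finally show ?thesis .
    qed
    then show ?thesis by blast
  qed
  then obtain D where D: "\<And>i u. (1 + (u $ i)\<^sup>2) ^ ?n * norm (fourier g u) \<le> D i" by metis
  define K where "K = (\<Sum>i\<in>UNIV. \<bar>D i\<bar>)"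
  have K: "0 \<le> K" unfolding K_def by (intro sum_nonneg) auto
  have DK: "D i \<le> K" for i
  proof -
    have "\<bar>D i\<bar> \<le> K" unfolding K_def by (intro member_le_sum) auto
    then show ?thesis by simp
  qed
  show ?thesis
  proof (rule decayingI[OF continuous_on_fourier[OF schwartz_decaying[OF g]], where C = K])
    fix u :: "real^'n"
    have "norm (fourier g u) \<le> K * inverse (1 + (u $ i)\<^sup>2) ^ ?n" for i
    proof -
      have "(1 + (u $ i)\<^sup>2) ^ ?n * norm (fourier g u) \<le> K" using D[of u i] DK[of i] by simp
      then show ?thesis using one_plus_square_pos[of "u $ i"] by (simp add: field_simps)
    qed
    then have "(\<Prod>i\<in>(UNIV::'n set). norm (fourier g u)) \<le> (\<Prod>i\<in>UNIV. K * inverse (1 + (u $ i)\<^sup>2) ^ ?n)"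
      by (intro prod_mono) auto
    also have "\<dots> = (K * weight u) ^ ?n"
      by (simp add: prod.distrib weight_def prod_power_distrib power_mult_distrib)
    finally have "norm (fourier g u) ^ ?n \<le> (K * weight u) ^ ?n" by simp
    then show "norm (fourier g u) \<le> K * weight u"
      using K by (subst (asm) power_mono_iff) (auto simp: weight_nonneg)
  qed
qed

text \<open>For fixed x the inner integral is the transform of v |-> f x g (x + v), and the outer
  one inverts it at v = 0.\<close>

theorem L_schwartz_eq:
  fixes f g :: "real ^ 'n::finite \<Rightarrow> 'c::cstar_algebra"
  assumes g: "g \<in> schwartz"
  shows "L_schwartz f g = (\<lambda>x. f x * g x)"
proof
  fix x
  define h where "h v = f x * g (v + x)" for v
  have gt: "decaying (\<lambda>v. g (v + x))"
    using decaying_affine[OF _ schwartz_decaying[OF g], of 1 x] by simp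
  then have h: "decaying h"
    unfolding h_def by (rule decaying_linear[OF bounded_linear_mult_right])
  \<comment> \<open>The factor \<open>f x\<close> is constant in v and leaves the integral, so only
    the transform of g has to be decaying.\<close>
  have fh: "fourier h u = f x * (wave u (- x) *\<^sub>C fourier g u)" for u
  proof -
    have "fourier h u = integral UNIV (\<lambda>v. f x * (wave u v *\<^sub>C g (v + x)))"
      unfolding fourier_def h_def by (simp add: mult_scaleC_right)
    also have "\<dots> = f x * fourier (\<lambda>v. g (v + x)) u"
      unfolding fourier_def
      by (intro integral_linear'[OF bounded_linear_mult_right] decaying_integrable decaying_wave gt)
    finally show ?thesis by (simp add: fourier_translate[OF schwartz_decaying[OF g]])
  qed
  have "decaying (\<lambda>u. wave u (- x) *\<^sub>C fourier g u)"
    by (rule decaying_bilinear[OF bounded_bilinear_scaleC _ _ decaying_fourier[OF g]])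
      (auto intro!: continuous_on_wave continuous_intros boundedI[of _ 1])
  then have "decaying (fourier h)"
    unfolding fh by (rule decaying_linear[OF bounded_linear_mult_right])
  then have "integral UNIV (fourier h) = h 0" by (rule fourier_inversion_at_0[OF h])
  then show "L_schwartz f g x = f x * g x"
    by (simp add: L_schwartz_def fourier_def[abs_def] wave_def h_def add.commute)
qed

section \<open>Positivity in a C*-algebra without unit\<close>

definition uemb :: "'a::cstar_algebra \<Rightarrow> 'a unitization" where
  "uemb a = Unitization a 0"

lemma uemb_sel [simp]: "upart (uemb a) = a" "uscal (uemb a) = 0"
  by (simp_all add: uemb_def)

lemma uemb_add: "uemb (a + b) = uemb a + uemb b"
  and uemb_diff: "uemb (a - b) = uemb a - uemb b"
  and uemb_mult: "uemb (a * b) = uemb a * uemb b"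
  and uemb_star: "uemb (star a) = star (uemb a)"
  and uemb_scaleR: "uemb (r *\<^sub>R a) = r *\<^sub>R uemb a"
  by (simp_all add: unitization_eq_iff)

lemma norm_uemb [simp]: "norm (uemb a) = norm a"
proof (rule antisym)
  show "norm (uemb a) \<le> norm a" using norm_unitization_le[of "uemb a"] by simp
  have "norm a * norm a = norm (left_op (uemb a) (star a))"
    using norm_star_mult[of "star a"] by (simp add: left_op_def star_star)
  also have "\<dots> \<le> norm (uemb a) * norm a" using norm_left_op_le[of "uemb a" "star a"] by simp
  finally show "norm a \<le> norm (uemb a)" by (cases "a = 0") auto
qed

lemma bounded_linear_uemb: "bounded_linear uemb"
  by (rule bounded_linear_intro[of _ 1]) (auto simp: uemb_add uemb_scaleR)

definition cpos :: "'a::cstar_algebra \<Rightarrow> bool" where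
  "cpos h \<longleftrightarrow> pos (uemb h)"

lemma cpos_add: "cpos a \<Longrightarrow> cpos b \<Longrightarrow> cpos (a + b)"
  by (simp add: cpos_def uemb_add pos_add)

lemma cpos_scaleR: "cpos a \<Longrightarrow> 0 \<le> r \<Longrightarrow> cpos (r *\<^sub>R a)"
  by (simp add: cpos_def uemb_scaleR pos_scaleR)

lemma cpos_star_mult: "cpos (star a * a)"
  by (simp add: cpos_def uemb_mult uemb_star pos_star_mult)

lemma norm_mono_cpos: "cpos p \<Longrightarrow> cpos (q - p) \<Longrightarrow> norm p \<le> norm q"
  using norm_mono_pos[of "uemb p" "uemb q"] by (simp add: cpos_def uemb_diff)

text \<open>The element t - p lives in the unitization only; conjugation by an element of C brings
  it back into C.\<close>

lemma cpos_conj_le: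
  assumes "star p = p" "norm p \<le> t"
  shows "cpos (t *\<^sub>R (star a * a) - star a * p * a)"
proof -
  have "pos (of_real t - uemb p)"
    using assms by (intro pos_norm_minus) (simp_all add: uemb_star[symmetric])
  then have "pos (star (uemb a) * (of_real t - uemb p) * uemb a)" by (rule pos_conj)
  also have "star (uemb a) * (of_real t - uemb p) * uemb a = uemb (t *\<^sub>R (star a * a) - star a * p * a)"
    by (simp add: uemb_diff uemb_scaleR uemb_mult uemb_star of_real_def algebra_simps)
  finally show ?thesis by (simp add: cpos_def)
qed

text \<open>For positive h, the number t in \<open>pos\<close> may be any bound of |h|, so t = C
  weight x is an integrable choice. Integrating |t - h| <= t gives the same inequality for the
  integrals.\<close>

lemma cpos_integral:
  fixes h :: "real ^ 'n::finite \<Rightarrow> 'c::cstar_algebra"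
  assumes h: "decaying h" and pos: "\<And>x. cpos (h x)"
  shows "cpos (integral UNIV h)"
proof -
  obtain C where C: "0 \<le> C" "\<And>x. norm (h x) \<le> C * weight x" using decayingD[OF h] by metis
  let ?t = "\<lambda>x::real^'n. C * weight x"
  have ti: "?t integrable_on UNIV" by (intro integrable_on_mult_right integrable_weight)
  have hi: "(\<lambda>x. uemb (h x)) integrable_on UNIV"
    by (intro decaying_integrable decaying_linear[OF bounded_linear_uemb] h)
  have oi: "(\<lambda>x. of_real (?t x) :: 'c unitization) integrable_on UNIV"
    using integrable_linear[OF ti bounded_linear_of_real] by (simp add: o_def)
  have le: "norm (of_real (?t x) - uemb (h x)) \<le> ?t x" for x
  proof (rule norm_le_of_pos)
    have p: "pos (uemb (h x))" using pos[of x] by (simp add: cpos_def)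
    then have s: "star (uemb (h x)) = uemb (h x)" by (rule pos_selfadjoint)
    have t: "0 \<le> ?t x" using C(1) by (simp add: weight_nonneg)
    show "pos (of_real (?t x) - (of_real (?t x) - uemb (h x)))" using p by simp
    show "pos (of_real (?t x) + (of_real (?t x) - uemb (h x)))"
      using C(2)[of x] by (intro pos_add pos_of_real t pos_norm_minus s) simp
    show "star (of_real (?t x) - uemb (h x)) = of_real (?t x) - uemb (h x)"
      by (simp only: star_diff star_of_real s)
  qed (use C(1) in \<open>simp add: weight_nonneg\<close>)
  have u: "uemb (integral UNIV h) = integral UNIV (\<lambda>x. uemb (h x))"
    by (rule integral_linear'[OF bounded_linear_uemb decaying_integrable[OF h], symmetric])
  have sh: "star (h x) = h x" for x
  proof -
    have "uemb (star (h x)) = uemb (h x)"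
      using pos[of x] by (simp add: cpos_def pos_selfadjoint uemb_star)
    then show ?thesis by (simp add: unitization_eq_iff)
  qed
  have "star (integral UNIV h) = integral UNIV h"
    using integral_linear'[OF bounded_linear_star decaying_integrable[OF h]] unfolding sh by (rule sym)
  then have sa: "star (uemb (integral UNIV h)) = uemb (integral UNIV h)"
    by (simp add: uemb_star[symmetric])
  have "of_real (integral UNIV ?t) = integral UNIV (\<lambda>x. of_real (?t x) :: 'c unitization)"
    by (rule integral_linear'[OF bounded_linear_of_real ti, symmetric])
  then have "norm (of_real (integral UNIV ?t) - uemb (integral UNIV h))
      = norm (integral UNIV (\<lambda>x. of_real (?t x) - uemb (h x)))"
    unfolding u by (simp only: integral_diff[OF oi hi])
  also have "\<dots> \<le> integral UNIV ?t"
    by (rule Henstock_Kurzweil_Integration.integral_norm_bound_integral[OF integrable_diff[OF oi hi] ti le])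
  finally show ?thesis unfolding cpos_def by (rule posI[OF sa])
qed

section \<open>The inner product\<close>

lemma decaying_star_mult:
  fixes f g :: "real ^ 'n::finite \<Rightarrow> 'c::cstar_algebra"
  assumes "decaying f" "decaying g"
  shows "decaying (\<lambda>x. star (f x) * g x)"
  using assms
  by (intro decaying_bilinear[OF bounded_bilinear_mult] continuous_on_star decaying_continuous
      bounded_range_linear[OF bounded_linear_star] decaying_bounded)

lemma schwartz_inner_add_right:
  fixes f g h :: "real ^ 'n::finite \<Rightarrow> 'c::cstar_algebra"
  assumes "decaying f" "decaying g" "decaying h"
  shows "schwartz_inner f (\<lambda>x. g x + h x) = schwartz_inner f g + schwartz_inner f h"
  unfolding schwartz_inner_def distrib_left
  by (intro integral_add decaying_integrable decaying_star_mult assms)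

text \<open>This is right C-linearity of the inner product; its use is with T b = - l b a.\<close>

lemma schwartz_inner_linear_right:
  fixes f g :: "real ^ 'n::finite \<Rightarrow> 'c::cstar_algebra"
  assumes T: "bounded_linear T" "\<And>a b. T (a * b) = a * T b" and f: "decaying f" "decaying g"
  shows "schwartz_inner f (\<lambda>x. T (g x)) = T (schwartz_inner f g)"
  unfolding schwartz_inner_def T(2)[symmetric]
  by (intro integral_linear' T decaying_integrable decaying_star_mult f)

lemma star_schwartz_inner:
  fixes f g :: "real ^ 'n::finite \<Rightarrow> 'c::cstar_algebra"
  assumes "decaying f" "decaying g"
  shows "star (schwartz_inner f g) = schwartz_inner g f"
  unfolding schwartz_inner_def
  by (subst integral_linear'[OF bounded_linear_star, symmetric])
    (auto intro: decaying_integrable decaying_star_mult assms simp: star_mult star_star)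

lemma cpos_schwartz_inner:
  fixes f :: "real ^ 'n::finite \<Rightarrow> 'c::cstar_algebra"
  shows "decaying f \<Longrightarrow> cpos (schwartz_inner f f)"
  unfolding schwartz_inner_def by (intro cpos_integral decaying_star_mult cpos_star_mult)

lemma norm2_nonneg: "0 \<le> norm2 f"
  by (simp add: norm2_def)

lemma norm2_square: "(norm2 f)\<^sup>2 = norm (schwartz_inner f f)"
  by (simp add: norm2_def)

lemma schwartz_inner_add_add:
  fixes f g :: "real ^ 'n::finite \<Rightarrow> 'c::cstar_algebra"
  assumes f: "decaying f" and g: "decaying g"
  shows "schwartz_inner (\<lambda>x. f x + g x) (\<lambda>x. f x + g x)
    = schwartz_inner f f + schwartz_inner f g + (schwartz_inner g f + schwartz_inner g g)"
proof -
  have fg: "decaying (\<lambda>x. f x + g x)" by (rule decaying_add[OF f g])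
  have "schwartz_inner (\<lambda>x. f x + g x) h = schwartz_inner f h + schwartz_inner g h" if "decaying h" for h
    using star_schwartz_inner[OF that fg] schwartz_inner_add_right[OF that f g]
    by (simp add: star_add star_schwartz_inner that f g)
  then show ?thesis
    by (simp add: schwartz_inner_add_right f g fg algebra_simps)
qed

text \<open>The inner square of g - l f a with a = <f, g> is positive. Its quadratic term is bounded
  in the order through \<open>cpos_conj_le\<close>, which leaves l times \<open>star a * a\<close>
  below <g, g>; monotonicity of the norm concludes.\<close>

theorem schwartz_inner_Cauchy_Schwarz:
  fixes f g :: "real ^ 'n::finite \<Rightarrow> 'c::cstar_algebra"
  assumes f: "decaying f" and g: "decaying g"
  shows "norm (schwartz_inner f g) \<le> norm2 f * norm2 g"
proof -
  define a where "a = schwartz_inner f g"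
  define F where "F = norm (schwartz_inner f f)"
  define G where "G = norm (schwartz_inner g g)"
  have sa: "star a = schwartz_inner g f" unfolding a_def by (rule star_schwartz_inner[OF f g])
  have bound: "(norm a)\<^sup>2 \<le> (F + e) * G" if e: "e > 0" for e
  proof -
    \<comment> \<open>As in the scalar case, the optimal coefficient would be 1/F; adding e covers F
      = 0.\<close>
    define l where "l = 1 / (F + e)"
    have Fe: "F + e > 0" using e by (simp add: F_def add_nonneg_pos)
    have l: "l > 0" "l * (F + e) = 1" using Fe by (auto simp: l_def)
    define T where "T b = (- l) *\<^sub>R (b * a)" for b
    have T: "bounded_linear T" "\<And>b c. T (b * c) = b * T c"
      unfolding T_def
      by (rule bounded_linear_compose[OF bounded_linear_scaleR_right bounded_linear_mult_left])
        (simp add: mult.assoc)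
    have fT: "decaying (\<lambda>x. T (f x))" by (rule decaying_linear[OF T(1) f])
    have i1: "schwartz_inner g (\<lambda>x. T (f x)) = (- l) *\<^sub>R (star a * a)"
      by (rule trans[OF schwartz_inner_linear_right[OF T g f]]) (simp only: T_def sa)
    have i2: "schwartz_inner (\<lambda>x. T (f x)) g = (- l) *\<^sub>R (star a * a)"
      using star_schwartz_inner[OF g fT] unfolding i1 by (simp add: star_mult star_star star_scaleR star_minus)
    have i3: "schwartz_inner (\<lambda>x. T (f x)) (\<lambda>x. T (f x)) = (l * l) *\<^sub>R (star a * schwartz_inner f f * a)"
    proof -
      have "schwartz_inner f (\<lambda>x. T (f x)) = T (schwartz_inner f f)"
        by (rule schwartz_inner_linear_right[OF T f f])
      then have "schwartz_inner (\<lambda>x. T (f x)) f = star (T (schwartz_inner f f))"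
        using star_schwartz_inner[OF f fT] by simp
      also have "\<dots> = (- l) *\<^sub>R (star a * schwartz_inner f f)"
        by (simp add: T_def star_scaleR star_minus star_mult star_schwartz_inner[OF f f])
      finally have e: "schwartz_inner (\<lambda>x. T (f x)) f = (- l) *\<^sub>R (star a * schwartz_inner f f)" .
      show ?thesis
        by (rule trans[OF schwartz_inner_linear_right[OF T fT f]], unfold e) (simp add: T_def)
    qed
    have "cpos (schwartz_inner (\<lambda>x. g x + T (f x)) (\<lambda>x. g x + T (f x)))"
      by (intro cpos_schwartz_inner decaying_add g fT)
    then have p1: "cpos (schwartz_inner g g + (- l) *\<^sub>R (star a * a)
        + ((- l) *\<^sub>R (star a * a) + (l * l) *\<^sub>R (star a * schwartz_inner f f * a)))"
      unfolding schwartz_inner_add_add[OF g fT] i1 i2 i3 .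
    have p2: "cpos ((l * l) *\<^sub>R ((F + e) *\<^sub>R (star a * a) - star a * schwartz_inner f f * a))"
      using e by (intro cpos_scaleR cpos_conj_le star_schwartz_inner f) (auto simp: F_def)
    have "(l * l * (F + e)) *\<^sub>R (star a * a) = l *\<^sub>R (star a * a)"
      using l(2) by (simp add: mult.assoc)
    then have "cpos (schwartz_inner g g - l *\<^sub>R (star a * a))"
      using cpos_add[OF p1 p2] by (simp add: scaleR_diff_right algebra_simps)
    then have "norm (l *\<^sub>R (star a * a)) \<le> G"
      unfolding G_def using l(1) by (intro norm_mono_cpos cpos_scaleR cpos_star_mult) auto
    then have "(F + e) * (l * (norm a)\<^sup>2) \<le> (F + e) * G"
      using l(1) Fe by (intro mult_left_mono) (auto simp: cstar_identity)
    then show ?thesis using l(2) by (simp add: mult.assoc[symmetric] mult.commute[of _ l])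
  qed
  have "(norm a)\<^sup>2 \<le> F * G"
  proof (rule field_le_epsilon)
    fix e :: real assume e: "e > 0"
    \<comment> \<open>The denominator is \<open>G + 1\<close> because \<open>G\<close> may
      vanish.\<close>
    have "(norm a)\<^sup>2 \<le> (F + e / (G + 1)) * G" using e by (intro bound) (simp add: G_def add_nonneg_pos)
    also have "\<dots> \<le> F * G + e"
    proof -
      have G: "0 \<le> G" by (simp add: G_def)
      then have "e / (G + 1) * G \<le> e" using e by (simp add: field_simps)
      then show ?thesis by (simp add: algebra_simps)
    qed
    finally show "(norm a)\<^sup>2 \<le> F * G + e" .
  qed
  also have "\<dots> = (norm2 f * norm2 g)\<^sup>2" by (simp add: power_mult_distrib norm2_square F_def G_def)
  finally show ?thesis
    unfolding a_def by (rule power2_le_imp_le) (simp add: norm2_nonneg)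
qed

section \<open>Seminorm properties of \<open>norm2\<close>\<close>

lemma norm2_add:
  fixes f g :: "real ^ 'n::finite \<Rightarrow> 'c::cstar_algebra"
  assumes f: "decaying f" and g: "decaying g"
  shows "norm2 (\<lambda>x. f x + g x) \<le> norm2 f + norm2 g"
proof (rule power2_le_imp_le)
  have "(norm2 (\<lambda>x. f x + g x))\<^sup>2
      \<le> norm (schwartz_inner f f) + norm (schwartz_inner f g)
        + (norm (schwartz_inner g f) + norm (schwartz_inner g g))"
    unfolding norm2_square schwartz_inner_add_add[OF f g]
    by (intro norm_triangle_mono order_refl)
  also have "\<dots> \<le> (norm2 f)\<^sup>2 + norm2 f * norm2 g + (norm2 g * norm2 f + (norm2 g)\<^sup>2)"
    unfolding norm2_square
    by (intro add_mono order_refl schwartz_inner_Cauchy_Schwarz f g)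
  finally show "(norm2 (\<lambda>x. f x + g x))\<^sup>2 \<le> (norm2 f + norm2 g)\<^sup>2"
    by (simp add: power2_eq_square algebra_simps)
qed (simp add: norm2_nonneg)

lemma norm2_zero [simp]: "norm2 (\<lambda>x. 0) = 0"
  by (simp add: norm2_def schwartz_inner_def)

lemma norm2_scaleC:
  fixes f :: "real ^ 'n::finite \<Rightarrow> 'c::cstar_algebra"
  assumes f: "decaying f"
  shows "norm2 (\<lambda>x. c *\<^sub>C f x) = cmod c * norm2 f"
proof -
  have "star (c *\<^sub>C f x) * (c *\<^sub>C f x) = (cmod c)\<^sup>2 *\<^sub>R (star (f x) * f x)" for x
  proof -
    have "star (c *\<^sub>C f x) * (c *\<^sub>C f x) = (cnj c * c) *\<^sub>C (star (f x) * f x)"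
      by (simp add: star_scaleC mult_scaleC_left mult_scaleC_right scaleC_scaleC mult.commute[of c])
    also have "cnj c * c = complex_of_real ((cmod c)\<^sup>2)"
      by (metis complex_norm_square mult.commute)
    finally show ?thesis by (simp only: scaleC_of_real)
  qed
  then have "schwartz_inner (\<lambda>x. c *\<^sub>C f x) (\<lambda>x. c *\<^sub>C f x) = (cmod c)\<^sup>2 *\<^sub>R schwartz_inner f f"
    unfolding schwartz_inner_def
    by (simp only: integral_linear'[OF bounded_linear_scaleR_right decaying_integrable[OF decaying_star_mult[OF f f]]])
  then show ?thesis by (simp add: norm2_def real_sqrt_mult)
qed

lemma norm2_scaleR:
  fixes f :: "real ^ 'n::finite \<Rightarrow> 'c::cstar_algebra"
  shows "decaying f \<Longrightarrow> norm2 (\<lambda>x. r *\<^sub>R f x) = \<bar>r\<bar> * norm2 f"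
  using norm2_scaleC[of f "complex_of_real r"] by (simp add: scaleC_of_real)

lemma norm2_minus_commute:
  fixes f g :: "real ^ 'n::finite \<Rightarrow> 'c::cstar_algebra"
  shows "norm2 (\<lambda>x. f x - g x) = norm2 (\<lambda>x. g x - f x)"
proof -
  have "star (f x - g x) * (f x - g x) = star (g x - f x) * (g x - f x)" for x
    by (simp add: star_diff algebra_simps)
  then show ?thesis unfolding norm2_def schwartz_inner_def by simp
qed

lemma norm2_mult:
  fixes f g :: "real ^ 'n::finite \<Rightarrow> 'c::cstar_algebra"
  assumes g: "decaying g" and fg: "decaying (\<lambda>x. f x * g x)" and M: "\<And>x. norm (f x) \<le> M"
  shows "norm2 (\<lambda>x. f x * g x) \<le> M * norm2 g"
proof -
  have M0: "0 \<le> M" by (rule order_trans[OF norm_ge_zero M[of 0]])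
  let ?gg = "\<lambda>x. star (g x) * g x" and ?hh = "\<lambda>x. star (f x * g x) * (f x * g x)"
  have gg: "decaying ?gg" by (rule decaying_star_mult[OF g g])
  have Mgg: "decaying (\<lambda>x. (M * M) *\<^sub>R ?gg x)" by (rule decaying_linear[OF bounded_linear_scaleR_right gg])
  have hh: "decaying ?hh" by (rule decaying_star_mult[OF fg fg])
  have "cpos ((M * M) *\<^sub>R ?gg x - ?hh x)" for x
  proof -
    have "norm (star (f x) * f x) \<le> M * M"
      unfolding norm_star_mult by (intro mult_mono M M0 norm_ge_zero)
    then have "cpos ((M * M) *\<^sub>R (star (g x) * g x) - star (g x) * (star (f x) * f x) * g x)"
      by (intro cpos_conj_le) (simp_all add: star_mult star_star)
    then show ?thesis by (simp add: star_mult mult.assoc)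
  qed
  then have "cpos (integral UNIV (\<lambda>x. (M * M) *\<^sub>R ?gg x - ?hh x))"
    by (intro cpos_integral decaying_diff Mgg hh)
  also have "integral UNIV (\<lambda>x. (M * M) *\<^sub>R ?gg x - ?hh x)
      = (M * M) *\<^sub>R schwartz_inner g g - schwartz_inner (\<lambda>x. f x * g x) (\<lambda>x. f x * g x)"
    unfolding schwartz_inner_def
    by (simp only: integral_diff[OF decaying_integrable[OF Mgg] decaying_integrable[OF hh]]
        integral_linear'[OF bounded_linear_scaleR_right decaying_integrable[OF gg]])
  finally have "norm (schwartz_inner (\<lambda>x. f x * g x) (\<lambda>x. f x * g x)) \<le> norm ((M * M) *\<^sub>R schwartz_inner g g)"
    by (intro norm_mono_cpos cpos_schwartz_inner fg)
  then have "(norm2 (\<lambda>x. f x * g x))\<^sup>2 \<le> (M * norm2 g)\<^sup>2"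
    unfolding power_mult_distrib norm2_square by (simp add: power2_eq_square)
  then show ?thesis by (rule power2_le_imp_le) (simp add: M0 norm2_nonneg)
qed

section \<open>The completion and its operators\<close>

lemma norm2_diff_triangle:
  assumes "f \<in> schwartz" "g \<in> schwartz" "h \<in> schwartz"
  shows "norm2 (\<lambda>x. f x - h x) \<le> norm2 (\<lambda>x. f x - g x) + norm2 (\<lambda>x. g x - h x)"
  using norm2_add[of "\<lambda>x. f x - g x" "\<lambda>x. g x - h x"] assms
  by (simp add: schwartz_decaying schwartz_diff)

lemma norm2_diff_le:
  assumes "f \<in> schwartz" "g \<in> schwartz"
  shows "\<bar>norm2 f - norm2 g\<bar> \<le> norm2 (\<lambda>x. f x - g x)"
  using norm2_add[of "\<lambda>x. f x - g x" g] norm2_add[of "\<lambda>x. g x - f x" f] norm2_minus_commute[of f g] assms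
  by (simp add: schwartz_decaying schwartz_diff)

lemma cauchy_seqs_schwartz: "X \<in> cauchy_seqs \<Longrightarrow> X k \<in> schwartz"
  by (simp add: cauchy_seqs_def)

lemma cauchy_seqsD:
  "X \<in> cauchy_seqs \<Longrightarrow> e > 0 \<Longrightarrow> \<exists>N. \<forall>j\<ge>N. \<forall>k\<ge>N. norm2 (\<lambda>x. X j x - X k x) < e"
  by (simp add: cauchy_seqs_def)

lemma equiv_seqsD:
  assumes "(X, Y) \<in> equiv_seqs"
  shows "X \<in> cauchy_seqs" "Y \<in> cauchy_seqs" "(\<lambda>k. norm2 (\<lambda>x. X k x - Y k x)) \<longlonglongrightarrow> 0"
  using assms by (auto simp: equiv_seqs_def)

lemma equiv_seqsI:
  "X \<in> cauchy_seqs \<Longrightarrow> Y \<in> cauchy_seqs \<Longrightarrow> (\<lambda>k. norm2 (\<lambda>x. X k x - Y k x)) \<longlonglongrightarrow> 0 \<Longrightarrow> (X, Y) \<in> equiv_seqs"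
  by (simp add: equiv_seqs_def)

lemma null_le: "(\<And>k. 0 \<le> f k) \<Longrightarrow> (\<And>k. f k \<le> g k) \<Longrightarrow> g \<longlonglongrightarrow> 0 \<Longrightarrow> f \<longlonglongrightarrow> (0::real)"
  by (rule tendsto_sandwich[of "\<lambda>k. 0" f sequentially g 0]) auto

lemma equiv_equiv_seqs: "equiv cauchy_seqs (equiv_seqs :: (('c::cstar_algebra, 'n::finite) schwartz_seq \<times> _) set)"
proof (rule equivI)
  show "equiv_seqs \<subseteq> cauchy_seqs \<times> (cauchy_seqs :: ('c, 'n) schwartz_seq set)"
    by (auto simp: equiv_seqs_def)
  show "refl_on cauchy_seqs (equiv_seqs :: (('c, 'n) schwartz_seq \<times> _) set)"
    by (auto simp: refl_on_def equiv_seqs_def)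
  show "sym (equiv_seqs :: (('c, 'n) schwartz_seq \<times> _) set)"
  proof (rule symI)
    fix X Y :: "('c, 'n) schwartz_seq" assume XY: "(X, Y) \<in> equiv_seqs"
    have "(\<lambda>k. norm2 (\<lambda>x. Y k x - X k x)) \<longlonglongrightarrow> 0"
      using equiv_seqsD(3)[OF XY] by (subst norm2_minus_commute)
    then show "(Y, X) \<in> equiv_seqs" using equiv_seqsD[OF XY] by (intro equiv_seqsI)
  qed
  show "trans (equiv_seqs :: (('c, 'n) schwartz_seq \<times> _) set)"
  proof (rule transI)
    fix X Y Z :: "('c, 'n) schwartz_seq" assume XY: "(X, Y) \<in> equiv_seqs" and YZ: "(Y, Z) \<in> equiv_seqs"
    have "(\<lambda>k. norm2 (\<lambda>x. X k x - Y k x) + norm2 (\<lambda>x. Y k x - Z k x)) \<longlonglongrightarrow> 0"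
      using tendsto_add[OF equiv_seqsD(3)[OF XY] equiv_seqsD(3)[OF YZ]] by simp
    then have "(\<lambda>k. norm2 (\<lambda>x. X k x - Z k x)) \<longlonglongrightarrow> 0"
      using equiv_seqsD[OF XY] equiv_seqsD[OF YZ]
      by (intro null_le[OF norm2_nonneg norm2_diff_triangle[where g = "Y _"]])
        (auto simp: cauchy_seqs_schwartz)
    then show "(X, Z) \<in> equiv_seqs" using equiv_seqsD[OF XY] equiv_seqsD[OF YZ] by (intro equiv_seqsI)
  qed
qed

section \<open>Classes of Cauchy sequences\<close>

abbreviation cls :: "('c::cstar_algebra, 'n::finite) schwartz_seq \<Rightarrow> ('c, 'n) schwartz_seq set" where
  "cls X \<equiv> equiv_seqs `` {X}"

lemma cls_in_E: "X \<in> cauchy_seqs \<Longrightarrow> cls X \<in> E"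
  unfolding E_def by (rule quotientI)

lemma E_cases:
  assumes "\<xi> \<in> E"
  obtains X where "X \<in> cauchy_seqs" "\<xi> = cls X"
  using assms unfolding E_def by (rule quotientE)

lemma self_in_cls: "X \<in> cauchy_seqs \<Longrightarrow> X \<in> cls X"
  by (rule equiv_class_self[OF equiv_equiv_seqs])

lemma cls_eq: "(X, Y) \<in> equiv_seqs \<Longrightarrow> cls X = cls Y"
  by (rule equiv_class_eq[OF equiv_equiv_seqs])

text \<open>Operations on \<open>E\<close> are unions over all representatives. Once the class of
  the result does not depend on the representative, the union collapses to a single term.\<close>

lemma UN_cls:
  assumes "X \<in> cauchy_seqs" "\<And>Y. (X, Y) \<in> equiv_seqs \<Longrightarrow> f Y = f X"
  shows "(\<Union>Y\<in>cls X. f Y) = f X"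
  by (rule UN_constant_eq[OF self_in_cls[OF assms(1)]]) (simp add: assms(2))

lemma norm2_Cauchy:
  assumes X: "X \<in> cauchy_seqs"
  shows "Cauchy (\<lambda>k. norm2 (X k))"
proof (rule metric_CauchyI)
  fix e :: real assume "e > 0"
  then obtain N where N: "\<And>j k. j \<ge> N \<Longrightarrow> k \<ge> N \<Longrightarrow> norm2 (\<lambda>x. X j x - X k x) < e"
    using cauchy_seqsD[OF X] by meson
  have "dist (norm2 (X j)) (norm2 (X k)) < e" if "j \<ge> N" "k \<ge> N" for j k
    using norm2_diff_le[OF cauchy_seqs_schwartz[OF X, of j] cauchy_seqs_schwartz[OF X, of k]] N[OF that]
    by (simp add: dist_real_def)
  then show "\<exists>M. \<forall>m\<ge>M. \<forall>n\<ge>M. dist (norm2 (X m)) (norm2 (X n)) < e" by blast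
qed

text \<open>\<open>norm_E\<close> describes the common limit over all representatives, so equivalent
  sequences must be shown to have the same one.\<close>

lemma norm_E_tendsto:
  assumes X: "X \<in> cauchy_seqs"
  shows "(\<lambda>k. norm2 (X k)) \<longlonglongrightarrow> norm_E (cls X)"
proof -
  obtain r where r: "(\<lambda>k. norm2 (X k)) \<longlonglongrightarrow> r"
    using norm2_Cauchy[OF X] Cauchy_convergent convergentD by blast
  have all: "(\<lambda>k. norm2 (Y k)) \<longlonglongrightarrow> r" if "Y \<in> cls X" for Y
  proof -
    have XY: "(X, Y) \<in> equiv_seqs" using that by simp
    have "(\<lambda>k. norm2 (Y k) - norm2 (X k)) \<longlonglongrightarrow> 0"
    proof (rule Lim_null_comparison[OF always_eventually equiv_seqsD(3)[OF XY]], intro allI)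
      fix k
      show "norm (norm2 (Y k) - norm2 (X k)) \<le> norm2 (\<lambda>x. X k x - Y k x)"
        using norm2_diff_le[of "X k" "Y k"] equiv_seqsD(1,2)[OF XY]
        by (simp add: cauchy_seqs_schwartz abs_minus_commute)
    qed
    from tendsto_add[OF this r] show ?thesis by simp
  qed
  have "norm_E (cls X) = r"
    unfolding norm_E_def
  proof (rule the_equality)
    show "\<forall>Y\<in>cls X. (\<lambda>k. norm2 (Y k)) \<longlonglongrightarrow> r" using all by blast
    show "s = r" if "\<forall>Y\<in>cls X. (\<lambda>k. norm2 (Y k)) \<longlonglongrightarrow> s" for s
      using that self_in_cls[OF X] r LIMSEQ_unique by blast
  qed
  with r show ?thesis by simp
qed

lemma norm_E_nonneg: "\<xi> \<in> E \<Longrightarrow> 0 \<le> norm_E \<xi>"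
proof -
  assume "\<xi> \<in> E"
  then obtain X where X: "X \<in> cauchy_seqs" "\<xi> = cls X" by (rule E_cases)
  show ?thesis unfolding X(2)
    by (rule LIMSEQ_le_const[OF norm_E_tendsto[OF X(1)]]) (simp add: norm2_nonneg)
qed

text \<open>Cauchy-Schwarz for the two terms of <f - f', g> + <f', g - g'>. It gives both
  convergence of inner products and independence of representatives.\<close>

lemma schwartz_inner_diff_le:
  fixes f g f' g' :: "real ^ 'n::finite \<Rightarrow> 'c::cstar_algebra"
  assumes "f \<in> schwartz" "g \<in> schwartz" "f' \<in> schwartz" "g' \<in> schwartz"
  shows "norm (schwartz_inner f g - schwartz_inner f' g')
    \<le> norm2 (\<lambda>x. f x - f' x) * norm2 g + norm2 f' * norm2 (\<lambda>x. g x - g' x)"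
proof -
  have d: "decaying f" "decaying g" "decaying f'" "decaying g'"
    "decaying (\<lambda>x. f x - f' x)" "decaying (\<lambda>x. g x - g' x)"
    using assms by (auto intro!: schwartz_decaying schwartz_diff)
  have right: "schwartz_inner h (\<lambda>x. p x - q x) = schwartz_inner h p - schwartz_inner h q"
    if "decaying h" "decaying p" "decaying q" for h p q :: "real^'n \<Rightarrow> 'c"
    using that unfolding schwartz_inner_def right_diff_distrib
    by (intro integral_diff decaying_integrable decaying_star_mult)
  have "schwartz_inner (\<lambda>x. f x - f' x) g = schwartz_inner f g - schwartz_inner f' g"
    unfolding schwartz_inner_def star_diff left_diff_distrib
    by (intro integral_diff decaying_integrable decaying_star_mult d)
  then have "schwartz_inner f g - schwartz_inner f' g'
      = schwartz_inner (\<lambda>x. f x - f' x) g + schwartz_inner f' (\<lambda>x. g x - g' x)"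
    by (simp add: right d)
  then show ?thesis
    using norm_triangle_mono[OF schwartz_inner_Cauchy_Schwarz[OF d(5,2)] schwartz_inner_Cauchy_Schwarz[OF d(3,6)]]
    by simp
qed

lemma inner_E_tendsto:
  fixes X Y :: "('c::cstar_algebra, 'n::finite) schwartz_seq"
  assumes X: "X \<in> cauchy_seqs" and Y: "Y \<in> cauchy_seqs"
  shows "(\<lambda>k. schwartz_inner (X k) (Y k)) \<longlonglongrightarrow> inner_E (cls X) (cls Y)"
proof -
  note s = cauchy_seqs_schwartz
  have bdd: "\<exists>K>0. \<forall>k. norm2 (Z k) \<le> K" if "Z \<in> cauchy_seqs" for Z :: "('c, 'n) schwartz_seq"
  proof -
    have "Bseq (\<lambda>k. norm2 (Z k))" by (rule Cauchy_Bseq[OF norm2_Cauchy[OF that]])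
    then show ?thesis unfolding Bseq_def by (auto simp: norm2_nonneg)
  qed
  obtain K where K: "K > 0" "\<And>k. norm2 (X k) \<le> K" using bdd[OF X] by blast
  obtain M where M: "M > 0" "\<And>k. norm2 (Y k) \<le> M" using bdd[OF Y] by blast
  have "Cauchy (\<lambda>k. schwartz_inner (X k) (Y k))"
  proof (rule CauchyI)
    fix e :: real assume e: "e > 0"
    obtain N1 where N1: "\<And>j k. j \<ge> N1 \<Longrightarrow> k \<ge> N1 \<Longrightarrow> norm2 (\<lambda>x. X j x - X k x) < e / (2 * M)"
      using cauchy_seqsD[OF X, of "e / (2 * M)"] e M by (meson divide_pos_pos mult_pos_pos zero_less_numeral)
    obtain N2 where N2: "\<And>j k. j \<ge> N2 \<Longrightarrow> k \<ge> N2 \<Longrightarrow> norm2 (\<lambda>x. Y j x - Y k x) < e / (2 * K)"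
      using cauchy_seqsD[OF Y, of "e / (2 * K)"] e K by (meson divide_pos_pos mult_pos_pos zero_less_numeral)
    have "norm (schwartz_inner (X j) (Y j) - schwartz_inner (X k) (Y k)) < e"
      if "j \<ge> max N1 N2" "k \<ge> max N1 N2" for j k
    proof -
      have "norm2 (\<lambda>x. X j x - X k x) * norm2 (Y j) \<le> norm2 (\<lambda>x. X j x - X k x) * M"
        by (intro mult_left_mono M norm2_nonneg)
      also have "\<dots> < e / (2 * M) * M" using N1[of j k] that M by (intro mult_strict_right_mono) auto
      also have "\<dots> = e / 2" using M by simp
      finally have 1: "norm2 (\<lambda>x. X j x - X k x) * norm2 (Y j) < e / 2" .
      have "norm2 (X k) * norm2 (\<lambda>x. Y j x - Y k x) \<le> K * norm2 (\<lambda>x. Y j x - Y k x)"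
        by (intro mult_right_mono K norm2_nonneg)
      also have "\<dots> < K * (e / (2 * K))" using N2[of j k] that K by (intro mult_strict_left_mono) auto
      also have "\<dots> = e / 2" using K by simp
      finally show ?thesis
        using 1 schwartz_inner_diff_le[OF s[OF X, of j] s[OF Y, of j] s[OF X, of k] s[OF Y, of k]] by linarith
    qed
    then show "\<exists>N. \<forall>m\<ge>N. \<forall>n\<ge>N. norm (schwartz_inner (X m) (Y m) - schwartz_inner (X n) (Y n)) < e" by blast
  qed
  then obtain c where c: "(\<lambda>k. schwartz_inner (X k) (Y k)) \<longlonglongrightarrow> c"
    using Cauchy_convergent convergentD by blast
  have all: "(\<lambda>k. schwartz_inner (X' k) (Y' k)) \<longlonglongrightarrow> c" if "X' \<in> cls X" "Y' \<in> cls Y" for X' Y'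
  proof -
    have XX: "(X, X') \<in> equiv_seqs" and YY: "(Y, Y') \<in> equiv_seqs" using that by simp_all
    note X' = equiv_seqsD(2)[OF XX] and Y' = equiv_seqsD(2)[OF YY]
    obtain K' where K': "\<And>k. norm2 (X' k) \<le> K'" using bdd[OF X'] by blast
    have "(\<lambda>k. schwartz_inner (X k) (Y k) - schwartz_inner (X' k) (Y' k)) \<longlonglongrightarrow> 0"
    proof (rule Lim_null_comparison[OF always_eventually], intro allI)
      fix k
      show "norm (schwartz_inner (X k) (Y k) - schwartz_inner (X' k) (Y' k))
        \<le> norm2 (\<lambda>x. X k x - X' k x) * M + K' * norm2 (\<lambda>x. Y k x - Y' k x)"
        using schwartz_inner_diff_le[OF s[OF X, of k] s[OF Y, of k] s[OF X', of k] s[OF Y', of k]]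
          mult_left_mono[OF M(2)[of k] norm2_nonneg[of "\<lambda>x. X k x - X' k x"]]
          mult_right_mono[OF K'[of k] norm2_nonneg[of "\<lambda>x. Y k x - Y' k x"]] by linarith
      show "(\<lambda>k. norm2 (\<lambda>x. X k x - X' k x) * M + K' * norm2 (\<lambda>x. Y k x - Y' k x)) \<longlonglongrightarrow> 0"
        using tendsto_add[OF tendsto_mult_right[OF equiv_seqsD(3)[OF XX]] tendsto_mult_left[OF equiv_seqsD(3)[OF YY]]]
        by simp
    qed
    from tendsto_diff[OF c this] show ?thesis by simp
  qed
  have "inner_E (cls X) (cls Y) = c"
    unfolding inner_E_def
  proof (rule the_equality)
    show "\<forall>X'\<in>cls X. \<forall>Y'\<in>cls Y. (\<lambda>k. schwartz_inner (X' k) (Y' k)) \<longlonglongrightarrow> c" using all by blast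
    show "d = c" if "\<forall>X'\<in>cls X. \<forall>Y'\<in>cls Y. (\<lambda>k. schwartz_inner (X' k) (Y' k)) \<longlonglongrightarrow> d" for d
      using that self_in_cls[OF X] self_in_cls[OF Y] c LIMSEQ_unique by blast
  qed
  with c show ?thesis by simp
qed

section \<open>Operations that descend to the completion\<close>

lemma cauchy_seqs_add:
  assumes X: "X \<in> cauchy_seqs" and Y: "Y \<in> cauchy_seqs"
  shows "(\<lambda>k x. X k x + Y k x) \<in> cauchy_seqs"
  unfolding cauchy_seqs_def
proof (intro CollectI conjI allI impI)
  note s = cauchy_seqs_schwartz
  show "(\<lambda>x. X k x + Y k x) \<in> schwartz" for k by (intro schwartz_add s X Y)
  fix e :: real assume "e > 0"
  then have e2: "e / 2 > 0" by simp
  obtain N1 where N1: "\<And>j k. j \<ge> N1 \<Longrightarrow> k \<ge> N1 \<Longrightarrow> norm2 (\<lambda>x. X j x - X k x) < e / 2"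
    using cauchy_seqsD[OF X e2] by meson
  obtain N2 where N2: "\<And>j k. j \<ge> N2 \<Longrightarrow> k \<ge> N2 \<Longrightarrow> norm2 (\<lambda>x. Y j x - Y k x) < e / 2"
    using cauchy_seqsD[OF Y e2] by meson
  show "\<exists>N. \<forall>j\<ge>N. \<forall>k\<ge>N. norm2 (\<lambda>x. X j x + Y j x - (X k x + Y k x)) < e"
  proof (intro exI[of _ "max N1 N2"] allI impI)
    fix j k assume "j \<ge> max N1 N2" "k \<ge> max N1 N2"
    then have "norm2 (\<lambda>x. X j x - X k x) + norm2 (\<lambda>x. Y j x - Y k x) < e"
      using N1[of j k] N2[of j k] by simp
    then show "norm2 (\<lambda>x. X j x + Y j x - (X k x + Y k x)) < e"
      using norm2_add[of "\<lambda>x. X j x - X k x" "\<lambda>x. Y j x - Y k x"]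
      by (simp add: schwartz_decaying schwartz_diff s[OF X] s[OF Y] algebra_simps)
  qed
qed

lemma add_E_cls:
  assumes X: "X \<in> cauchy_seqs" and Y: "Y \<in> cauchy_seqs"
  shows "add_E (cls X) (cls Y) = cls (\<lambda>k x. X k x + Y k x)"
proof -
  note s = cauchy_seqs_schwartz
  have eq: "cls (\<lambda>k x. X' k x + Y' k x) = cls (\<lambda>k x. X k x + Y k x)"
    if XX: "(X, X') \<in> equiv_seqs" and YY: "(Y, Y') \<in> equiv_seqs" for X' Y'
  proof (rule cls_eq[symmetric], rule equiv_seqsI)
    note X' = equiv_seqsD(2)[OF XX] and Y' = equiv_seqsD(2)[OF YY]
    show "(\<lambda>k x. X k x + Y k x) \<in> cauchy_seqs" "(\<lambda>k x. X' k x + Y' k x) \<in> cauchy_seqs"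
      by (intro cauchy_seqs_add X Y X' Y')+
    have "(\<lambda>k. norm2 (\<lambda>x. X k x - X' k x) + norm2 (\<lambda>x. Y k x - Y' k x)) \<longlonglongrightarrow> 0"
      using tendsto_add[OF equiv_seqsD(3)[OF XX] equiv_seqsD(3)[OF YY]] by simp
    moreover have "norm2 (\<lambda>x. X k x + Y k x - (X' k x + Y' k x))
        \<le> norm2 (\<lambda>x. X k x - X' k x) + norm2 (\<lambda>x. Y k x - Y' k x)" for k
      using norm2_add[of "\<lambda>x. X k x - X' k x" "\<lambda>x. Y k x - Y' k x"]
      by (simp add: schwartz_decaying schwartz_diff s[OF X] s[OF Y] s[OF X'] s[OF Y'] algebra_simps)
    ultimately show "(\<lambda>k. norm2 (\<lambda>x. X k x + Y k x - (X' k x + Y' k x))) \<longlonglongrightarrow> 0"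
      by (intro null_le[OF norm2_nonneg])
  qed
  have "(\<Union>Y'\<in>cls Y. cls (\<lambda>k x. X' k x + Y' k x)) = cls (\<lambda>k x. X k x + Y k x)"
    if "(X, X') \<in> equiv_seqs" for X'
    using eq[OF that] eq[OF that, of Y] self_in_cls[OF Y] by (subst UN_cls[OF Y]) auto
  then show ?thesis
    unfolding add_E_def using self_in_cls[OF X] by (subst UN_cls[OF X]) auto
qed

text \<open>A common frame for scalar multiplication and multiplication by \<open>f\<close>: a
  Lipschitz bound preserves Cauchy sequences and null sequences.\<close>

locale lipschitz_operation =
  fixes \<phi> :: "(real ^ 'n::finite \<Rightarrow> 'c) \<Rightarrow> real ^ 'n \<Rightarrow> 'c::cstar_algebra" and K :: real
  assumes schwartz: "g \<in> schwartz \<Longrightarrow> \<phi> g \<in> schwartz"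
    and lipschitz: "g \<in> schwartz \<Longrightarrow> h \<in> schwartz \<Longrightarrow>
      norm2 (\<lambda>x. \<phi> g x - \<phi> h x) \<le> K * norm2 (\<lambda>x. g x - h x)"
begin

lemma cauchy:
  assumes X: "X \<in> cauchy_seqs"
  shows "(\<lambda>k. \<phi> (X k)) \<in> cauchy_seqs"
  unfolding cauchy_seqs_def
proof (intro CollectI conjI allI impI)
  note s = cauchy_seqs_schwartz[OF X]
  show "\<phi> (X k) \<in> schwartz" for k by (intro schwartz s)
  fix e :: real assume "e > 0"
  \<comment> \<open>No sign of \<open>K\<close> is assumed, so the positive number
    \<open>\<bar>K\<bar> + 1\<close> replaces it as divisor.\<close>
  then have e: "e / (\<bar>K\<bar> + 1) > 0" by simp
  obtain N where N: "\<And>j k. j \<ge> N \<Longrightarrow> k \<ge> N \<Longrightarrow> norm2 (\<lambda>x. X j x - X k x) < e / (\<bar>K\<bar> + 1)"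
    using cauchy_seqsD[OF X e] by meson
  have "norm2 (\<lambda>x. \<phi> (X j) x - \<phi> (X k) x) < e" if "j \<ge> N" "k \<ge> N" for j k
  proof -
    have "norm2 (\<lambda>x. \<phi> (X j) x - \<phi> (X k) x) \<le> K * norm2 (\<lambda>x. X j x - X k x)" by (intro lipschitz s)
    also have "\<dots> \<le> (\<bar>K\<bar> + 1) * norm2 (\<lambda>x. X j x - X k x)"
      by (intro mult_right_mono norm2_nonneg) simp
    also have "\<dots> < (\<bar>K\<bar> + 1) * (e / (\<bar>K\<bar> + 1))"
      using N[OF that] by (intro mult_strict_left_mono) auto
    also have "\<dots> = e" by simp
    finally show ?thesis .
  qed
  then show "\<exists>N. \<forall>j\<ge>N. \<forall>k\<ge>N. norm2 (\<lambda>x. \<phi> (X j) x - \<phi> (X k) x) < e" by blast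
qed

lemma UN_eq:
  assumes X: "X \<in> cauchy_seqs"
  shows "(\<Union>Y\<in>cls X. cls (\<lambda>k. \<phi> (Y k))) = cls (\<lambda>k. \<phi> (X k))"
proof (rule UN_cls[OF X], rule cls_eq[symmetric], rule equiv_seqsI)
  fix Y assume XY: "(X, Y) \<in> equiv_seqs"
  note Y = equiv_seqsD(2)[OF XY]
  show "(\<lambda>k. \<phi> (X k)) \<in> cauchy_seqs" "(\<lambda>k. \<phi> (Y k)) \<in> cauchy_seqs" by (intro cauchy X Y)+
  have "(\<lambda>k. K * norm2 (\<lambda>x. X k x - Y k x)) \<longlonglongrightarrow> 0"
    using tendsto_mult_left[OF equiv_seqsD(3)[OF XY], of K] by simp
  then show "(\<lambda>k. norm2 (\<lambda>x. \<phi> (X k) x - \<phi> (Y k) x)) \<longlonglongrightarrow> 0"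
    by (rule null_le[OF norm2_nonneg lipschitz[OF cauchy_seqs_schwartz[OF X] cauchy_seqs_schwartz[OF Y]]])
qed

end

lemma lipschitz_scaleC:
  "lipschitz_operation (\<lambda>g x. c *\<^sub>C g x :: 'c::cstar_algebra) (cmod c :: real)"
proof
  fix g h :: "real ^ 'n::finite \<Rightarrow> 'c" assume "g \<in> schwartz" "h \<in> schwartz"
  then show "norm2 (\<lambda>x. c *\<^sub>C g x - c *\<^sub>C h x) \<le> cmod c * norm2 (\<lambda>x. g x - h x)"
    unfolding scaleC_diff_right[symmetric]
    by (subst norm2_scaleC) (auto intro!: schwartz_decaying schwartz_diff)
qed (rule schwartz_scaleC)

lemma lipschitz_mult:
  fixes f :: "real ^ 'n::finite \<Rightarrow> 'c::cstar_algebra"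
  assumes f: "f \<in> smooth_bounded" and M: "\<And>x. norm (f x) \<le> M"
  shows "lipschitz_operation (\<lambda>g x. f x * g x) M"
proof
  fix g h :: "real ^ 'n \<Rightarrow> 'c" assume gh: "g \<in> schwartz" "h \<in> schwartz"
  then show "norm2 (\<lambda>x. f x * g x - f x * h x) \<le> M * norm2 (\<lambda>x. g x - h x)"
    unfolding right_diff_distrib[symmetric]
    by (intro norm2_mult M schwartz_decaying schwartz_mult[OF f] schwartz_diff)
qed (rule schwartz_mult[OF f])

lemma scaleC_E_cls: "X \<in> cauchy_seqs \<Longrightarrow> scaleC_E c (cls X) = cls (\<lambda>k x. c *\<^sub>C X k x)"
  unfolding scaleC_E_def by (rule lipschitz_operation.UN_eq[OF lipschitz_scaleC])

lemma cauchy_seqs_scaleC: "X \<in> cauchy_seqs \<Longrightarrow> (\<lambda>k x. c *\<^sub>C X k x) \<in> cauchy_seqs"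
  by (rule lipschitz_operation.cauchy[OF lipschitz_scaleC])

lemma diff_E_cls:
  assumes "X \<in> cauchy_seqs" "Y \<in> cauchy_seqs"
  shows "add_E (cls X) (scaleC_E (- 1) (cls Y)) = cls (\<lambda>k x. X k x - Y k x)"
    and "(\<lambda>k x. X k x - Y k x) \<in> cauchy_seqs"
  using add_E_cls[OF assms(1) cauchy_seqs_scaleC[OF assms(2)], of "- 1"] scaleC_E_cls[OF assms(2), of "- 1"]
    cauchy_seqs_add[OF assms(1) cauchy_seqs_scaleC[OF assms(2)], of "- 1"]
  by (simp_all add: scaleC_minus_left)

section \<open>Uniqueness of the extension from Schwartz functions\<close>

lemma cauchy_seqs_const: "g \<in> schwartz \<Longrightarrow> (\<lambda>k. g) \<in> cauchy_seqs"
  by (simp add: cauchy_seqs_def)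

lemma norm_E_embed: "g \<in> schwartz \<Longrightarrow> norm_E (embed_E g) = norm2 g"
  unfolding embed_E_def using norm_E_tendsto[OF cauchy_seqs_const] LIMSEQ_const_iff by metis

text \<open>The class of X is approximated by the embedded terms X N. Both operators have the same
  value there, so their values at the class differ by at most the sum of their bounds times the
  distance.\<close>

lemma operators_E_eqI:
  fixes S T :: "('c::cstar_algebra, 'n::finite) schwartz_seq set \<Rightarrow> ('c, 'n) schwartz_seq set"
  assumes S: "S \<in> operators_E" and T: "T \<in> operators_E"
    and eq: "\<And>g. g \<in> schwartz \<Longrightarrow> S (embed_E g) = T (embed_E g)"
  shows "S = T"
proof (rule extensionalityI)
  show "S \<in> extensional E" "T \<in> extensional E" using S T by (auto simp: operators_E_def PiE_def)
  fix \<xi> :: "('c, 'n) schwartz_seq set" assume xi: "\<xi> \<in> E"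
  then obtain X where X: "X \<in> cauchy_seqs" "\<xi> = cls X" by (rule E_cases)
  have in_E: "S \<eta> \<in> E" "T \<eta> \<in> E" if "\<eta> \<in> E" for \<eta> using S T that by (auto simp: operators_E_def)
  obtain Y where Y: "Y \<in> cauchy_seqs" "S \<xi> = cls Y" using in_E(1)[OF xi] by (rule E_cases)
  obtain Z where Z: "Z \<in> cauchy_seqs" "T \<xi> = cls Z" using in_E(2)[OF xi] by (rule E_cases)
  have bdd: "\<exists>B\<ge>0. \<forall>\<xi>\<in>E. norm_E (U \<xi>) \<le> B * norm_E \<xi>" if U: "U \<in> operators_E"
    for U :: "('c, 'n) schwartz_seq set \<Rightarrow> ('c, 'n) schwartz_seq set"
  proof -
    obtain B where B: "\<And>\<xi>. \<xi> \<in> E \<Longrightarrow> norm_E (U \<xi>) \<le> B * norm_E \<xi>"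
      using U unfolding operators_E_def bounded_E_def by blast
    have "norm_E (U \<xi>) \<le> \<bar>B\<bar> * norm_E \<xi>" if "\<xi> \<in> E" for \<xi>
      using B[OF that] norm_E_nonneg[OF that] by (meson abs_ge_self mult_right_mono order_trans)
    then show ?thesis by (intro exI[of _ "\<bar>B\<bar>"]) auto
  qed
  obtain B where B: "B \<ge> 0" "\<And>\<xi>. \<xi> \<in> E \<Longrightarrow> norm_E (S \<xi>) \<le> B * norm_E \<xi>" using bdd[OF S] by blast
  obtain C where C: "C \<ge> 0" "\<And>\<xi>. \<xi> \<in> E \<Longrightarrow> norm_E (T \<xi>) \<le> C * norm_E \<xi>" using bdd[OF T] by blast
  note YZ = diff_E_cls(2)[OF Y(1) Z(1)]
  have small: "norm_E (cls (\<lambda>k x. Y k x - Z k x)) \<le> (B + C) * e" if e: "e > 0" for e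
  proof -
    obtain N where N: "\<And>j k. j \<ge> N \<Longrightarrow> k \<ge> N \<Longrightarrow> norm2 (\<lambda>x. X j x - X k x) < e"
      using cauchy_seqsD[OF X(1) e] by meson
    have XN: "(\<lambda>k. X N) \<in> cauchy_seqs" by (intro cauchy_seqs_const cauchy_seqs_schwartz X)
    have eta: "embed_E (X N) \<in> E" unfolding embed_E_def by (rule cls_in_E[OF XN])
    obtain W where W: "W \<in> cauchy_seqs" "S (embed_E (X N)) = cls W" using in_E(1)[OF eta] by (rule E_cases)
    have TW: "T (embed_E (X N)) = cls W" using W(2) eq[OF cauchy_seqs_schwartz[OF X(1)]] by simp
    \<comment> \<open>The difference is written with \<open>add_E\<close> and
      \<open>scaleC_E\<close>, the operations that \<open>linear_E\<close> speaks about.\<close>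
    let ?D = "add_E \<xi> (scaleC_E (- 1) (embed_E (X N)))"
    have D: "?D = cls (\<lambda>k x. X k x - X N x)" "(\<lambda>k x. X k x - X N x) \<in> cauchy_seqs"
      unfolding embed_E_def X(2) by (rule diff_E_cls[OF X(1) XN])+
    have DE: "?D \<in> E" unfolding D(1) by (rule cls_in_E[OF D(2)])
    have sE: "scaleC_E (- 1) (embed_E (X N)) \<in> E"
      unfolding embed_E_def scaleC_E_cls[OF XN] by (intro cls_in_E cauchy_seqs_scaleC XN)
    have nD: "norm_E ?D \<le> e"
      unfolding D(1)
      by (rule LIMSEQ_le_const2[OF norm_E_tendsto[OF D(2)]]) (use N in \<open>auto intro!: exI[of _ N] less_imp_le\<close>)
    have lin: "U ?D = add_E (U \<xi>) (scaleC_E (- 1) (U (embed_E (X N))))" if "U \<in> operators_E"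
      for U :: "('c, 'n) schwartz_seq set \<Rightarrow> ('c, 'n) schwartz_seq set"
      using that xi sE eta unfolding operators_E_def linear_E_def by simp
    have SD: "S ?D = cls (\<lambda>k x. Y k x - W k x)"
      unfolding lin[OF S] Y(2) W(2) by (rule diff_E_cls[OF Y(1) W(1)])
    have TD: "T ?D = cls (\<lambda>k x. Z k x - W k x)"
      unfolding lin[OF T] Z(2) TW by (rule diff_E_cls[OF Z(1) W(1)])
    note lY = norm_E_tendsto[OF diff_E_cls(2)[OF Y(1) W(1)]] and lZ = norm_E_tendsto[OF diff_E_cls(2)[OF Z(1) W(1)]]
    have "norm_E (cls (\<lambda>k x. Y k x - Z k x)) \<le> norm_E (S ?D) + norm_E (T ?D)"
    proof (rule LIMSEQ_le[OF norm_E_tendsto[OF YZ]])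
      show "(\<lambda>k. norm2 (\<lambda>x. Y k x - W k x) + norm2 (\<lambda>x. Z k x - W k x)) \<longlonglongrightarrow> norm_E (S ?D) + norm_E (T ?D)"
        unfolding SD TD by (rule tendsto_add[OF lY lZ])
      show "\<exists>N. \<forall>k\<ge>N. norm2 (\<lambda>x. Y k x - Z k x) \<le> norm2 (\<lambda>x. Y k x - W k x) + norm2 (\<lambda>x. Z k x - W k x)"
        using norm2_diff_triangle[OF cauchy_seqs_schwartz[OF Y(1)] cauchy_seqs_schwartz[OF W(1)] cauchy_seqs_schwartz[OF Z(1)]]
          norm2_minus_commute[of "Z _" "W _"] by simp
    qed
    also have "\<dots> \<le> B * norm_E ?D + C * norm_E ?D" by (intro add_mono B C DE)
    also have "\<dots> \<le> (B + C) * e"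
      using mult_left_mono[OF nD B(1)] mult_left_mono[OF nD C(1)] by (simp add: algebra_simps)
    finally show ?thesis .
  qed
  have "norm_E (cls (\<lambda>k x. Y k x - Z k x)) \<le> 0"
  proof (rule field_le_epsilon)
    fix e :: real assume e: "e > 0"
    \<comment> \<open>Adding 1 in the denominator covers the case that both bounds are 0.\<close>
    have "norm_E (cls (\<lambda>k x. Y k x - Z k x)) \<le> (B + C) * (e / (B + C + 1))"
      using e B(1) C(1) by (intro small) (simp add: add_nonneg_pos)
    also have "\<dots> \<le> e" using e B(1) C(1) by (simp add: field_simps)
    finally show "norm_E (cls (\<lambda>k x. Y k x - Z k x)) \<le> 0 + e" by simp
  qed
  then have "norm_E (cls (\<lambda>k x. Y k x - Z k x)) = 0"
    using norm_E_nonneg[OF cls_in_E[OF YZ]] by simp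
  then have "(\<lambda>k. norm2 (\<lambda>x. Y k x - Z k x)) \<longlonglongrightarrow> 0" using norm_E_tendsto[OF YZ] by simp
  then have "cls Y = cls Z" by (intro cls_eq equiv_seqsI Y Z)
  then show "S \<xi> = T \<xi>" using Y Z by simp
qed

text \<open>The candidate for \<open>L f\<close>. It is restricted to \<open>E\<close> because
  operators are extensional, so that it can equal \<open>L f\<close> as a function.\<close>

definition mult_op :: "(real ^ 'n::finite \<Rightarrow> 'c::cstar_algebra) \<Rightarrow>
    ('c, 'n) schwartz_seq set \<Rightarrow> ('c, 'n) schwartz_seq set" where
  "mult_op f = (\<lambda>\<xi>\<in>E. \<Union>X\<in>\<xi>. cls (\<lambda>k x. f x * X k x))"

context
  fixes f :: "real ^ 'n::finite \<Rightarrow> 'c::cstar_algebra" and M :: real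
  assumes f: "f \<in> smooth_bounded" and M: "\<And>x. norm (f x) \<le> M"
begin

lemma mult_cauchy: "X \<in> cauchy_seqs \<Longrightarrow> (\<lambda>k x. f x * X k x) \<in> cauchy_seqs"
  by (rule lipschitz_operation.cauchy[OF lipschitz_mult[OF f M]])

lemma mult_op_cls: "X \<in> cauchy_seqs \<Longrightarrow> mult_op f (cls X) = cls (\<lambda>k x. f x * X k x)"
  using lipschitz_operation.UN_eq[OF lipschitz_mult[OF f M]] by (simp add: mult_op_def cls_in_E)

lemma mult_op_in_E: "\<xi> \<in> E \<Longrightarrow> mult_op f \<xi> \<in> E"
proof -
  assume "\<xi> \<in> E"
  then obtain X where X: "X \<in> cauchy_seqs" "\<xi> = cls X" by (rule E_cases)
  show ?thesis unfolding X(2) mult_op_cls[OF X(1)] by (rule cls_in_E[OF mult_cauchy[OF X(1)]])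
qed

lemma norm_mult_op_le:
  assumes "\<xi> \<in> E"
  shows "norm_E (mult_op f \<xi>) \<le> M * norm_E \<xi>"
proof -
  obtain X where X: "X \<in> cauchy_seqs" "\<xi> = cls X" using assms by (rule E_cases)
  note s = cauchy_seqs_schwartz[OF X(1)]
  show ?thesis
    unfolding X(2) mult_op_cls[OF X(1)]
  proof (rule LIMSEQ_le[OF norm_E_tendsto[OF mult_cauchy[OF X(1)]] tendsto_mult_left[OF norm_E_tendsto[OF X(1)]]])
    show "\<exists>N. \<forall>k\<ge>N. norm2 (\<lambda>x. f x * X k x) \<le> M * norm2 (X k)"
      by (intro exI[of _ 0] allI impI norm2_mult M schwartz_decaying schwartz_mult[OF f] s)
  qed
qed

lemma mult_op_embed: "g \<in> schwartz \<Longrightarrow> mult_op f (embed_E g) = embed_E (\<lambda>x. f x * g x)"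
  unfolding embed_E_def by (rule mult_op_cls[OF cauchy_seqs_const])

end

text \<open>The adjoint is multiplication by the pointwise star of f. The adjoint relation already
  holds for Schwartz functions, under the integral sign, and passes to limits.\<close>

lemma mult_op_operator:
  fixes f :: "real ^ 'n::finite \<Rightarrow> 'c::cstar_algebra"
  assumes f: "f \<in> smooth_bounded" and M: "\<And>x. norm (f x) \<le> M"
  shows "mult_op f \<in> operators_E"
  unfolding operators_E_def
proof (intro CollectI conjI)
  let ?f' = "\<lambda>x. star (f x)"
  have f': "?f' \<in> smooth_bounded" by (rule smooth_bounded_star[OF f])
  have M': "norm (?f' x) \<le> M" for x using M by simp
  note cls_f = mult_op_cls[OF f M] and cauchy_f = mult_cauchy[OF f M]
  show "mult_op f \<in> E \<rightarrow>\<^sub>E E"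
    using mult_op_in_E[OF f M] by (auto simp: mult_op_def)
  show "linear_E (mult_op f)"
    unfolding linear_E_def
  proof (intro conjI ballI allI)
    fix \<xi> \<eta> :: "('c, 'n) schwartz_seq set" and c assume xi: "\<xi> \<in> E" and eta: "\<eta> \<in> E"
    obtain X where X: "X \<in> cauchy_seqs" "\<xi> = cls X" using xi by (rule E_cases)
    obtain Y where Y: "Y \<in> cauchy_seqs" "\<eta> = cls Y" using eta by (rule E_cases)
    show "mult_op f (add_E \<xi> \<eta>) = add_E (mult_op f \<xi>) (mult_op f \<eta>)"
      unfolding X(2) Y(2) add_E_cls[OF X(1) Y(1)] cls_f[OF X(1)] cls_f[OF Y(1)]
        cls_f[OF cauchy_seqs_add[OF X(1) Y(1)]] add_E_cls[OF cauchy_f[OF X(1)] cauchy_f[OF Y(1)]]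
      by (simp add: distrib_left)
  next
    fix c and \<xi> :: "('c, 'n) schwartz_seq set" assume "\<xi> \<in> E"
    then obtain X where X: "X \<in> cauchy_seqs" "\<xi> = cls X" by (rule E_cases)
    show "mult_op f (scaleC_E c \<xi>) = scaleC_E c (mult_op f \<xi>)"
      unfolding X(2) scaleC_E_cls[OF X(1)] cls_f[OF X(1)] cls_f[OF cauchy_seqs_scaleC[OF X(1)]]
        scaleC_E_cls[OF cauchy_f[OF X(1)]]
      by (simp add: mult_scaleC_right)
  qed
  show "bounded_E (mult_op f)"
    unfolding bounded_E_def using norm_mult_op_le[OF f M] by blast
  show "adjointable_E (mult_op f)"
    unfolding adjointable_E_def
  proof (intro bexI ballI)
    show "mult_op ?f' \<in> E \<rightarrow> E" using mult_op_in_E[OF f' M'] by blast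
    fix \<xi> \<eta> :: "('c, 'n) schwartz_seq set" assume xi: "\<xi> \<in> E" and eta: "\<eta> \<in> E"
    obtain X where X: "X \<in> cauchy_seqs" "\<xi> = cls X" using xi by (rule E_cases)
    obtain Y where Y: "Y \<in> cauchy_seqs" "\<eta> = cls Y" using eta by (rule E_cases)
    have "schwartz_inner (\<lambda>x. f x * X k x) (Y k) = schwartz_inner (X k) (\<lambda>x. ?f' x * Y k x)" for k
      by (simp add: schwartz_inner_def star_mult mult.assoc)
    then show "inner_E (mult_op f \<xi>) \<eta> = inner_E \<xi> (mult_op ?f' \<eta>)"
      unfolding X(2) Y(2) cls_f[OF X(1)] mult_op_cls[OF f' M' Y(1)]
      using inner_E_tendsto[OF cauchy_f[OF X(1)] Y(1)] inner_E_tendsto[OF X(1) mult_cauchy[OF f' M' Y(1)]]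
      by (simp add: LIMSEQ_unique)
  qed
qed

lemma L_eq_mult_op:
  fixes f :: "real ^ 'n::finite \<Rightarrow> 'c::cstar_algebra"
  assumes f: "f \<in> smooth_bounded" and M: "\<And>x. norm (f x) \<le> M"
  shows "L f = mult_op f"
  unfolding L_def
proof (rule the_equality)
  show *: "mult_op f \<in> operators_E \<and> (\<forall>g\<in>schwartz. mult_op f (embed_E g) = embed_E (L_schwartz f g))"
    using mult_op_operator[OF f M] by (simp add: mult_op_embed[OF f M] L_schwartz_eq)
  show "T = mult_op f" if "T \<in> operators_E \<and> (\<forall>g\<in>schwartz. T (embed_E g) = embed_E (L_schwartz f g))" for T
    using that * by (intro operators_E_eqI) auto
qed

text \<open>Gaussians concentrating at \<open>x0\<close>, multiplied by \<open>star (f x0)\<close>, make \<open>norm (f x0)\<close> a lower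
  bound for the norm of multiplication by \<open>f\<close>.\<close>

lemma norm_le_of_norm2_mult_le:
  fixes f :: "real ^ 'n::finite \<Rightarrow> 'c::cstar_algebra"
  assumes f: "f \<in> smooth_bounded" and N: "0 \<le> N"
    and le: "\<And>g. g \<in> schwartz \<Longrightarrow> norm2 (\<lambda>x. f x * g x) \<le> N * norm2 g"
  shows "norm (f x0) \<le> N"
proof -
  let ?n = "CARD('n)"
  define c where "c = star (f x0)"
  define h where "h x = star (f x * c) * (f x * c)" for x
  have hc: "continuous_on UNIV h"
    unfolding h_def by (intro continuous_intros continuous_on_star smooth_bounded_continuous f)
  obtain M where M: "\<And>x. norm (f x) \<le> M" using smooth_bounded_bounded[OF f] by (auto simp: bounded_iff)
  have "norm (f x * c) \<le> M * norm c" for x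
    by (rule order_trans[OF norm_mult_ineq mult_right_mono[OF M norm_ge_zero]])
  then have "norm (h x) \<le> (M * norm c) * (M * norm c)" for x
    unfolding h_def norm_star_mult by (meson mult_mono norm_ge_zero order_trans)
  then have hb: "bounded (range h)" unfolding bounded_iff by blast
  have bound: "norm (integral UNIV (\<lambda>z. gauss z *\<^sub>R h (x0 + \<epsilon> *\<^sub>R z))) \<le> N\<^sup>2 * (norm c)\<^sup>2" if \<epsilon>: "\<epsilon> > 0" for \<epsilon>
  proof -
    \<comment> \<open>With this \<open>a\<close> the square of \<open>p\<close> is exp (- |x - x0|^2
      / (2 \<epsilon>^2)), up to a factor the normal density of width \<epsilon> around x0.\<close>
    define a where "a = 1 / (4 * \<epsilon>\<^sup>2)"
    have a: "a > 0" using \<epsilon> by (simp add: a_def)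
    define p where "p x = exp (- a * ((x - x0) \<bullet> (x - x0)))" for x
    define g where "g x = p x *\<^sub>R c" for x
    have g: "g \<in> schwartz" unfolding g_def p_def by (rule gaussian_schwartz[OF a])
    let ?s = "sqrt (2 * pi) ^ ?n"
    have gauss_eq: "gauss z = exp (- (z \<bullet> z) / 2) / ?s" for z :: "real^'n"
    proof -
      have "gauss z = (\<Prod>i\<in>(UNIV::'n set). exp (- (z $ i)\<^sup>2 / 2)) / ?s"
        by (simp add: gauss_def std_normal_density_def prod_dividef)
      also have "(\<Prod>i\<in>(UNIV::'n set). exp (- (z $ i)\<^sup>2 / 2)) = exp (\<Sum>i\<in>UNIV. - (z $ i)\<^sup>2 / 2)"
        by (simp add: exp_sum)
      also have "(\<Sum>i\<in>UNIV. - (z $ i)\<^sup>2 / 2) = - (z \<bullet> z) / 2"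
        by (simp add: inner_vec_def power2_eq_square sum_negf flip: sum_divide_distrib)
      finally show ?thesis .
    qed
    have p2: "p (x0 + \<epsilon> *\<^sub>R z) * p (x0 + \<epsilon> *\<^sub>R z) = ?s * gauss z" for z
      using \<epsilon> unfolding p_def gauss_eq by (simp add: a_def power2_eq_square flip: exp_add)
    \<comment> \<open>The substitution x = x0 + \<epsilon> z produces the same factor for g and for
      f g, so that it cancels from the inequality between their norms.\<close>
    have scale: "integral UNIV (\<lambda>x. (p x * p x) *\<^sub>R k x) = (?s * \<epsilon> ^ ?n) *\<^sub>R integral UNIV (\<lambda>z. gauss z *\<^sub>R k (x0 + \<epsilon> *\<^sub>R z))"
      if k: "decaying (\<lambda>x. (p x * p x) *\<^sub>R k x)" for k :: "real^'n \<Rightarrow> 'c"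
    proof -
      let ?F = "\<lambda>x. (p x * p x) *\<^sub>R k x"
      have "integral UNIV (\<lambda>z. ?F (\<epsilon> *\<^sub>R z + x0)) = integral UNIV ?F /\<^sub>R \<epsilon> ^ ?n"
        by (subst integral_affinity[OF decaying_integrable[OF k] \<epsilon>]) simp
      moreover have "?F (\<epsilon> *\<^sub>R z + x0) = ?s *\<^sub>R (gauss z *\<^sub>R k (x0 + \<epsilon> *\<^sub>R z))" for z
        using p2[of z] by (simp add: add.commute)
      ultimately have "integral UNIV ?F /\<^sub>R \<epsilon> ^ ?n = integral UNIV (\<lambda>z. ?s *\<^sub>R (gauss z *\<^sub>R k (x0 + \<epsilon> *\<^sub>R z)))"
        by (simp only:)
      also have "\<dots> = ?s *\<^sub>R integral UNIV (\<lambda>z. gauss z *\<^sub>R k (x0 + \<epsilon> *\<^sub>R z))"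
        by (rule integral_cmul)
      finally have "\<epsilon> ^ ?n *\<^sub>R (integral UNIV ?F /\<^sub>R \<epsilon> ^ ?n)
          = \<epsilon> ^ ?n *\<^sub>R (?s *\<^sub>R integral UNIV (\<lambda>z. gauss z *\<^sub>R k (x0 + \<epsilon> *\<^sub>R z)))" by simp
      then show ?thesis using \<epsilon> by (simp add: mult.commute)
    qed
    have e1: "star (g x) * g x = (p x * p x) *\<^sub>R (star c * c)" for x by (simp add: g_def star_scaleR)
    have e2: "star (f x * g x) * (f x * g x) = (p x * p x) *\<^sub>R h x" for x by (simp add: g_def h_def star_scaleR)
    have dg: "decaying g" and dfg: "decaying (\<lambda>x. f x * g x)"
      by (intro schwartz_decaying g schwartz_mult f)+
    have "schwartz_inner g g = (?s * \<epsilon> ^ ?n) *\<^sub>R integral UNIV (\<lambda>z::real^'n. gauss z *\<^sub>R (star c * c))"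
      unfolding schwartz_inner_def e1 using decaying_star_mult[OF dg dg] unfolding e1 by (rule scale)
    also have "integral UNIV (\<lambda>z::real^'n. gauss z *\<^sub>R (star c * c)) = star c * c"
      by (rule integral_unique[OF has_integral_scaleR_left[OF has_integral_gauss, of "star c * c", simplified]])
    finally have g2: "(norm2 g)\<^sup>2 = (?s * \<epsilon> ^ ?n) * (norm c)\<^sup>2"
      using \<epsilon> by (simp add: norm2_square cstar_identity)
    have "schwartz_inner (\<lambda>x. f x * g x) (\<lambda>x. f x * g x)
        = (?s * \<epsilon> ^ ?n) *\<^sub>R integral UNIV (\<lambda>z. gauss z *\<^sub>R h (x0 + \<epsilon> *\<^sub>R z))"
      unfolding schwartz_inner_def e2 using decaying_star_mult[OF dfg dfg] unfolding e2 by (rule scale)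
    then have "(?s * \<epsilon> ^ ?n) * norm (integral UNIV (\<lambda>z. gauss z *\<^sub>R h (x0 + \<epsilon> *\<^sub>R z))) = (norm2 (\<lambda>x. f x * g x))\<^sup>2"
      using \<epsilon> by (simp add: norm2_square)
    also have "\<dots> \<le> (N * norm2 g)\<^sup>2" by (intro power_mono le g norm2_nonneg)
    also have "\<dots> = (?s * \<epsilon> ^ ?n) * (N\<^sup>2 * (norm c)\<^sup>2)" by (simp add: power_mult_distrib g2)
    finally show ?thesis using \<epsilon> by (simp add: mult_le_cancel_left)
  qed
  have "(\<lambda>k. integral UNIV (\<lambda>z. gauss z *\<^sub>R h (x0 + inverse (real (Suc k)) *\<^sub>R z))) \<longlonglongrightarrow> h x0"
    by (rule gauss_average_tendsto[OF hc hb])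
  then have "norm (h x0) \<le> N\<^sup>2 * (norm c)\<^sup>2"
    by (rule LIMSEQ_le_const2[OF tendsto_norm]) (auto intro!: exI[of _ 0] bound)
  \<comment> \<open>\<open>h x0\<close> is the square of the selfadjoint
    \<open>f x0 * star (f x0)\<close>, so the C*-identity applies twice.\<close>
  moreover have "norm (h x0) = (norm (f x0))\<^sup>2 * (norm (f x0))\<^sup>2"
    using norm_star_mult[of "star (f x0)"]
    by (simp add: h_def c_def norm_star_mult star_star power2_eq_square)
  ultimately have "(norm (f x0))\<^sup>2 * (norm (f x0))\<^sup>2 \<le> N\<^sup>2 * (norm (f x0))\<^sup>2" by (simp add: c_def)
  \<comment> \<open>The common factor |f x0|^2 may be zero; then the claim holds because N is
    nonnegative.\<close>
  moreover have "a = 0 \<or> a \<le> b" if "a * a \<le> b * a" "0 \<le> a" for a b :: real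
    using that by (auto simp: mult_le_cancel_right)
  ultimately have "(norm (f x0))\<^sup>2 = 0 \<or> (norm (f x0))\<^sup>2 \<le> N\<^sup>2" using zero_le_power2 by blast
  then show ?thesis using N by (auto intro: power2_le_imp_le)
qed

text \<open>Testing on normalised embedded Schwartz functions already shows that the supremum N over
  the unit ball satisfies |f g|_2 <= N |g|_2, which is what the Gaussian argument needs.\<close>

theorem proposition3p15:
  fixes f :: "real ^ 'n::finite \<Rightarrow> 'c::cstar_algebra"
  assumes "f \<in> smooth_bounded"
  shows "(SUP x. norm (f x)) = opnorm_E (L f)"
proof -
  note f = assms
  let ?B = "{\<xi> \<in> E. norm_E \<xi> \<le> 1} :: ('c, 'n) schwartz_seq set set"
  define M where "M = (SUP x. norm (f x))"
  define N where "N = (SUP \<xi> \<in> ?B. norm_E (mult_op f \<xi>))"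
  obtain K where "\<And>x. norm (f x) \<le> K" using smooth_bounded_bounded[OF f] by (auto simp: bounded_iff)
  then have "bdd_above (range (\<lambda>x. norm (f x)))" by (rule bdd_aboveI2)
  then have M: "norm (f x) \<le> M" for x unfolding M_def by (rule cSUP_upper[OF UNIV_I])
  have M0: "0 \<le> M" by (rule order_trans[OF norm_ge_zero M])
  \<comment> \<open>The zero function arises as a multiple of a Gaussian. Its class makes
    \<open>?B\<close> nonempty and shows that N is nonnegative.\<close>
  have zero: "(\<lambda>x. 0) \<in> (schwartz :: (real^'n \<Rightarrow> 'c) set)"
    using schwartz_scaleR[OF gaussian_schwartz[of 1 0 0], of 0] by simp
  have emb: "embed_E g \<in> E" if "g \<in> schwartz" for g :: "real^'n \<Rightarrow> 'c"
    unfolding embed_E_def by (intro cls_in_E cauchy_seqs_const that)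
  have zB: "embed_E (\<lambda>x. 0) \<in> ?B" using emb[OF zero] norm_E_embed[OF zero] by simp
  have upper: "norm_E (mult_op f \<xi>) \<le> M" if "\<xi> \<in> ?B" for \<xi>
  proof -
    have "norm_E (mult_op f \<xi>) \<le> M * norm_E \<xi>" using that by (intro norm_mult_op_le[OF f M]) auto
    also have "\<dots> \<le> M" using that M0 by (intro mult_left_le) auto
    finally show ?thesis .
  qed
  then have bdd: "bdd_above ((\<lambda>\<xi>. norm_E (mult_op f \<xi>)) ` ?B)" by (rule bdd_aboveI2)
  have NM: "N \<le> M" unfolding N_def using zB upper by (intro cSUP_least) auto
  have NB: "norm_E (mult_op f \<xi>) \<le> N" if "\<xi> \<in> ?B" for \<xi>
    unfolding N_def by (rule cSUP_upper[OF that bdd])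
  have N0: "0 \<le> N"
    by (rule order_trans[OF norm_E_nonneg NB[OF zB]]) (intro mult_op_in_E[OF f M] emb zero)
  have "norm2 (\<lambda>x. f x * g x) \<le> N * norm2 g" if g: "g \<in> schwartz" for g
  \<comment> \<open>A g with \<open>norm2 g = 0\<close> cannot be normalised, but then the bound
    with M makes the left side vanish.\<close>
  proof (cases "norm2 g = 0")
    case True
    then show ?thesis
      using norm2_mult[of g f M] g M by (simp add: schwartz_decaying schwartz_mult f)
  next
    case False
    define r where "r = inverse (norm2 g)"
    have r: "r > 0" "r * norm2 g = 1" using False norm2_nonneg[of g] by (auto simp: r_def)
    let ?g = "\<lambda>x. r *\<^sub>R g x"
    have g': "?g \<in> schwartz" by (rule schwartz_scaleR[OF g])
    have "norm2 ?g = 1" using r by (simp add: norm2_scaleR schwartz_decaying g)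
    then have "embed_E ?g \<in> ?B" using emb[OF g'] by (simp add: norm_E_embed[OF g'])
    then have "norm_E (mult_op f (embed_E ?g)) \<le> N" by (rule NB)
    then have "norm2 (\<lambda>x. f x * ?g x) \<le> N"
      unfolding mult_op_embed[OF f M g'] norm_E_embed[OF schwartz_mult[OF f g']] .
    then have "r * norm2 (\<lambda>x. f x * g x) \<le> N"
      using norm2_scaleR[of "\<lambda>x. f x * g x" r] r by (simp add: schwartz_decaying schwartz_mult f g)
    then have "norm2 g * (r * norm2 (\<lambda>x. f x * g x)) \<le> norm2 g * N"
      by (rule mult_left_mono) (rule norm2_nonneg)
    then show ?thesis using r(2) by (simp add: mult.assoc[symmetric] mult.commute)
  qed
  then have "norm (f x) \<le> N" for x by (rule norm_le_of_norm2_mult_le[OF f N0])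
  then have "M \<le> N" unfolding M_def by (intro cSUP_least) auto
  with NM have "M = N" by simp
  then show ?thesis
    unfolding M_def N_def opnorm_E_def L_eq_mult_op[OF f M] .
qed

end
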